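(* (b) A bivariant vectorial FQ operation $\Xi$ is uniquely determined by its circular-basis coefficients $\tilde p^{[s]}_{4,\dots,4}$ ($s\in\{1,2\}$, all numbers of indices $\ge0$, the empty word giving the constant term), and these can be prescribed arbitrarily (i.e. for any choice of these real numbers there is exactly one bivariant vectorial FQ operation with these coefficients). (b') The same holds for antivariant vectorial FQ operations with the coefficients $\tilde p^{[s]}_{5,\dots,5}$, $s\in\{1,2\}$. (c) The same holds for left-variant scalar (resp. pseudoscalar) FQ operations with the coefficients $\tilde p^{[0]}_{4,\dots,4}$ (resp. $\tilde p^{[12]}_{4,\dots,4}$). (c') The same holds for right-variant scalar (resp. pseudoscalar) FQ operations with the coefficients $\tilde p^{[0]}_{5,\dots,5}$ (resp. $\tilde p^{[12]}_{5,\dots,5}$).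
   Context: Setting. $(Q_1,Q_2)$ is a Clifford system: $Q_1^2=Q_2^2=-1$, $Q_1Q_2=-Q_2Q_1$. $R_1,R_2$ are formal noncommuting infinitesimal variables; one works in the real algebra generated by $Q_1,Q_2,R_1,R_2$ (free apart from the Clifford relations), completed with respect to total degree in $R_1,R_2$, or in extensions of it by further formal infinitesimal elements. Put $A_i=Q_i+R_i$. For $Q$ with $Q^2=-1$ and any $X$ put $X^0_Q=\frac12(X+Q^{-1}XQ)$, $X^1_Q=\frac12(X-Q^{-1}XQ)$. The split variables are $r_1,\dots,r_8$: for $j\in\{1,2\}$, $\iota_1,\iota_2\in\{0,1\}$, $r_{4(j-1)+2\iota_1+\iota_2+1}=((R_jQ_j^{-1})^{\iota_1}_{Q_1})^{\iota_2}_{Q_2}$. An FQ operation around $(Q_1,Q_2)$ is given by formal real noncommutative power series in eight variables: scalar $\Xi(A_1,A_2)=f_0(r_1,\dots,r_8)$, vectorial $\Xi(A_1,A_2)=(f_1(r)Q_1,f_2(r)Q_2)$, pseudoscalar $\Xi(A_1,A_2)=f_{12}(r)Q_1Q_2$; the operation is identified with this family of series. The same series can be evaluated at any pair $(A'_1,A'_2)$ with $A'_i-Q_i$ infinitesimal, by forming the split variables of $A'_i-Q_i$. Mixed basis: $\hat r_1=\frac12(r_2-r_7)$, $\hat r_2=\frac12(r_2+r_7)$, $\hat r_3=\frac12(r_1+r_5)$, $\hat r_4=\frac12(r_1-r_5)$, $\hat r_5=\frac12(r_4-r_8)$, $\hat r_6=\frac12(r_4+r_8)$, $\hat r_7=\frac12(r_3+r_6)$,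 $\hat r_8=\frac12(r_3-r_6)$. Circular basis: $\tilde r_i=\hat r_i$ for $i\notin\{4,5\}$, $\tilde r_4=\hat r_4+\hat r_5$, $\tilde r_5=\hat r_4-\hat r_5$; $\tilde p^{[s]}_{i_1,\dots,i_r}$ is the coefficient of $\tilde r_{i_1}\cdots\tilde r_{i_r}$ in $f_s$ rewritten in these variables. Variance properties: below $\theta_1,\theta_2$ range over elements of the form $1+\epsilon$ with $\epsilon$ a formal infinitesimal (possibly in an extension algebra), and $\Xi$ is always evaluated around the fixed base $(Q_1,Q_2)$; in the vectorial case the right-hand sides are meant componentwise. $\Xi$ is bivariant if $\Xi(\theta_1A_1\theta_2,\theta_1A_2\theta_2)=\theta_1\Xi(A_1,A_2)\theta_2$; antivariant if $\Xi(\theta_1A_1\theta_2,\theta_1A_2\theta_2)=\theta_2^{-1}\Xi(A_1,A_2)\theta_1^{-1}$; left-variant if $\Xi(\theta_1A_1\theta_2,\theta_1A_2\theta_2)=\theta_1\Xi(A_1,A_2)\theta_1^{-1}$; right-variant if $\Xi(\theta_1A_1\theta_2,\theta_1A_2\theta_2)=\theta_2^{-1}\Xi(A_1,A_2)\theta_2$. *)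

theory Defs
  imports Complex_Main
begin

text \<open>Basis of the Clifford algebra generated by Q1, Q2: the pair (a,b) stands for
  Q1^a Q2^b, i.e. 1, Q1, Q2, Q1Q2.\<close>
type_synonym qb = "bool \<times> bool"

text \<open>Normal-form monomials of the free product of Cl(Q1,Q2) with the free algebra on
  generators X_0, X_1, X_2, ... : (h0, [(i1,h1),...,(ik,hk)]) stands for
  h0 X_i1 h1 ... X_ik hk.  The degree in the X's is k.\<close>
type_synonym mono = "qb \<times> (nat \<times> qb) list"

text \<open>Elements of the degree-completed algebra: arbitrary real coefficient functions.\<close>
type_synonym alg = "mono \<Rightarrow> real"

definition qsign :: "qb \<Rightarrow> qb \<Rightarrow> real" where
  "qsign a c = (-1) ^ ((of_bool (snd a \<and> fst c) :: nat) + of_bool (fst a \<and> fst c)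
                        + of_bool (snd a \<and> snd c))"

definition qprod :: "qb \<Rightarrow> qb \<Rightarrow> qb" where
  "qprod a c = (fst a \<noteq> fst c, snd a \<noteq> snd c)"

definition mmul :: "mono \<Rightarrow> mono \<Rightarrow> real \<times> mono" where
  "mmul m1 m2 = (case m1 of (b, xs) \<Rightarrow> case m2 of (d, ys) \<Rightarrow>
     if xs = [] then (qsign b d, (qprod b d, ys))
     else (qsign (snd (last xs)) d,
           (b, butlast xs @ [(fst (last xs), qprod (snd (last xs)) d)] @ ys)))"

definition amul :: "alg \<Rightarrow> alg \<Rightarrow> alg" where
  "amul f g = (\<lambda>m. \<Sum>p\<in>{p. snd (mmul (fst p) (snd p)) = m}.
                    fst (mmul (fst p) (snd p)) * f (fst p) * g (snd p))"

definition abasis :: "mono \<Rightarrow> alg" where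
  "abasis m0 = (\<lambda>m. if m = m0 then 1 else 0)"

definition aone :: alg where "aone = abasis ((False, False), [])"
definition aQ1 :: alg where "aQ1 = abasis ((True, False), [])"
definition aQ2 :: alg where "aQ2 = abasis ((False, True), [])"
definition agen :: "nat \<Rightarrow> alg" where "agen i = abasis ((False, False), [(i, (False, False))])"

definition aadd :: "alg \<Rightarrow> alg \<Rightarrow> alg" where "aadd f g = (\<lambda>m. f m + g m)"
definition asub :: "alg \<Rightarrow> alg \<Rightarrow> alg" where "asub f g = (\<lambda>m. f m - g m)"
definition ascale :: "real \<Rightarrow> alg \<Rightarrow> alg" where "ascale c f = (\<lambda>m. c * f m)"

definition ainv :: "alg \<Rightarrow> alg" where
  "ainv x = (THE y. amul x y = aone \<and> amul y x = aone)"

definition infinitesimal :: "alg \<Rightarrow> bool" where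
  "infinitesimal x \<longleftrightarrow> (\<forall>b. x (b, []) = 0)"

definition Qc :: "nat \<Rightarrow> alg" where "Qc j = (if j = 1 then aQ1 else aQ2)"

text \<open>R1 = X_1, R2 = X_2; the other generators provide the extension by further
  formal infinitesimal elements.\<close>
definition baseA :: "nat \<Rightarrow> alg" where "baseA j = aadd (Qc j) (agen j)"

definition halfpart :: "alg \<Rightarrow> nat \<Rightarrow> alg \<Rightarrow> alg" where
  "halfpart Q \<iota> X = ascale (1/2)
     (if \<iota> = 0 then aadd X (amul (ainv Q) (amul X Q)) else asub X (amul (ainv Q) (amul X Q)))"

text \<open>r_k, k = 4(j-1) + 2 iota1 + iota2 + 1, for k in 1..8.\<close>
definition splitvar :: "alg \<Rightarrow> alg \<Rightarrow> nat \<Rightarrow> alg" where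
  "splitvar R1 R2 k =
     (let j = (k - 1) div 4 + 1; i1 = ((k - 1) mod 4) div 2; i2 = (k - 1) mod 2;
          Rj = (if j = 1 then R1 else R2)
      in halfpart aQ2 i2 (halfpart aQ1 i1 (amul Rj (ainv (Qc j)))))"

text \<open>Formal noncommutative power series in r_1..r_8: coefficient of each word over
  the letters 1..8 (words containing other letters must have coefficient 0).\<close>
type_synonym series = "nat list \<Rightarrow> real"

definition valid_series :: "series \<Rightarrow> bool" where
  "valid_series f \<longleftrightarrow> (\<forall>w. \<not> set w \<subseteq> {1..8} \<longrightarrow> f w = 0)"

definition aprod :: "alg list \<Rightarrow> alg" where "aprod xs = foldr amul xs aone"

text \<open>Evaluation of a series at infinitesimal arguments: in degree k only words of
  length at most k contribute.\<close>
definition series_eval :: "series \<Rightarrow> (nat \<Rightarrow> alg) \<Rightarrow> alg" where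
  "series_eval f r = (\<lambda>m. \<Sum>w\<in>{w. set w \<subseteq> {1..8} \<and> length w \<le> length (snd m)}.
                          f w * aprod (map r w) m)"

definition fq_eval :: "series \<Rightarrow> alg \<Rightarrow> alg \<Rightarrow> alg" where
  "fq_eval f A1 A2 = series_eval f (splitvar (asub A1 aQ1) (asub A2 aQ2))"

definition bivar :: "alg \<Rightarrow> alg \<Rightarrow> alg \<Rightarrow> alg" where
  "bivar t1 t2 X = amul t1 (amul X t2)"
definition antivar :: "alg \<Rightarrow> alg \<Rightarrow> alg \<Rightarrow> alg" where
  "antivar t1 t2 X = amul (ainv t2) (amul X (ainv t1))"
definition leftvar :: "alg \<Rightarrow> alg \<Rightarrow> alg \<Rightarrow> alg" where
  "leftvar t1 t2 X = amul t1 (amul X (ainv t1))"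
definition rightvar :: "alg \<Rightarrow> alg \<Rightarrow> alg \<Rightarrow> alg" where
  "rightvar t1 t2 X = amul (ainv t2) (amul X t2)"

definition vec_variant :: "(alg \<Rightarrow> alg \<Rightarrow> alg \<Rightarrow> alg) \<Rightarrow> series \<Rightarrow> series \<Rightarrow> bool" where
  "vec_variant T f1 f2 \<longleftrightarrow>
     (\<forall>e1 e2. infinitesimal e1 \<and> infinitesimal e2 \<longrightarrow>
        (let t1 = aadd aone e1; t2 = aadd aone e2;
             A1 = baseA 1; A2 = baseA 2;
             B1 = amul t1 (amul A1 t2); B2 = amul t1 (amul A2 t2)
         in amul (fq_eval f1 B1 B2) aQ1 = T t1 t2 (amul (fq_eval f1 A1 A2) aQ1) \<and>
            amul (fq_eval f2 B1 B2) aQ2 = T t1 t2 (amul (fq_eval f2 A1 A2) aQ2)))"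

definition single_variant :: "(alg \<Rightarrow> alg \<Rightarrow> alg \<Rightarrow> alg) \<Rightarrow> (alg \<Rightarrow> alg) \<Rightarrow> series \<Rightarrow> bool" where
  "single_variant T V f \<longleftrightarrow>
     (\<forall>e1 e2. infinitesimal e1 \<and> infinitesimal e2 \<longrightarrow>
        (let t1 = aadd aone e1; t2 = aadd aone e2;
             A1 = baseA 1; A2 = baseA 2;
             B1 = amul t1 (amul A1 t2); B2 = amul t1 (amul A2 t2)
         in V (fq_eval f B1 B2) = T t1 t2 (V (fq_eval f A1 A2))))"

definition scalar_val :: "alg \<Rightarrow> alg" where "scalar_val x = x"
definition pseudo_val :: "alg \<Rightarrow> alg" where "pseudo_val x = amul x (amul aQ1 aQ2)"

text \<open>hat_form i k = coefficient of r_k in hat r_i.\<close>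
definition hat_form :: "nat \<Rightarrow> nat \<Rightarrow> real" where
  "hat_form i k =
    (if i = 1 then (of_bool (k = 2) - of_bool (k = 7)) / 2
     else if i = 2 then (of_bool (k = 2) + of_bool (k = 7)) / 2
     else if i = 3 then (of_bool (k = 1) + of_bool (k = 5)) / 2
     else if i = 4 then (of_bool (k = 1) - of_bool (k = 5)) / 2
     else if i = 5 then (of_bool (k = 4) - of_bool (k = 8)) / 2
     else if i = 6 then (of_bool (k = 4) + of_bool (k = 8)) / 2
     else if i = 7 then (of_bool (k = 3) + of_bool (k = 6)) / 2
     else if i = 8 then (of_bool (k = 3) - of_bool (k = 6)) / 2
     else 0)"

text \<open>tilde_form l i = coefficient of hat r_i in tilde r_l.\<close>
definition tilde_form :: "nat \<Rightarrow> nat \<Rightarrow> real" where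
  "tilde_form l i =
    (if l = 4 then of_bool (i = 4) + of_bool (i = 5)
     else if l = 5 then of_bool (i = 4) - of_bool (i = 5)
     else if l \<in> {1..8} then of_bool (i = l) else 0)"

text \<open>Substituting linear forms y_l = sum_k L l k x_k into a series g(y) gives a series in x.\<close>
definition lin_subst :: "(nat \<Rightarrow> nat \<Rightarrow> real) \<Rightarrow> series \<Rightarrow> series" where
  "lin_subst L g = (\<lambda>w. \<Sum>u\<in>{u. set u \<subseteq> {1..8} \<and> length u = length w}.
                        g u * (\<Prod>j<length w. L (u ! j) (w ! j)))"

text \<open>The series f rewritten in the circular variables: the unique g with
  f(r) = g(tilde r(hat r(r))).  circ_coeff f u is the coefficient of tilde r_u.\<close>
definition circ_coeff :: "series \<Rightarrow> series" where
  "circ_coeff f = (THE g. valid_series g \<and> lin_subst hat_form (lin_subst tilde_form g) = f)"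

end

theory Submission
  imports Defs
begin

text \<open>
  Under (A1, A2) to (u A1 v, u A2 v) the quotient W = A1 A2^{-1} is conjugated by u and
  V = A2^{-1} A1 by v^{-1}. As W^2 + 1 = -4 r + (terms of degree at least 2) with r the
  circular variable 4, the series \<Sum>c_n (W^2 + 1)^n, multiplied on the right by 1, W or
  A_i, are left-variant or bivariant, and evaluating at the point whose only nonzero
  circular variable is the fourth shows that their coefficients at the words 4...4 can be
  prescribed by solving a triangular system. The right-variant and antivariant cases use V,
  with factors 1, V or A_i^{-1}, and the circular variable 5.

  For uniqueness take a variant series whose lowest nonzero degree is n. To first order,
  all circular variables except 4 and 5 can be moved to 0, so the degree n part only
  involves the letters 4 and 5. Moving the generic pair by u = v = 1 + e, where e is the
  circular variable 6, conjugates the variables 4 and 5 by 1 + e and 1 - e up to second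
  order; comparing degree n + 1 forces all letters of a word with nonzero coefficient to
  agree with its first letter, which is 4 for left- and bivariant series and 5 otherwise.
\<close>

section \<open>The degree-completed algebra as a filtered ring\<close>

text \<open>An FQ operation carries its Q's only at the far right, and W is not infinitesimal.
  Pulling the Q's in W and V to the right flips the signs of the split variables that anticommute
  with them, whence the signs s and t in \<open>fa\<close> and \<open>fb\<close>; in W^2 + 1 the Q's
  cancel, leaving an infinitesimal series in the r's.

  The letters 4 and 5 reflect the tangent space of the orbit: to first order R_i Q_i^{-1} moves by e
  + Q_i d Q_i^{-1}. On components commuting with one Q and anticommuting with the other, the sign of
  d differs for i = 1 and i = 2, so both components can be removed; on the remaining ones the signs
  agree, and r_1 - r_5 and r_4 - r_8 survive, which span the circular variables 4 and 5.

  If e anticommutes with Q1 and Q2, then (1 + e) Q_i (1 + e) = (1 - e^2) Q_i, so this move fixes the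
  base pair to first order and changes the lowest-degree part F of a series only by commutators one
  degree higher. Passing e through the trailing Q1, Q2, 1 or Q1Q2 shows that each law sends F to F +
  [e, F] or F - [e, F] at that order; the sign selects the letter 4 or 5.\<close>

abbreviation deg :: "mono \<Rightarrow> nat" where "deg m \<equiv> length (snd m)"
abbreviation mone :: mono where "mone \<equiv> ((False, False), [])"

text \<open>The algebra is a twisted monoid algebra: \<open>mm\<close> is an associative product on
  normal forms and \<open>ms\<close> a 2-cocycle with values 1 and -1.\<close>

definition mm :: "mono \<Rightarrow> mono \<Rightarrow> mono" where "mm a b = snd (mmul a b)"
definition ms :: "mono \<Rightarrow> mono \<Rightarrow> real" where "ms a b = fst (mmul a b)"

lemma amul_altdef:
  "amul f g m = (\<Sum>p\<in>{p. mm (fst p) (snd p) = m}. ms (fst p) (snd p) * f (fst p) * g (snd p))"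
  by (simp add: amul_def mm_def ms_def)

lemma mm_Nil: "mm (b, []) (d, ys) = (qprod b d, ys)"
  by (simp add: mm_def mmul_def)

lemma ms_Nil: "ms (b, []) (d, ys) = qsign b d"
  by (simp add: ms_def mmul_def)

lemma mm_snoc: "mm (b, xs @ [(i, h)]) (d, ys) = (b, xs @ (i, qprod h d) # ys)"
  by (simp add: mm_def mmul_def)

lemma ms_snoc: "ms (b, xs @ [(i, h)]) (d, ys) = qsign h d"
  by (simp add: ms_def mmul_def)

lemma mono_cases:
  obtains (Nil) b where "m = (b, [])" | (snoc) b xs i h where "m = ((b, xs @ [(i, h)])::mono)"
proof (cases m)
  case (Pair b l)
  then show thesis
    using that by (cases l rule: rev_cases) auto
qed

lemma qprod_assoc: "qprod (qprod a b) c = qprod a (qprod b c)"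
  by (auto simp: qprod_def)

lemma qsign_cocycle: "qsign a b * qsign (qprod a b) c = qsign b c * qsign a (qprod b c)"
proof -
  obtain a1 a2 b1 b2 c1 c2 where "a = (a1, a2)" "b = (b1, b2)" "c = (c1, c2)"
    by (metis surj_pair)
  then show ?thesis
    by (cases a1; cases a2; cases b1; cases b2; cases c1; cases c2) (simp_all add: qprod_def qsign_def)
qed

lemma mm_one [simp]: "mm mone m = m" "mm m mone = m"
proof -
  show "mm mone m = m"
    by (cases m) (simp add: mm_Nil qprod_def)
  show "mm m mone = m"
    by (cases m rule: mono_cases) (simp_all add: mm_Nil mm_snoc qprod_def)
qed

lemma ms_one [simp]: "ms mone m = 1" "ms m mone = 1"
proof -
  show "ms mone m = 1"
    by (cases m) (simp add: ms_Nil qsign_def)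
  show "ms m mone = 1"
    by (cases m rule: mono_cases) (simp_all add: ms_Nil ms_snoc qsign_def)
qed

lemma mm_assoc: "mm (mm a b) c = mm a (mm b c)"
proof (cases b rule: mono_cases)
  case Nil
  then show ?thesis
    by (cases a rule: mono_cases; cases c) (auto simp: mm_Nil mm_snoc qprod_assoc)
next
  case (snoc b' xs i h)
  then show ?thesis
    by (cases a rule: mono_cases; cases c)
      (auto simp: mm_Nil mm_snoc mm_snoc[where xs = "_ @ (_, _) # _", simplified])
qed

text \<open>If the middle monomial contains a generator, its two junctions do not interact and the
  signs separate. Only a middle factor of degree 0 calls for the cocycle identity of the Clifford
  algebra.\<close>

lemma ms_cocycle: "ms a b * ms (mm a b) c = ms b c * ms a (mm b c)"
proof (cases b rule: mono_cases)
  case Nil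
  then show ?thesis
    by (cases a rule: mono_cases; cases c) (auto simp: mm_Nil mm_snoc ms_Nil ms_snoc qsign_cocycle)
next
  case (snoc b' xs i h)
  then show ?thesis
    by (cases a rule: mono_cases; cases c)
      (auto simp: mm_Nil mm_snoc ms_Nil ms_snoc ms_snoc[where xs = "_ @ (_, _) # _", simplified])
qed

lemma deg_mm: "deg (mm a b) = deg a + deg b"
  by (cases a rule: mono_cases; cases b) (auto simp: mm_Nil mm_snoc)

lemma letters_mm: "fst ` set (snd (mm a b)) = fst ` set (snd a) \<union> fst ` set (snd b)"
  by (cases a rule: mono_cases; cases b) (auto simp: mm_Nil mm_snoc)

text \<open>Both factors use only generators of m and have at most its degree. Finiteness matters
  although there are infinitely many generators: a sum over an infinite set would be 0 by
  convention.\<close>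

lemma finite_mm_fibre [simp]: "finite {p. mm (fst p) (snd p) = m}"
proof -
  let ?L = "fst ` set (snd m) \<times> (UNIV :: qb set)"
  let ?M = "(UNIV :: qb set) \<times> {l. set l \<subseteq> ?L \<and> length l \<le> deg m}"
  have fin: "finite ?M"
    by (intro finite_cartesian_product finite_lists_length_le) auto
  have "{p. mm (fst p) (snd p) = m} \<subseteq> ?M \<times> ?M"
  proof
    fix p assume "p \<in> {p. mm (fst p) (snd p) = m}"
    then have "fst ` set (snd (fst p)) \<union> fst ` set (snd (snd p)) = fst ` set (snd m)"
      "deg (fst p) + deg (snd p) = deg m"
      using letters_mm[of "fst p" "snd p"] deg_mm[of "fst p" "snd p"] by auto
    then have "fst ` set (snd (fst p)) \<subseteq> fst ` set (snd m)" "fst ` set (snd (snd p)) \<subseteq> fst ` set (snd m)"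
      "deg (fst p) \<le> deg m" "deg (snd p) \<le> deg m"
      by auto
    then have "set (snd (fst p)) \<subseteq> ?L" "set (snd (snd p)) \<subseteq> ?L"
      "deg (fst p) \<le> deg m" "deg (snd p) \<le> deg m"
      by (simp_all add: image_subset_iff subset_iff mem_Times_iff)
    then show "p \<in> ?M \<times> ?M"
      by (simp add: mem_Times_iff)
  qed
  then show ?thesis
    using fin finite_subset by blast
qed

lemma amul_assoc: "amul (amul f g) h = amul f (amul g h)"
proof
  fix m
  let ?F = "\<lambda>m. {p. mm (fst p) (snd p) = m}"
  have "amul (amul f g) h m =
     (\<Sum>p\<in>?F m. \<Sum>q\<in>?F (fst p). ms (fst p) (snd p) * ms (fst q) (snd q) * f (fst q) * g (snd q) * h (snd p))"
    unfolding amul_altdef by (simp add: sum_distrib_left sum_distrib_right mult_ac)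
  also have "\<dots> = (\<Sum>(p, q)\<in>Sigma (?F m) (\<lambda>p. ?F (fst p)).
      ms (fst p) (snd p) * ms (fst q) (snd q) * f (fst q) * g (snd q) * h (snd p))"
    by (subst sum.Sigma) auto
  also have "\<dots> = (\<Sum>(p, q)\<in>Sigma (?F m) (\<lambda>p. ?F (snd p)).
      ms (fst p) (snd p) * ms (fst q) (snd q) * f (fst p) * g (fst q) * h (snd q))"
  \<comment> \<open>Both index sets list the factorizations m = abc, stored as ((ab, c), (a, b)) on
    one side and ((a, bc), (b, c)) on the other; the cocycle identity matches the signs.\<close>
  proof (rule sum.reindex_bij_witness
      [where i = "\<lambda>(p, q). ((mm (fst p) (fst q), snd q), (fst p, fst q))"
         and j = "\<lambda>(p, q). ((fst q, mm (snd q) (snd p)), (snd q, snd p))"], goal_cases)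
    case (1 x)
    then obtain a b c where "x = ((mm a b, c), (a, b))"
      by (cases x) (simp add: mem_Times_iff, metis prod.collapse)
    then show ?case by simp
  next
    case (2 x)
    then obtain a b c where "x = ((mm a b, c), (a, b))" "mm (mm a b) c = m"
      by (cases x) (simp add: mem_Times_iff, metis prod.collapse)
    then show ?case by (simp add: mm_assoc)
  next
    case (3 x)
    then obtain a b c where "x = ((a, mm b c), (b, c))"
      by (cases x) (simp add: mem_Times_iff, metis prod.collapse)
    then show ?case by simp
  next
    case (4 x)
    then obtain a b c where "x = ((a, mm b c), (b, c))" "mm a (mm b c) = m"
      by (cases x) (simp add: mem_Times_iff, metis prod.collapse)
    then show ?case by (simp add: mm_assoc)
  next
    case (5 x)
    then obtain a b c where x: "x = ((mm a b, c), (a, b))"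
      by (cases x) (simp add: mem_Times_iff, metis prod.collapse)
    show ?case
      using ms_cocycle[of a b c] by (simp add: x mult_ac)
  qed
  also have "\<dots> = (\<Sum>p\<in>?F m. \<Sum>q\<in>?F (snd p). ms (fst p) (snd p) * ms (fst q) (snd q) * f (fst p) * g (fst q) * h (snd q))"
    by (subst sum.Sigma) auto
  also have "\<dots> = amul f (amul g h) m"
    unfolding amul_altdef by (simp add: sum_distrib_left sum_distrib_right mult_ac)
  finally show "amul (amul f g) h m = amul f (amul g h) m" .
qed

lemma amul_abasis_left:
  assumes "\<And>x. mm a x = m \<longleftrightarrow> x = b"
  shows "amul (abasis a) g m = ms a b * g b"
proof -
  have "amul (abasis a) g m
      = (\<Sum>p\<in>{p. mm (fst p) (snd p) = m}. if p = (a, b) then ms a b * g b else 0)"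
    unfolding amul_altdef
  proof (rule sum.cong[OF refl])
    fix p assume "p \<in> {p. mm (fst p) (snd p) = m}"
    then show "ms (fst p) (snd p) * abasis a (fst p) * g (snd p) = (if p = (a, b) then ms a b * g b else 0)"
      using assms by (cases p) (simp add: abasis_def, blast)
  qed
  then show ?thesis using assms by simp
qed

lemma amul_abasis_left_zero:
  assumes "\<And>x. mm a x \<noteq> m"
  shows "amul (abasis a) g m = 0"
  unfolding amul_altdef using assms
  by (intro sum.neutral) (simp add: abasis_def)

lemma amul_abasis_right:
  assumes "\<And>x. mm x a = m \<longleftrightarrow> x = b"
  shows "amul g (abasis a) m = ms b a * g b"
proof -
  have "amul g (abasis a) m
      = (\<Sum>p\<in>{p. mm (fst p) (snd p) = m}. if p = (b, a) then ms b a * g b else 0)"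
    unfolding amul_altdef
  proof (rule sum.cong[OF refl])
    fix p assume "p \<in> {p. mm (fst p) (snd p) = m}"
    then show "ms (fst p) (snd p) * g (fst p) * abasis a (snd p) = (if p = (b, a) then ms b a * g b else 0)"
      using assms by (cases p) (simp add: abasis_def, blast)
  qed
  then show ?thesis using assms by simp
qed

lemma amul_aone [simp]: "amul aone f = f" "amul f aone = f"
  by (rule ext, simp add: aone_def amul_abasis_left amul_abasis_right)+

lemma amul_abasis: "amul (abasis a) (abasis b) = ascale (ms a b) (abasis (mm a b))"
proof
  fix m
  let ?t = "\<lambda>p. ms (fst p) (snd p) * abasis a (fst p) * abasis b (snd p)"
  have "amul (abasis a) (abasis b) m = (\<Sum>p\<in>{p. mm (fst p) (snd p) = m}. if p = (a, b) then ms a b else 0)"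
    unfolding amul_altdef
  proof (rule sum.cong[OF refl])
    fix p show "?t p = (if p = (a, b) then ms a b else 0)"
      by (cases p) (simp add: abasis_def)
  qed
  also have "\<dots> = ascale (ms a b) (abasis (mm a b)) m"
    by (simp add: ascale_def abasis_def)
  finally show "amul (abasis a) (abasis b) m = ascale (ms a b) (abasis (mm a b)) m" .
qed

text \<open>A copy of the function type \<open>alg\<close> on which the ring classes can be instantiated.\<close>

typedef qalg = "UNIV :: alg set" morphisms coef qalg_of by simp

setup_lifting type_definition_qalg

lemma coef_inject_ext: "(\<And>m. coef x m = coef y m) \<Longrightarrow> x = y"
  by (metis coef_inject ext)

instantiation qalg :: real_algebra_1
begin

lift_definition zero_qalg :: qalg is "\<lambda>m. 0" .
lift_definition one_qalg :: qalg is aone .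
lift_definition plus_qalg :: "qalg \<Rightarrow> qalg \<Rightarrow> qalg" is aadd .
lift_definition minus_qalg :: "qalg \<Rightarrow> qalg \<Rightarrow> qalg" is asub .
lift_definition uminus_qalg :: "qalg \<Rightarrow> qalg" is "\<lambda>f m. - f m" .
lift_definition times_qalg :: "qalg \<Rightarrow> qalg \<Rightarrow> qalg" is amul .
lift_definition scaleR_qalg :: "real \<Rightarrow> qalg \<Rightarrow> qalg" is ascale .

instance
proof
  fix a b c :: qalg and r s :: real
  show "a * b * c = a * (b * c)" by transfer (rule amul_assoc)
  show "1 * a = a" "a * 1 = a" by (transfer, simp)+
  show "(a + b) * c = a * c + b * c" "a * (b + c) = a * b + a * c"
    by (transfer, simp add: fun_eq_iff amul_altdef aadd_def sum.distrib algebra_simps)+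
  show "(r *\<^sub>R a) * b = r *\<^sub>R (a * b)" "a * (r *\<^sub>R b) = r *\<^sub>R (a * b)"
    by (transfer, simp add: fun_eq_iff amul_altdef ascale_def sum_distrib_left mult_ac)+
  show "(0::qalg) \<noteq> 1"
    by transfer (auto simp: aone_def abasis_def fun_eq_iff)
qed (transfer, simp add: fun_eq_iff aadd_def asub_def ascale_def algebra_simps)+

end

lemma coef_simps [simp]:
  "coef 0 m = 0" "coef (x + y) m = coef x m + coef y m" "coef (x - y) m = coef x m - coef y m"
  "coef (- x) m = - coef x m" "coef (r *\<^sub>R x) m = r * coef x m"
  by (transfer, simp add: aadd_def asub_def ascale_def)+

lemma coef_sum [simp]: "coef (sum f I) m = (\<Sum>i\<in>I. coef (f i) m)"
  by (induction I rule: infinite_finite_induct) auto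

lemma coef_one: "coef 1 m = of_bool (m = mone)"
  by transfer (auto simp: aone_def abasis_def)

section \<open>The degree filtration: equality means agreement modulo every degree\<close>

lift_definition filt :: "nat \<Rightarrow> qalg \<Rightarrow> bool" is "\<lambda>N x. \<forall>m. deg m < N \<longrightarrow> x m = 0" .

lemma filtD: "filt N x \<Longrightarrow> deg m < N \<Longrightarrow> coef x m = 0"
  by transfer auto

lemma filtI: "(\<And>m. deg m < N \<Longrightarrow> coef x m = 0) \<Longrightarrow> filt N x"
  by transfer auto

lemma filt_zero [simp]: "filt N 0" "filt 0 x"
  by (auto intro: filtI)

lemma filt_mono: "filt N x \<Longrightarrow> M \<le> N \<Longrightarrow> filt M x"
  by (rule filtI) (meson filtD order_less_le_trans)

lemma filt_add: "filt N x \<Longrightarrow> filt N y \<Longrightarrow> filt N (x + y)"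
  and filt_diff: "filt N x \<Longrightarrow> filt N y \<Longrightarrow> filt N (x - y)"
  and filt_minus: "filt N x \<Longrightarrow> filt N (- x)"
  and filt_scaleR: "filt N x \<Longrightarrow> filt N (r *\<^sub>R x)"
  by (rule filtI, simp add: filtD)+

lemma filt_sum: "(\<And>i. i \<in> I \<Longrightarrow> filt N (f i)) \<Longrightarrow> filt N (sum f I)"
proof (rule filtI)
  fix m :: mono assume "\<And>i. i \<in> I \<Longrightarrow> filt N (f i)" "deg m < N"
  then have "coef (f i) m = 0" if "i \<in> I" for i using that filtD by blast
  then show "coef (sum f I) m = 0" by simp
qed

lemma filt_mult: "filt M x \<Longrightarrow> filt N y \<Longrightarrow> filt (M + N) (x * y)"
proof (transfer, intro allI impI)
  fix M N and x y :: alg and m :: mono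
  assume x: "\<forall>m. deg m < M \<longrightarrow> x m = 0" and y: "\<forall>m. deg m < N \<longrightarrow> y m = 0"
    and m: "deg m < M + N"
  have "ms (fst p) (snd p) * x (fst p) * y (snd p) = 0" if "mm (fst p) (snd p) = m" for p
  proof -
    have "deg (fst p) < M \<or> deg (snd p) < N"
      using that deg_mm[of "fst p" "snd p"] m by force
    then have "x (fst p) = 0 \<or> y (snd p) = 0" using x y by blast
    then show ?thesis by auto
  qed
  then show "amul x y m = 0"
    unfolding amul_altdef by (auto intro!: sum.neutral)
qed

lemma filt_mult_left: "filt N y \<Longrightarrow> filt N (x * y)"
  and filt_mult_right: "filt N x \<Longrightarrow> filt N (x * y)"
  using filt_mult[of 0 x N y] filt_mult[of N x 0 y] by auto

lemma filt_mult_both: "filt N y \<Longrightarrow> filt N (x * y * z)"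
  by (intro filt_mult_right filt_mult_left)

lemma filt_power: "filt 1 x \<Longrightarrow> filt n (x ^ n)"
proof (induction n)
  case (Suc n)
  then show ?case using filt_mult[of 1 x n "x ^ n"] by auto
qed simp

lemma filt_all_eqI: "(\<And>N. filt N (x - y)) \<Longrightarrow> x = y"
proof (rule coef_inject_ext)
  fix m assume "\<And>N. filt N (x - y)"
  from filtD[OF this, of m "Suc (deg m)"] show "coef x m = coef y m" by simp
qed

lemma filt_trans: "filt N (x - y) \<Longrightarrow> filt N (y - z) \<Longrightarrow> filt N (x - z)"
  using filt_add[of N "x - y" "y - z"] by simp

lemma filt_sym: "filt N (x - y) \<Longrightarrow> filt N (y - x)"
  using filt_minus[of N "x - y"] by simp

text \<open>The infinite sum of c_n x^n, with the powers of x written as iterated products. Cutting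
  it at the degree of the monomial loses nothing when x is infinitesimal; otherwise the value has no
  meaning.\<close>

lift_definition psum :: "(nat \<Rightarrow> real) \<Rightarrow> qalg \<Rightarrow> qalg" is
  "\<lambda>c x m. \<Sum>n\<le>deg m. c n * (((\<lambda>y. amul x y) ^^ n) aone) m" .

lemma coef_power: "coef (x ^ n) = ((\<lambda>y. amul (coef x) y) ^^ n) aone"
  by (induction n) (simp_all add: one_qalg.rep_eq times_qalg.rep_eq)

lemma coef_psum: "coef (psum c x) m = (\<Sum>n\<le>deg m. c n * coef (x ^ n) m)"
  by (simp add: psum.rep_eq coef_power)

lemma psum_truncate:
  assumes "filt 1 x"
  shows "filt N (psum c x - (\<Sum>n<N. c n *\<^sub>R x ^ n))"
proof (rule filtI)
  fix m :: mono assume m: "deg m < N"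
  have "(\<Sum>n\<le>deg m. c n * coef (x ^ n) m) = (\<Sum>n<N. c n * coef (x ^ n) m)"
    using m filtD[OF filt_power[OF assms]] by (intro sum.mono_neutral_left) auto
  then show "coef (psum c x - (\<Sum>n<N. c n *\<^sub>R x ^ n)) m = 0"
    by (simp add: coef_psum)
qed

lemma psum_conj:
  assumes x: "filt 1 x" and uv: "v * u = 1" "u * v = 1"
  shows "psum c (u * x * v) = u * psum c x * v"
proof (rule filt_all_eqI)
  fix N
  have pow: "(u * x * v) ^ n = u * x ^ n * v" for n
  proof (induction n)
    case (Suc n)
    have "v * (u * z) = z" for z
      by (simp add: uv flip: mult.assoc)
    then show ?case using Suc by (simp add: mult.assoc)
  qed (simp add: uv)
  have "filt 1 (u * x * v)"
    using x by (rule filt_mult_both)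
  from psum_truncate[OF this, of N c]
  have 1: "filt N (psum c (u * x * v) - u * (\<Sum>n<N. c n *\<^sub>R x ^ n) * v)"
    by (simp add: pow sum_distrib_left sum_distrib_right)
  have "filt N (u * (psum c x - (\<Sum>n<N. c n *\<^sub>R x ^ n)) * v)"
    by (intro filt_mult_both psum_truncate x)
  then show "filt N (psum c (u * x * v) - u * psum c x * v)"
    by (intro filt_trans[OF 1 filt_sym]) (simp add: algebra_simps)
qed

text \<open>The geometric series in 1 - u, a two-sided inverse for u near 1.\<close>

definition qinv :: "qalg \<Rightarrow> qalg" where "qinv u = psum (\<lambda>n. (-1) ^ n) (u - 1)"

lemma
  assumes "filt 1 (u - 1)"
  shows qinv_right: "u * qinv u = 1" and qinv_left: "qinv u * u = 1"
    and qinv_first: "filt 1 (qinv u - 1)"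
proof -
  define x where "x = 1 - u"
  have x: "filt 1 x" using filt_sym[OF assms] by (simp add: x_def)
  have pw: "(-1) ^ n *\<^sub>R (u - 1) ^ n = x ^ n" for n
  proof (induction n)
    case (Suc n)
    have "x ^ Suc n = - (u - 1) * ((-1) ^ n *\<^sub>R (u - 1) ^ n)"
      by (simp add: Suc x_def)
    then show ?case by (simp add: left_diff_distrib scaleR_right_diff_distrib)
  qed simp
  have tr: "filt N (qinv u - (\<Sum>n<N. x ^ n))" for N
    using psum_truncate[OF assms, of N "\<lambda>n. (-1) ^ n"] by (simp add: qinv_def pw)
  have geo1: "(1 - x) * (\<Sum>n<N. x ^ n) = 1 - x ^ N" for N
    by (induction N) (simp_all add: distrib_left left_diff_distrib)
  have geo2: "(\<Sum>n<N. x ^ n) * (1 - x) = 1 - x ^ N" for N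
  proof (induction N)
    case (Suc N)
    have "(\<Sum>n<Suc N. x ^ n) * (1 - x) = (\<Sum>n<N. x ^ n) * (1 - x) + x ^ N * (1 - x)"
      by (simp add: distrib_right)
    then show ?case unfolding Suc by (simp add: right_diff_distrib power_commutes)
  qed simp
  have u: "u = 1 - x" by (simp add: x_def)
  show "u * qinv u = 1"
  proof (rule filt_all_eqI)
    fix N
    have "filt N (u * (qinv u - (\<Sum>n<N. x ^ n)) - x ^ N)"
      by (intro filt_diff filt_mult_left tr filt_power x)
    then show "filt N (u * qinv u - 1)"
      using geo1[of N, folded u] by (simp add: right_diff_distrib)
  qed
  show "qinv u * u = 1"
  proof (rule filt_all_eqI)
    fix N
    have "filt N ((qinv u - (\<Sum>n<N. x ^ n)) * u - x ^ N)"
      by (intro filt_diff filt_mult_right tr filt_power x)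
    then show "filt N (qinv u * u - 1)"
      using geo2[of N, folded u] by (simp add: left_diff_distrib)
  qed
  show "filt 1 (qinv u - 1)"
    using tr[of 1] by simp
qed

section \<open>Evaluation of noncommutative series\<close>

lemma psum_rec:
  assumes x: "filt 1 x"
  shows "psum c x = c 0 *\<^sub>R 1 + x * psum (\<lambda>n. c (Suc n)) x"
proof (rule filt_all_eqI)
  fix N
  have "filt (Suc N) (psum c x - (\<Sum>n<Suc N. c n *\<^sub>R x ^ n))"
    by (rule psum_truncate[OF x])
  then have 1: "filt N (psum c x - (\<Sum>n<Suc N. c n *\<^sub>R x ^ n))"
    by (rule filt_mono) simp
  have "filt N (x * (psum (\<lambda>n. c (Suc n)) x - (\<Sum>n<N. c (Suc n) *\<^sub>R x ^ n)))"
    by (rule filt_mult_left[OF psum_truncate[OF x]])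
  then have 2: "filt N (c 0 *\<^sub>R 1 + x * psum (\<lambda>n. c (Suc n)) x - (\<Sum>n<Suc N. c n *\<^sub>R x ^ n))"
    unfolding sum.lessThan_Suc_shift by (simp add: algebra_simps sum_distrib_left)
  show "filt N (psum c x - (c 0 *\<^sub>R 1 + x * psum (\<lambda>n. c (Suc n)) x))"
    by (rule filt_trans[OF 1 filt_sym[OF 2]])
qed

text \<open>In each summand of the telescoped difference one factor has degree 2 and the others
  degree 1. Thus the leading term of x alone fixes the leading term of x^n.\<close>

lemma filt_power_diff:
  assumes "filt 1 x" "filt 1 y" "filt 2 (x - y)"
  shows "filt (Suc n) (x ^ n - y ^ n)"
proof (induction n)
  case (Suc n)
  have "filt (2 + n) ((x - y) * x ^ n)" "filt (1 + Suc n) (y * (x ^ n - y ^ n))"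
    by (intro filt_mult assms filt_power Suc)+
  then have "filt (Suc (Suc n)) ((x - y) * x ^ n + y * (x ^ n - y ^ n))"
    by (intro filt_add) auto
  then show ?case by (simp add: algebra_simps)
qed simp

abbreviation wprod :: "(nat \<Rightarrow> qalg) \<Rightarrow> nat list \<Rightarrow> qalg" where
  "wprod r w \<equiv> prod_list (map r w)"

definition words :: "nat \<Rightarrow> nat list set" where
  "words N = {w. set w \<subseteq> {1..8} \<and> length w \<le> N}"

definition inftes :: "(nat \<Rightarrow> qalg) \<Rightarrow> bool" where
  "inftes r \<longleftrightarrow> (\<forall>k\<in>{1..8}. filt 1 (r k))"

definition ev :: "series \<Rightarrow> (nat \<Rightarrow> qalg) \<Rightarrow> qalg" where
  "ev f r = qalg_of (series_eval f (\<lambda>k. coef (r k)))"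

lemma aprod_coef: "aprod (map (\<lambda>k. coef (r k)) w) = coef (wprod r w)"
  by (induction w) (simp_all add: aprod_def one_qalg.rep_eq times_qalg.rep_eq)

lemma coef_ev: "coef (ev f r) m = (\<Sum>w\<in>words (deg m). f w * coef (wprod r w) m)"
  by (simp add: ev_def qalg_of_inverse series_eval_def words_def aprod_coef)

lemma finite_words [simp]: "finite (words N)"
  unfolding words_def by (rule finite_lists_length_le) simp

lemma filt_wprod:
  assumes "inftes r" "set w \<subseteq> {1..8}"
  shows "filt (length w) (wprod r w)"
  using assms(2)
proof (induction w)
  case (Cons k w)
  then have "filt 1 (r k)" using assms(1) by (simp add: inftes_def)
  from filt_mult[OF this, of "length w"] show ?case using Cons by simp
qed simp

lemma ev_truncate:
  assumes "inftes r"
  shows "filt (Suc N) (ev f r - (\<Sum>w\<in>words N. f w *\<^sub>R wprod r w))"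
proof (rule filtI)
  fix m :: mono assume m: "deg m < Suc N"
  have "(\<Sum>w\<in>words (deg m). f w * coef (wprod r w) m) = (\<Sum>w\<in>words N. f w * coef (wprod r w) m)"
  proof (rule sum.mono_neutral_left)
    show "words (deg m) \<subseteq> words N" using m by (auto simp: words_def)
    show "\<forall>w\<in>words N - words (deg m). f w * coef (wprod r w) m = 0"
    proof
      fix w assume "w \<in> words N - words (deg m)"
      then have "set w \<subseteq> {1..8}" "deg m < length w" by (auto simp: words_def)
      then show "f w * coef (wprod r w) m = 0"
        using filtD[OF filt_wprod[OF assms]] by simp
    qed
  qed simp
  then show "coef (ev f r - (\<Sum>w\<in>words N. f w *\<^sub>R wprod r w)) m = 0"
    by (simp add: coef_ev)
qed

lemma words_Suc: "words (Suc N) = insert [] ((\<lambda>(k, w). k # w) ` ({1..8} \<times> words N))"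
proof (intro set_eqI iffI)
  fix w assume "w \<in> words (Suc N)"
  then show "w \<in> insert [] ((\<lambda>(k, w). k # w) ` ({1..8} \<times> words N))"
    by (cases w) (auto simp: words_def)
qed (auto simp: words_def)

lemma sum_words_Suc:
  fixes F :: "nat list \<Rightarrow> 'a::comm_monoid_add"
  shows "(\<Sum>w\<in>words (Suc N). F w) = F [] + (\<Sum>k\<in>{1..8}. \<Sum>w\<in>words N. F (k # w))"
proof -
  have inj: "inj_on (\<lambda>(k, w). k # w) ({1..8} \<times> words N)"
    by (auto simp: inj_on_def)
  have "(\<Sum>w\<in>words (Suc N). F w) = F [] + (\<Sum>w\<in>(\<lambda>(k, w). k # w) ` ({1..8} \<times> words N). F w)"
    unfolding words_Suc by (rule sum.insert) auto
  also have "(\<Sum>w\<in>(\<lambda>(k, w). k # w) ` ({1..8} \<times> words N). F w) = (\<Sum>(k, w)\<in>{1..8} \<times> words N. F (k # w))"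
    by (subst sum.reindex[OF inj]) (simp add: case_prod_unfold)
  also have "\<dots> = (\<Sum>k\<in>{1..8}. \<Sum>w\<in>words N. F (k # w))"
    by (rule sum.cartesian_product[symmetric])
  finally show ?thesis .
qed

text \<open>Horner's rule for the first letter. Later identities about evaluations follow from it by
  induction on the degree: each letter is infinitesimal, so a bound N for the tails gives N + 1 for
  the whole.\<close>

lemma ev_rec:
  assumes "inftes r"
  shows "ev f r = f [] *\<^sub>R 1 + (\<Sum>k\<in>{1..8}. r k * ev (\<lambda>w. f (k # w)) r)"
proof (rule filt_all_eqI)
  fix N
  let ?T = "\<lambda>N f. \<Sum>w\<in>words N. f w *\<^sub>R wprod r w"
  have T: "?T (Suc N) f = f [] *\<^sub>R 1 + (\<Sum>k\<in>{1..8}. r k * ?T N (\<lambda>w. f (k # w)))"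
    by (simp add: sum_words_Suc sum_distrib_left)
  have 1: "filt N (ev f r - ?T (Suc N) f)"
    by (rule filt_mono[OF ev_truncate[OF assms]]) simp
  have "filt N (\<Sum>k\<in>{1..8}. r k * (ev (\<lambda>w. f (k # w)) r - ?T N (\<lambda>w. f (k # w))))"
    by (intro filt_sum filt_mult_left filt_mono[OF ev_truncate[OF assms]]) simp
  then have 2: "filt N (f [] *\<^sub>R 1 + (\<Sum>k\<in>{1..8}. r k * ev (\<lambda>w. f (k # w)) r) - ?T (Suc N) f)"
    unfolding T by (simp add: right_diff_distrib sum_subtractf)
  show "filt N (ev f r - (f [] *\<^sub>R 1 + (\<Sum>k\<in>{1..8}. r k * ev (\<lambda>w. f (k # w)) r)))"
    by (rule filt_trans[OF 1 filt_sym[OF 2]])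
qed

lemma ev_cong: "(\<And>k. k \<in> {1..8} \<Longrightarrow> r k = r' k) \<Longrightarrow> ev f r = ev f r'"
proof (rule coef_inject_ext)
  fix m assume *: "\<And>k. k \<in> {1..8} \<Longrightarrow> r k = r' k"
  have "map r w = map r' w" if "w \<in> words (deg m)" for w
    using that * by (auto simp: words_def)
  then show "coef (ev f r) m = coef (ev f r') m"
    unfolding coef_ev by (intro sum.cong refl) metis
qed

lemma ev_cong_series: "(\<And>w. set w \<subseteq> {1..8} \<Longrightarrow> f w = g w) \<Longrightarrow> ev f r = ev g r"
  by (rule coef_inject_ext) (simp add: coef_ev words_def)

lemma ev_add: "ev (\<lambda>w. f w + g w) r = ev f r + ev g r"
  and ev_diff: "ev (\<lambda>w. f w - g w) r = ev f r - ev g r"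
  and ev_scaleR: "ev (\<lambda>w. c * f w) r = c *\<^sub>R ev f r"
  and ev_zero: "ev (\<lambda>w. 0) r = 0"
  by (rule coef_inject_ext,
      simp add: coef_ev distrib_right left_diff_distrib sum.distrib sum_subtractf sum_distrib_left mult.assoc)+

lemma ev_sum: "ev (\<lambda>w. \<Sum>i\<in>I. f i w) r = (\<Sum>i\<in>I. ev (f i) r)"
  by (induction I rule: infinite_finite_induct) (simp_all add: ev_zero ev_add)

lemma filt_ev:
  assumes "inftes r" "\<And>w. set w \<subseteq> {1..8} \<Longrightarrow> length w < N \<Longrightarrow> f w = 0"
  shows "filt N (ev f r)"
  using assms(2)
proof (induction N arbitrary: f)
  case (Suc N)
  have "f [] = 0" using Suc.prems by simp
  moreover have "filt (1 + N) (r k * ev (\<lambda>w. f (k # w)) r)" if "k \<in> {1..8}" for k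
    using that assms(1) by (intro filt_mult Suc.IH Suc.prems) (auto simp: inftes_def)
  ultimately show ?case
    by (subst ev_rec[OF assms(1)]) (auto intro!: filt_sum)
qed simp

lemma ev_single:
  assumes "inftes r" "set w \<subseteq> {1..8}"
  shows "ev (\<lambda>u. of_bool (u = w)) r = wprod r w"
  using assms(2)
proof (induction w)
  case Nil
  show ?case by (subst ev_rec[OF assms(1)]) (simp add: ev_zero)
next
  case (Cons x w)
  have "r k * ev (\<lambda>u. of_bool (k # u = x # w)) r = (if k = x then r x * wprod r w else 0)" for k
    using Cons by (simp add: ev_zero)
  then show ?case
    using Cons.prems by (subst ev_rec[OF assms(1)]) simp
qed

definition smul :: "series \<Rightarrow> series \<Rightarrow> series" where
  "smul f g = (\<lambda>w. \<Sum>i\<le>length w. f (take i w) * g (drop i w))"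

lemma smul_Cons: "smul f g (k # w) = f [] * g (k # w) + smul (\<lambda>w. f (k # w)) g w"
  by (simp add: smul_def sum.atMost_Suc_shift del: sum.atMost_Suc)

lemma ev_smul:
  assumes "inftes r"
  shows "ev (smul f g) r = ev f r * ev g r"
proof (rule filt_all_eqI)
  fix N
  show "filt N (ev (smul f g) r - ev f r * ev g r)"
  proof (induction N arbitrary: f)
    case (Suc N)
    let ?f = "\<lambda>k w. f (k # w)" and ?g = "\<lambda>k w. g (k # w)"
    have "filt (1 + N) (r k * (ev (smul (?f k) g) r - ev (?f k) r * ev g r))" if "k \<in> {1..8}" for k
      using that assms by (intro filt_mult Suc.IH) (auto simp: inftes_def)
    then have "filt (Suc N) (\<Sum>k\<in>{1..8}. r k * (ev (smul (?f k) g) r - ev (?f k) r * ev g r))"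
      by (intro filt_sum) auto
    moreover have "ev (smul f g) r = (f [] * g []) *\<^sub>R 1
        + f [] *\<^sub>R (\<Sum>k\<in>{1..8}. r k * ev (?g k) r) + (\<Sum>k\<in>{1..8}. r k * ev (smul (?f k) g) r)"
      by (subst ev_rec[OF assms])
        (simp add: smul_Cons ev_add ev_scaleR distrib_left sum.distrib scaleR_sum_right, simp add: smul_def)
    moreover have "ev f r * ev g r = f [] *\<^sub>R ev g r + (\<Sum>k\<in>{1..8}. r k * (ev (?f k) r * ev g r))"
      by (subst ev_rec[OF assms, of f]) (simp add: distrib_right sum_distrib_right mult.assoc)
    moreover have "f [] *\<^sub>R ev g r = (f [] * g []) *\<^sub>R 1 + f [] *\<^sub>R (\<Sum>k\<in>{1..8}. r k * ev (?g k) r)"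
      by (subst ev_rec[OF assms, of g]) (simp add: scaleR_add_right)
    ultimately show ?case
      by (simp add: right_diff_distrib sum_subtractf)
  qed simp
qed

section \<open>Linear substitutions of the variables\<close>

lemma words_eq_Cons:
  "{u. set u \<subseteq> {1..8} \<and> length u = Suc n}
    = (\<lambda>(k, u). k # u) ` ({1..8} \<times> {u. set u \<subseteq> {1..8::nat} \<and> length u = n})"
  by (auto simp: length_Suc_conv image_iff)

lemma lin_subst_Nil [simp]: "lin_subst L g [] = g []"
proof -
  have "{u. set u \<subseteq> {1..8} \<and> length u = 0} = {[] :: nat list}" by auto
  then show ?thesis by (simp add: lin_subst_def)
qed

lemma lin_subst_Cons:
  "lin_subst L g (x # w) = (\<Sum>k\<in>{1..8}. L k x * lin_subst L (\<lambda>u. g (k # u)) w)"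
proof -
  let ?W = "{u. set u \<subseteq> {1..8::nat} \<and> length u = length w}"
  have inj: "inj_on (\<lambda>(k, u). k # u) ({1..8} \<times> ?W)"
    by (auto simp: inj_on_def)
  have "lin_subst L g (x # w) = (\<Sum>(k, u)\<in>{1..8} \<times> ?W.
      g (k # u) * (\<Prod>j<Suc (length w). L ((k # u) ! j) ((x # w) ! j)))"
    unfolding lin_subst_def list.size(4) add_Suc_right add_0_right words_eq_Cons
    by (subst sum.reindex[OF inj]) (simp add: case_prod_unfold)
  also have "\<dots> = (\<Sum>(k, u)\<in>{1..8} \<times> ?W. L k x * (g (k # u) * (\<Prod>j<length w. L (u ! j) (w ! j))))"
    by (simp add: prod.lessThan_Suc_shift mult_ac del: prod.lessThan_Suc)
  also have "\<dots> = (\<Sum>k\<in>{1..8}. L k x * lin_subst L (\<lambda>u. g (k # u)) w)"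
    by (simp add: lin_subst_def sum_distrib_left sum.cartesian_product)
  finally show ?thesis .
qed

lemma lin_subst_sum:
  "lin_subst L (\<lambda>u. \<Sum>i\<in>I. c i * g i u) w = (\<Sum>i\<in>I. c i * lin_subst L (g i) w)"
  unfolding lin_subst_def sum_distrib_right sum_distrib_left
  by (subst sum.swap) (simp add: mult_ac)

lemma lin_subst_diff:
  "lin_subst L (\<lambda>u. f u - g u) = (\<lambda>w. lin_subst L f w - lin_subst L g w)"
  by (simp add: lin_subst_def left_diff_distrib sum_subtractf)

lemma lin_subst_lin_subst:
  "lin_subst L (lin_subst K g) w = lin_subst (\<lambda>u x. \<Sum>k\<in>{1..8}. K u k * L k x) g w"
proof (induction w arbitrary: g)
  case (Cons x w)
  have "lin_subst L (lin_subst K g) (x # w)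
      = (\<Sum>k\<in>{1..8}. \<Sum>l\<in>{1..8}. L k x * (K l k * lin_subst L (lin_subst K (\<lambda>u. g (l # u))) w))"
    by (simp only: lin_subst_Cons lin_subst_sum sum_distrib_left)
  also have "\<dots> = (\<Sum>l\<in>{1..8}. \<Sum>k\<in>{1..8}. L k x * (K l k * lin_subst L (lin_subst K (\<lambda>u. g (l # u))) w))"
    by (rule sum.swap)
  also have "\<dots> = (\<Sum>l\<in>{1..8}. (\<Sum>k\<in>{1..8}. K l k * L k x) * lin_subst L (lin_subst K (\<lambda>u. g (l # u))) w)"
    unfolding sum_distrib_right by (simp only: mult_ac)
  finally show ?case
    by (simp only: lin_subst_Cons Cons.IH)
qed simp

lemma lin_subst_id:
  assumes "\<And>k x. k \<in> {1..8} \<Longrightarrow> L k x = of_bool (k = x)" "valid_series g"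
  shows "lin_subst L g = g"
proof
  fix w show "lin_subst L g w = g w"
    using assms(2)
  proof (induction w arbitrary: g)
    case (Cons x w)
    have "lin_subst L g (x # w) = (\<Sum>k\<in>{1..8}. if k = x then lin_subst L (\<lambda>u. g (x # u)) w else 0)"
      unfolding lin_subst_Cons by (rule sum.cong) (simp_all add: assms(1))
    also have "\<dots> = g (x # w)"
      using Cons.prems Cons.IH[of "\<lambda>u. g (x # u)"] by (auto simp: valid_series_def)
    finally show ?case .
  qed simp
qed

lemma valid_lin_subst:
  assumes "\<And>k x. k \<in> {1..8} \<Longrightarrow> x \<notin> {1..8} \<Longrightarrow> L k x = 0"
  shows "valid_series (lin_subst L g)"
proof -
  have "lin_subst L g w = 0" if "\<not> set w \<subseteq> {1..8}" for w
    using that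
  proof (induction w arbitrary: g)
    case (Cons x w)
    show ?case
    proof (cases "x \<in> {1..8}")
      case True
      then have "\<not> set w \<subseteq> {1..8}" using Cons.prems by auto
      then show ?thesis by (simp add: lin_subst_Cons Cons.IH)
    next
      case False
      then show ?thesis unfolding lin_subst_Cons by (intro sum.neutral) (simp add: assms)
    qed
  qed simp
  then show ?thesis by (simp add: valid_series_def)
qed

lemma ev_lin_subst:
  assumes "inftes r"
  shows "ev (lin_subst L g) r = ev g (\<lambda>l. \<Sum>k\<in>{1..8}. L l k *\<^sub>R r k)"
proof (rule filt_all_eqI)
  fix N
  let ?r = "\<lambda>l. \<Sum>k\<in>{1..8}. L l k *\<^sub>R r k"
  have r: "inftes ?r"
    using assms unfolding inftes_def by (blast intro: filt_sum filt_scaleR)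
  show "filt N (ev (lin_subst L g) r - ev g ?r)"
  proof (induction N arbitrary: g)
    case (Suc N)
    let ?g = "\<lambda>l u. g (l # u)"
    have "filt (1 + N) (?r l * (ev (lin_subst L (?g l)) r - ev (?g l) ?r))" if "l \<in> {1..8}" for l
      using that r by (intro filt_mult Suc.IH) (auto simp: inftes_def)
    then have "filt (Suc N) (\<Sum>l\<in>{1..8}. ?r l * (ev (lin_subst L (?g l)) r - ev (?g l) ?r))"
      by (intro filt_sum) auto
    moreover have "ev (lin_subst L g) r = g [] *\<^sub>R 1 + (\<Sum>l\<in>{1..8}. ?r l * ev (lin_subst L (?g l)) r)"
    proof -
      have "(\<Sum>k\<in>{1..8}. r k * ev (\<lambda>w. lin_subst L g (k # w)) r)
          = (\<Sum>k\<in>{1..8}. \<Sum>l\<in>{1..8}. (L l k *\<^sub>R r k) * ev (lin_subst L (?g l)) r)"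
        unfolding lin_subst_Cons by (simp only: ev_sum ev_scaleR sum_distrib_left mult_scaleR_left mult_scaleR_right)
      also have "\<dots> = (\<Sum>l\<in>{1..8}. \<Sum>k\<in>{1..8}. (L l k *\<^sub>R r k) * ev (lin_subst L (?g l)) r)"
        by (rule sum.swap)
      finally show ?thesis
        by (subst ev_rec[OF assms]) (simp only: sum_distrib_right lin_subst_Nil)
    qed
    moreover have "ev g ?r = g [] *\<^sub>R 1 + (\<Sum>l\<in>{1..8}. ?r l * ev (?g l) ?r)"
      by (rule ev_rec[OF r])
    ultimately show ?case
      by (simp add: right_diff_distrib sum_subtractf)
  qed simp
qed

section \<open>Representable functions and circular coefficients\<close>

fun spow :: "series \<Rightarrow> nat \<Rightarrow> series" where
  "spow g 0 = (\<lambda>w. of_bool (w = []))"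
| "spow g (Suc n) = smul g (spow g n)"

lemma ev_spow: "inftes r \<Longrightarrow> ev (spow g n) r = ev g r ^ n"
proof (induction n)
  case 0
  then show ?case using ev_single[of r "[]"] by simp
qed (simp add: ev_smul)

text \<open>Without constant term every factor uses up at least one letter. Hence a power series in
  g has finite sums as coefficients.\<close>

lemma spow_short:
  assumes "g [] = 0" "length w < n"
  shows "spow g n w = 0"
  using assms(2)
proof (induction n arbitrary: w)
  case (Suc n)
  have "g (take i w) * spow g n (drop i w) = 0" if "i \<le> length w" for i
  proof (cases i)
    case (Suc j)
    then have "length (drop i w) < n" using Suc.prems that by simp
    then show ?thesis using Suc.IH by simp
  qed (simp add: assms(1))
  then show ?case by (simp add: smul_def sum.neutral del: mult_eq_0_iff)
qed simp

text \<open>Functions of the split variables given by one universal series, valid at all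
  infinitesimal arguments. Closure under products, power series and inverses supplies the series of
  rational expressions such as A1 A2^{-1} without computing coefficients.\<close>

definition fq_rep :: "((nat \<Rightarrow> qalg) \<Rightarrow> qalg) \<Rightarrow> bool" where
  "fq_rep \<phi> \<longleftrightarrow> (\<exists>f. \<forall>r. inftes r \<longrightarrow> ev f r = \<phi> r)"

lemma fq_rep_var: "k \<in> {1..8} \<Longrightarrow> fq_rep (\<lambda>r. r k)"
  unfolding fq_rep_def using ev_single[of _ "[k]"]
  by (intro exI[of _ "\<lambda>u. of_bool (u = [k])"]) simp

lemma fq_rep_one: "fq_rep (\<lambda>r. 1)"
  unfolding fq_rep_def using ev_single[of _ "[]"]
  by (intro exI[of _ "\<lambda>u. of_bool (u = [])"]) simp

lemma fq_rep_add: "fq_rep \<phi> \<Longrightarrow> fq_rep \<psi> \<Longrightarrow> fq_rep (\<lambda>r. \<phi> r + \<psi> r)"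
  and fq_rep_diff: "fq_rep \<phi> \<Longrightarrow> fq_rep \<psi> \<Longrightarrow> fq_rep (\<lambda>r. \<phi> r - \<psi> r)"
  and fq_rep_mult: "fq_rep \<phi> \<Longrightarrow> fq_rep \<psi> \<Longrightarrow> fq_rep (\<lambda>r. \<phi> r * \<psi> r)"
  and fq_rep_scaleR: "fq_rep \<phi> \<Longrightarrow> fq_rep (\<lambda>r. c *\<^sub>R \<phi> r)"
  unfolding fq_rep_def by (metis ev_add, metis ev_diff, metis ev_smul, metis ev_scaleR)

lemma fq_rep_psum:
  assumes "fq_rep \<phi>" and inf: "\<And>r. inftes r \<Longrightarrow> filt 1 (\<phi> r)"
  shows "fq_rep (\<lambda>r. psum c (\<phi> r))"
proof -
  obtain g where g: "\<And>r. inftes r \<Longrightarrow> ev g r = \<phi> r"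
    using assms(1) unfolding fq_rep_def by blast
  \<comment> \<open>Evaluation at the zero tuple isolates the constant term of g, which must vanish
    for the substitution into a power series to make sense.\<close>
  have "inftes (\<lambda>k. 0)" by (simp add: inftes_def)
  from inf[OF this] have "filt 1 (g [] *\<^sub>R (1::qalg))"
    using g[OF \<open>inftes (\<lambda>k. 0)\<close>] ev_rec[OF \<open>inftes (\<lambda>k. 0)\<close>, of g] by simp
  from filtD[OF this, of mone] have g0: "g [] = 0" by (simp add: coef_one)
  define f where "f w = (\<Sum>n\<le>length w. c n * spow g n w)" for w
  have "ev f r = psum c (\<phi> r)" if r: "inftes r" for r
  proof (rule filt_all_eqI)
    fix N
    have "f w - (\<Sum>n<N. c n * spow g n w) = 0" if "length w < N" for w
    proof -
      have "(\<Sum>n\<le>length w. c n * spow g n w) = (\<Sum>n<N. c n * spow g n w)"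
        using that by (intro sum.mono_neutral_left) (auto simp: spow_short[of g, OF g0])
      then show ?thesis by (simp add: f_def)
    qed
    then have "filt N (ev (\<lambda>w. f w - (\<Sum>n<N. c n * spow g n w)) r)"
      by (intro filt_ev r) auto
    then have 1: "filt N (ev f r - (\<Sum>n<N. c n *\<^sub>R \<phi> r ^ n))"
      by (simp add: ev_diff ev_sum ev_scaleR ev_spow r g)
    show "filt N (ev f r - psum c (\<phi> r))"
      by (rule filt_trans[OF 1 filt_sym[OF psum_truncate[OF inf[OF r]]]])
  qed
  then show ?thesis unfolding fq_rep_def by blast
qed

lemma fq_rep_qinv:
  assumes "fq_rep \<phi>" "\<And>r. inftes r \<Longrightarrow> filt 1 (\<phi> r - 1)"
  shows "fq_rep (\<lambda>r. qinv (\<phi> r))"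
  unfolding qinv_def by (intro fq_rep_psum fq_rep_diff assms fq_rep_one)

lemma fq_rep_valid:
  assumes "fq_rep \<phi>"
  shows "\<exists>f. valid_series f \<and> (\<forall>r. inftes r \<longrightarrow> ev f r = \<phi> r)"
proof -
  obtain f where f: "\<And>r. inftes r \<Longrightarrow> ev f r = \<phi> r"
    using assms unfolding fq_rep_def by blast
  let ?f = "\<lambda>w. if set w \<subseteq> {1..8} then f w else 0"
  have "ev ?f r = ev f r" for r by (rule ev_cong_series) simp
  with f have "valid_series ?f \<and> (\<forall>r. inftes r \<longrightarrow> ev ?f r = \<phi> r)"
    by (simp add: valid_series_def)
  then show ?thesis by blast
qed

section \<open>The change to the circular basis and its inverse\<close>

lemma sum_1_8:
  fixes F :: "nat \<Rightarrow> 'a::comm_monoid_add"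
  shows "(\<Sum>k\<in>{1..8}. F k) = F 1 + F 2 + F 3 + F 4 + F 5 + F 6 + F 7 + F 8"
proof -
  have "{1..8::nat} = {1, 2, 3, 4, 5, 6, 7, 8}" by auto
  then show ?thesis by (simp add: add_ac)
qed

lemma ball_1_8: "(\<forall>k\<in>{1..8::nat}. P k) \<longleftrightarrow> P 1 \<and> P 2 \<and> P 3 \<and> P 4 \<and> P 5 \<and> P 6 \<and> P 7 \<and> P 8"
proof -
  have "{1..8::nat} = {1, 2, 3, 4, 5, 6, 7, 8}" by auto
  then show ?thesis by simp
qed

text \<open>\<open>unhat\<close> and \<open>untilde\<close> are the inverse matrices of
  \<open>hat_form\<close> and \<open>tilde_form\<close>; they turn the description operator in
  \<open>circ_coeff\<close> into an explicit substitution.\<close>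

definition unhat :: "nat \<Rightarrow> nat \<Rightarrow> real" where
  "unhat k i =
    (if k = 1 then of_bool (i = 3) + of_bool (i = 4)
     else if k = 5 then of_bool (i = 3) - of_bool (i = 4)
     else if k = 2 then of_bool (i = 2) + of_bool (i = 1)
     else if k = 7 then of_bool (i = 2) - of_bool (i = 1)
     else if k = 4 then of_bool (i = 6) + of_bool (i = 5)
     else if k = 8 then of_bool (i = 6) - of_bool (i = 5)
     else if k = 3 then of_bool (i = 7) + of_bool (i = 8)
     else if k = 6 then of_bool (i = 7) - of_bool (i = 8) else 0)"

definition untilde :: "nat \<Rightarrow> nat \<Rightarrow> real" where
  "untilde i l =
    (if i = 4 then (of_bool (l = 4) + of_bool (l = 5)) / 2
     else if i = 5 then (of_bool (l = 4) - of_bool (l = 5)) / 2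
     else if i \<in> {1..8} then of_bool (l = i) else 0)"

lemma unhat_hat: "k \<in> {1..8} \<Longrightarrow> (\<Sum>i\<in>{1..8}. unhat k i * hat_form i x) = of_bool (k = x)"
  and hat_unhat: "k \<in> {1..8} \<Longrightarrow> (\<Sum>i\<in>{1..8}. hat_form k i * unhat i x) = of_bool (k = x)"
  and untilde_tilde: "k \<in> {1..8} \<Longrightarrow> (\<Sum>i\<in>{1..8}. untilde k i * tilde_form i x) = of_bool (k = x)"
  and tilde_untilde: "k \<in> {1..8} \<Longrightarrow> (\<Sum>i\<in>{1..8}. tilde_form k i * untilde i x) = of_bool (k = x)"
proof -
  have "\<forall>k\<in>{1..8}. (\<Sum>i\<in>{1..8}. unhat k i * hat_form i x) = of_bool (k = x)"
    unfolding ball_1_8 sum_1_8 by (simp add: unhat_def hat_form_def field_simps)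
  then show "k \<in> {1..8} \<Longrightarrow> (\<Sum>i\<in>{1..8}. unhat k i * hat_form i x) = of_bool (k = x)" by blast
  have "\<forall>k\<in>{1..8}. (\<Sum>i\<in>{1..8}. hat_form k i * unhat i x) = of_bool (k = x)"
    unfolding ball_1_8 sum_1_8 by (simp add: unhat_def hat_form_def field_simps)
  then show "k \<in> {1..8} \<Longrightarrow> (\<Sum>i\<in>{1..8}. hat_form k i * unhat i x) = of_bool (k = x)" by blast
  have "\<forall>k\<in>{1..8}. (\<Sum>i\<in>{1..8}. untilde k i * tilde_form i x) = of_bool (k = x)"
    unfolding ball_1_8 sum_1_8 by (simp add: untilde_def tilde_form_def field_simps)
  then show "k \<in> {1..8} \<Longrightarrow> (\<Sum>i\<in>{1..8}. untilde k i * tilde_form i x) = of_bool (k = x)" by blast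
  have "\<forall>k\<in>{1..8}. (\<Sum>i\<in>{1..8}. tilde_form k i * untilde i x) = of_bool (k = x)"
    unfolding ball_1_8 sum_1_8 by (simp add: untilde_def tilde_form_def field_simps)
  then show "k \<in> {1..8} \<Longrightarrow> (\<Sum>i\<in>{1..8}. tilde_form k i * untilde i x) = of_bool (k = x)" by blast
qed

lemma lin_subst_cancel:
  assumes "\<And>k x. k \<in> {1..8} \<Longrightarrow> (\<Sum>i\<in>{1..8}. K k i * L i x) = of_bool (k = x)" "valid_series g"
  shows "lin_subst L (lin_subst K g) = g"
proof -
  have "lin_subst L (lin_subst K g) = lin_subst (\<lambda>u x. \<Sum>i\<in>{1..8}. K u i * L i x) g"
    by (rule ext) (rule lin_subst_lin_subst)
  also have "\<dots> = g" by (rule lin_subst_id) (rule assms, assumption, rule assms)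
  finally show ?thesis .
qed

lemma valid_forms:
  "valid_series (lin_subst hat_form g)" "valid_series (lin_subst tilde_form g)"
  "valid_series (lin_subst unhat g)" "valid_series (lin_subst untilde g)"
  by (rule valid_lin_subst; auto simp: hat_form_def tilde_form_def unhat_def untilde_def)+

lemma lin_subst_inverse:
  assumes "valid_series g"
  shows "lin_subst hat_form (lin_subst unhat g) = g" "lin_subst unhat (lin_subst hat_form g) = g"
    "lin_subst tilde_form (lin_subst untilde g) = g" "lin_subst untilde (lin_subst tilde_form g) = g"
  by (rule lin_subst_cancel[OF _ assms];
      erule unhat_hat hat_unhat untilde_tilde tilde_untilde)+

lemma circ_coeff_eq:
  assumes "valid_series f"
  shows "circ_coeff f = lin_subst untilde (lin_subst unhat f)"
  unfolding circ_coeff_def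
proof (rule the_equality)
  show "valid_series (lin_subst untilde (lin_subst unhat f)) \<and>
      lin_subst hat_form (lin_subst tilde_form (lin_subst untilde (lin_subst unhat f))) = f"
    by (simp add: lin_subst_inverse valid_forms assms)
  fix g assume g: "valid_series g \<and> lin_subst hat_form (lin_subst tilde_form g) = f"
  then have "lin_subst untilde (lin_subst unhat f)
      = lin_subst untilde (lin_subst unhat (lin_subst hat_form (lin_subst tilde_form g)))" by simp
  also have "\<dots> = g"
    using conjunct1[OF g] by (simp add: lin_subst_inverse valid_forms)
  finally show "g = lin_subst untilde (lin_subst unhat f)" by simp
qed

lemma circ_coeff_inverse:
  assumes "valid_series f"
  shows "valid_series (circ_coeff f)" "lin_subst hat_form (lin_subst tilde_form (circ_coeff f)) = f"
  by (simp_all add: circ_coeff_eq[OF assms] lin_subst_inverse valid_forms assms)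

lemma valid_series_diff: "valid_series f \<Longrightarrow> valid_series g \<Longrightarrow> valid_series (\<lambda>w. f w - g w)"
  by (simp add: valid_series_def)

lemma circ_coeff_diff:
  assumes "valid_series f" "valid_series g"
  shows "circ_coeff (\<lambda>w. f w - g w) w = circ_coeff f w - circ_coeff g w"
  by (simp add: circ_coeff_eq assms valid_series_diff lin_subst_diff)

text \<open>The circular variables belonging to the split variables r.\<close>

definition rt :: "(nat \<Rightarrow> qalg) \<Rightarrow> nat \<Rightarrow> qalg" where
  "rt r l = (\<Sum>i\<in>{1..8}. tilde_form l i *\<^sub>R (\<Sum>k\<in>{1..8}. hat_form i k *\<^sub>R r k))"

lemma ev_rt:
  assumes "inftes r" "valid_series f"
  shows "ev f r = ev (circ_coeff f) (rt r)"
proof -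
  let ?h = "\<lambda>i. \<Sum>k\<in>{1..8}. hat_form i k *\<^sub>R r k"
  have h: "inftes ?h"
    using assms unfolding inftes_def by (blast intro: filt_sum filt_scaleR)
  have "ev f r = ev (lin_subst hat_form (lin_subst tilde_form (circ_coeff f))) r"
    by (simp add: circ_coeff_inverse assms)
  also have "\<dots> = ev (lin_subst tilde_form (circ_coeff f)) ?h"
    by (rule ev_lin_subst[OF assms(1)])
  also have "\<dots> = ev (circ_coeff f) (rt r)"
    unfolding ev_lin_subst[OF h] rt_def ..
  finally show ?thesis .
qed

lemma rt_simps:
  "rt r 1 = (1/2) *\<^sub>R (r 2 - r 7)" "rt r 2 = (1/2) *\<^sub>R (r 2 + r 7)"
  "rt r 3 = (1/2) *\<^sub>R (r 1 + r 5)" "rt r 4 = (1/2) *\<^sub>R (r 1 - r 5 + r 4 - r 8)"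
  "rt r 5 = (1/2) *\<^sub>R (r 1 - r 5 - r 4 + r 8)" "rt r 6 = (1/2) *\<^sub>R (r 4 + r 8)"
  "rt r 7 = (1/2) *\<^sub>R (r 3 + r 6)" "rt r 8 = (1/2) *\<^sub>R (r 3 - r 6)"
  unfolding rt_def sum_1_8 by (simp_all add: tilde_form_def hat_form_def algebra_simps)

lemma inftes_rt: "inftes r \<Longrightarrow> inftes (rt r)"
  unfolding inftes_def rt_def by (blast intro: filt_sum filt_scaleR)

section \<open>Reading off and prescribing the coefficients along one axis\<close>

lemma ev_one_variable:
  assumes "filt 1 t" "j \<in> {1..8}"
  shows "ev g (\<lambda>l. if l = j then t else 0) = psum (\<lambda>n. g (replicate n j)) t"
proof (rule filt_all_eqI)
  fix N
  let ?r = "\<lambda>l. if l = j then t else 0"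
  have r: "inftes ?r" using assms by (simp add: inftes_def)
  show "filt N (ev g ?r - psum (\<lambda>n. g (replicate n j)) t)"
  proof (induction N arbitrary: g)
    case (Suc N)
    have "ev g ?r = g [] *\<^sub>R 1 + (\<Sum>k\<in>{1..8}. if k = j then t * ev (\<lambda>w. g (j # w)) ?r else 0)"
      unfolding ev_rec[OF r, of g] by (intro arg_cong2[of _ _ _ _ "(+)"] sum.cong refl) simp
    then have "ev g ?r = g [] *\<^sub>R 1 + t * ev (\<lambda>w. g (j # w)) ?r"
      using assms(2) by simp
    moreover have "psum (\<lambda>n. g (replicate n j)) t = g [] *\<^sub>R 1 + t * psum (\<lambda>n. g (j # replicate n j)) t"
      by (subst psum_rec[OF assms(1)]) simp
    moreover have "filt (1 + N) (t * (ev (\<lambda>w. g (j # w)) ?r - psum (\<lambda>n. g (j # replicate n j)) t))"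
      using Suc[of "\<lambda>w. g (j # w)"] by (intro filt_mult assms)
    ultimately show ?case by (simp add: right_diff_distrib)
  qed simp
qed

text \<open>\<open>qX 1\<close> and \<open>qX 2\<close> are R1 and R2; \<open>qX 0\<close> serves as
  a bare formal variable for test points.\<close>

definition qX :: "nat \<Rightarrow> qalg" where "qX i = qalg_of (agen i)"

lemma coef_qX: "coef (qX i) = agen i"
  by (simp add: qX_def qalg_of_inverse)

lemma filt_qX: "filt 1 (qX i)"
  by (rule filtI) (auto simp: coef_qX agen_def abasis_def)

definition xmono :: "nat \<Rightarrow> mono" where
  "xmono n = ((False, False), replicate n (0, (False, False)))"

lemma coef_qX_power: "coef (qX 0 ^ n) = abasis (xmono n)"
proof (induction n)
  case 0
  show ?case by (simp add: one_qalg.rep_eq aone_def xmono_def)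
next
  case (Suc n)
  have "mm ((False, False), [(0, (False, False))]) (xmono n) = xmono (Suc n)"
    "ms ((False, False), [(0, (False, False))]) (xmono n) = 1"
    unfolding xmono_def
    using mm_snoc[of "(False, False)" "[]"] ms_snoc[of "(False, False)" "[]"]
    by (simp_all add: qprod_def qsign_def)
  then show ?case
    by (simp add: times_qalg.rep_eq Suc coef_qX agen_def amul_abasis ascale_def)
qed

lemma coef_psum_qX: "coef (psum c (qX 0)) (xmono N) = c N"
proof -
  have "coef (psum c (qX 0)) (xmono N) = (\<Sum>n\<le>N. if n = N then c N else 0)"
    unfolding coef_psum coef_qX_power by (rule sum.cong) (auto simp: xmono_def abasis_def)
  then show ?thesis by simp
qed

lemma circ_coeff_replicate:
  assumes "valid_series f" "j \<in> {1..8}" "inftes r"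
    "\<And>l. l \<in> {1..8} \<Longrightarrow> rt r l = (if l = j then qX 0 else 0)"
  shows "circ_coeff f (replicate n j) = coef (ev f r) (xmono n)"
proof -
  have "ev f r = ev (circ_coeff f) (\<lambda>l. if l = j then qX 0 else 0)"
    unfolding ev_rt[OF assms(3,1)] by (rule ev_cong) (rule assms(4))
  then show ?thesis
    by (simp add: ev_one_variable[OF filt_qX assms(2)] coef_psum_qX)
qed

fun tri_solve :: "(nat \<Rightarrow> nat \<Rightarrow> real) \<Rightarrow> (nat \<Rightarrow> real) \<Rightarrow> nat \<Rightarrow> real" where
  "tri_solve M d N = (d N - (\<Sum>n<N. tri_solve M d n * M n N)) / M N N"

declare tri_solve.simps [simp del]

lemma triangular_solution:
  fixes M :: "nat \<Rightarrow> nat \<Rightarrow> real"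
  assumes "\<And>N. M N N \<noteq> 0"
  shows "\<exists>c. \<forall>N. (\<Sum>n\<le>N. c n * M n N) = d N"
proof (intro exI allI)
  fix N
  have "(\<Sum>n\<le>N. tri_solve M d n * M n N) = (\<Sum>n<N. tri_solve M d n * M n N) + tri_solve M d N * M N N"
    by (simp flip: lessThan_Suc_atMost)
  then show "(\<Sum>n\<le>N. tri_solve M d n * M n N) = d N"
    using tri_solve.simps[of M d N] assms[of N] by simp
qed

text \<open>As G starts with -4 X_0 and Y with 1, the coefficient of X_0^N in G^n Y is 0 for n > N
  and (-4)^N for n = N. The conditions on c form a triangular system with nonzero diagonal.\<close>

lemma psum_prescribe:
  assumes G: "filt 1 G" "filt 2 (G + 4 *\<^sub>R qX 0)" and Y: "filt 1 (Y - 1)"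
  shows "\<exists>c. \<forall>N. coef (psum c G * Y) (xmono N) = d N"
proof -
  have "coef (psum c G * Y) (xmono N) = (\<Sum>n\<le>N. c n * coef (G ^ n * Y) (xmono N))" for c N
  proof -
    have "filt (Suc N) ((psum c G - (\<Sum>n<Suc N. c n *\<^sub>R G ^ n)) * Y)"
      by (intro filt_mult_right psum_truncate G)
    from filtD[OF this, of "xmono N"] show ?thesis
      unfolding lessThan_Suc_atMost by (simp add: left_diff_distrib sum_distrib_right xmono_def)
  qed
  moreover have "coef (G ^ N * Y) (xmono N) = (-4) ^ N" for N
  proof -
    have X: "filt 1 ((-4) *\<^sub>R qX 0)" by (intro filt_scaleR filt_qX)
    have "filt (Suc N) ((G ^ N - ((-4) *\<^sub>R qX 0) ^ N) * Y)"
      using G by (intro filt_mult_right filt_power_diff X) auto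
    moreover have "filt (N + 1) (((-4) *\<^sub>R qX 0) ^ N * (Y - 1))"
      by (intro filt_mult filt_power X Y)
    ultimately have "filt (Suc N) ((G ^ N - ((-4) *\<^sub>R qX 0) ^ N) * Y + ((-4) *\<^sub>R qX 0) ^ N * (Y - 1))"
      by (intro filt_add) auto
    then have "filt (Suc N) (G ^ N * Y - ((-4) *\<^sub>R qX 0) ^ N)"
      by (simp add: algebra_simps)
    moreover have "((-4) *\<^sub>R qX 0) ^ N = (-4) ^ N *\<^sub>R qX 0 ^ N"
      by (induction N) simp_all
    ultimately have "filt (Suc N) (G ^ N * Y - (-4) ^ N *\<^sub>R qX 0 ^ N)" by simp
    from filtD[OF this, of "xmono N"] show ?thesis
      by (simp add: coef_qX_power abasis_def) (simp add: xmono_def)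
  qed
  ultimately show ?thesis
    using triangular_solution[of "\<lambda>n N. coef (G ^ n * Y) (xmono N)" d] by simp
qed

section \<open>Split variables\<close>

definition q1 :: qalg where "q1 = qalg_of aQ1"
definition q2 :: qalg where "q2 = qalg_of aQ2"

lemma coef_q: "coef q1 = aQ1" "coef q2 = aQ2"
  by (simp_all add: q1_def q2_def qalg_of_inverse)

lemma clifford [simp]: "q1 * q1 = -1" "q2 * q2 = -1" "q2 * q1 = - (q1 * q2)"
  by (rule coef_inject_ext,
      simp add: times_qalg.rep_eq one_qalg.rep_eq coef_q aQ1_def aQ2_def aone_def amul_abasis mm_Nil ms_Nil
        qsign_def qprod_def ascale_def)+

lemma clifford_left [simp]:
  "q1 * (q1 * x) = - x" "q2 * (q2 * x) = - x" "q2 * (q1 * x) = - (q1 * (q2 * x))"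
  by (simp_all flip: mult.assoc)

text \<open>The component of x that commutes (0) or anticommutes (1) with q1, according to i, and
  with q2, according to j. Since q^{-1} = -q, the commuting part of x is half of x - q x q.\<close>

definition qcomp :: "nat \<Rightarrow> nat \<Rightarrow> qalg \<Rightarrow> qalg" where
  "qcomp i j x = (let y = (if i = 0 then x - q1 * x * q1 else x + q1 * x * q1)
                 in (1/4) *\<^sub>R (if j = 0 then y - q2 * y * q2 else y + q2 * y * q2))"

definition has_type :: "nat \<Rightarrow> nat \<Rightarrow> qalg \<Rightarrow> bool" where
  "has_type i j x \<longleftrightarrow> q1 * x = (if i = 0 then x * q1 else - (x * q1)) \<and>
                     q2 * x = (if j = 0 then x * q2 else - (x * q2))"

lemma has_type_comp: "has_type i j (qcomp i j x)"
  by (simp add: has_type_def qcomp_def Let_def algebra_simps)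

lemma qcomp_type:
  assumes "has_type i j x" "i \<in> {0,1}" "j \<in> {0,1}" "i' \<in> {0,1}" "j' \<in> {0,1}"
  shows "qcomp i' j' x = (if i' = i \<and> j' = j then x else 0)"
proof -
  have "q1 * x * q1 = (if i = 0 then - x else x)" "q2 * x * q2 = (if j = 0 then - x else x)"
    using assms(1) by (simp_all add: has_type_def mult.assoc)
  then show ?thesis
    using assms(2-) by (auto simp: qcomp_def Let_def scaleR_2[symmetric] simp flip: scaleR_add_left)
qed

lemma qcomp_add: "qcomp i j (x + y) = qcomp i j x + qcomp i j y"
  and qcomp_diff: "qcomp i j (x - y) = qcomp i j x - qcomp i j y"
  by (simp_all add: qcomp_def Let_def algebra_simps)

lemma qcomp_sum: "qcomp 0 0 x + qcomp 0 1 x + qcomp 1 0 x + qcomp 1 1 x = x"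
proof -
  have "qcomp 0 0 x + qcomp 0 1 x + qcomp 1 0 x + qcomp 1 1 x = (1/4) *\<^sub>R (x + x + x + x)"
    by (simp add: qcomp_def Let_def algebra_simps)
  also have "\<dots> = x" by (simp flip: scaleR_2 add: scaleR_add_left[symmetric] add.assoc)
  finally show ?thesis .
qed

lemma filt_comp: "filt N x \<Longrightarrow> filt N (qcomp i j x)"
  unfolding qcomp_def Let_def by (auto intro!: filt_scaleR filt_add filt_diff filt_mult_both)

text \<open>\<open>splitvar\<close> carried over to \<open>qalg\<close>; \<open>- (R1 * q1)\<close>
  is R1 Q1^{-1}.\<close>

definition sv :: "qalg \<Rightarrow> qalg \<Rightarrow> nat \<Rightarrow> qalg" where
  "sv R1 R2 k = qcomp (((k - 1) mod 4) div 2) ((k - 1) mod 2)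
                  (if (k - 1) div 4 = 0 then - (R1 * q1) else - (R2 * q2))"

lemma ainv_coef: "u * v = 1 \<Longrightarrow> v * u = 1 \<Longrightarrow> ainv (coef u) = coef v"
proof -
  assume uv: "u * v = 1" "v * u = 1"
  show ?thesis unfolding ainv_def
  proof (rule the_equality)
    show "amul (coef u) (coef v) = aone \<and> amul (coef v) (coef u) = aone"
      using uv by (metis times_qalg.rep_eq one_qalg.rep_eq)
    fix y assume y: "amul (coef u) y = aone \<and> amul y (coef u) = aone"
    then have "qalg_of y * u = 1"
      by (metis UNIV_I coef_inject one_qalg.rep_eq qalg_of_inverse times_qalg.rep_eq)
    then have "qalg_of y = v" using uv by (metis mult.assoc mult_1 mult_1_right)
    then show "y = coef v" by (metis UNIV_I qalg_of_inverse)
  qed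
qed

lemma ainv_q: "ainv aQ1 = coef (- q1)" "ainv aQ2 = coef (- q2)"
  using ainv_coef[of q1 "- q1"] ainv_coef[of q2 "- q2"] by (simp_all add: coef_q)

lemma halfpart_coef:
  "halfpart aQ1 i (coef x) = coef ((1/2) *\<^sub>R (if i = 0 then x - q1 * x * q1 else x + q1 * x * q1))"
  "halfpart aQ2 i (coef x) = coef ((1/2) *\<^sub>R (if i = 0 then x - q2 * x * q2 else x + q2 * x * q2))"
  unfolding halfpart_def ainv_q
  by (simp_all add: scaleR_qalg.rep_eq flip: coef_q times_qalg.rep_eq plus_qalg.rep_eq minus_qalg.rep_eq)
    (simp_all add: mult.assoc)

lemma splitvar_coef: "splitvar (coef R1) (coef R2) k = coef (sv R1 R2 k)"
proof -
  define i j where "i = ((k - 1) mod 4) div 2" and "j = (k - 1) mod 2"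
  have "amul (if (k - 1) div 4 + 1 = 1 then coef R1 else coef R2) (ainv (Qc ((k - 1) div 4 + 1)))
     = coef (if (k - 1) div 4 = 0 then - (R1 * q1) else - (R2 * q2))"
    by (simp add: Qc_def ainv_q flip: times_qalg.rep_eq)
  then show ?thesis
    unfolding splitvar_def sv_def Let_def halfpart_coef qcomp_def
    by (simp add: halfpart_coef qcomp_def Let_def algebra_simps)
qed

lemma fq_eval_coef: "fq_eval f (coef A1) (coef A2) = coef (ev f (sv (A1 - q1) (A2 - q2)))"
proof -
  have "splitvar (coef (A1 - q1)) (coef (A2 - q2)) = (\<lambda>k. coef (sv (A1 - q1) (A2 - q2) k))"
    by (rule ext) (rule splitvar_coef)
  then show ?thesis
    by (simp add: fq_eval_def ev_def qalg_of_inverse flip: coef_q minus_qalg.rep_eq)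
qed

lemma sv_numeral:
  "sv R1 R2 1 = qcomp 0 0 (- (R1 * q1))" "sv R1 R2 2 = qcomp 0 1 (- (R1 * q1))"
  "sv R1 R2 3 = qcomp 1 0 (- (R1 * q1))" "sv R1 R2 4 = qcomp 1 1 (- (R1 * q1))"
  "sv R1 R2 5 = qcomp 0 0 (- (R2 * q2))" "sv R1 R2 6 = qcomp 0 1 (- (R2 * q2))"
  "sv R1 R2 7 = qcomp 1 0 (- (R2 * q2))" "sv R1 R2 8 = qcomp 1 1 (- (R2 * q2))"
  by (simp_all add: sv_def)

definition typed :: "(nat \<Rightarrow> qalg) \<Rightarrow> bool" where
  "typed r \<longleftrightarrow> (\<forall>k\<in>{1..8}. has_type (((k - 1) mod 4) div 2) ((k - 1) mod 2) (r k))"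

lemma typed_sv: "typed (sv R1 R2)"
  by (simp add: typed_def sv_def has_type_comp)

lemma typed_numeral:
  assumes "typed r"
  shows "has_type 0 0 (r 1)" "has_type 0 1 (r 2)" "has_type 1 0 (r 3)" "has_type 1 1 (r 4)"
    "has_type 0 0 (r 5)" "has_type 0 1 (r 6)" "has_type 1 0 (r 7)" "has_type 1 1 (r 8)"
  using assms unfolding typed_def ball_1_8 by simp_all

lemma sv_sum:
  "(sv R1 R2 1 + sv R1 R2 2 + sv R1 R2 3 + sv R1 R2 4) * q1 = R1"
  "(sv R1 R2 5 + sv R1 R2 6 + sv R1 R2 7 + sv R1 R2 8) * q2 = R2"
  unfolding sv_numeral qcomp_sum by (simp_all add: mult.assoc)

lemma inftes_sv: "filt 1 R1 \<Longrightarrow> filt 1 R2 \<Longrightarrow> inftes (sv R1 R2)"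
  by (auto simp: inftes_def sv_def intro!: filt_comp filt_minus filt_mult_right)

section \<open>Invariants of a pair under two-sided multiplication\<close>

text \<open>With s = t = 1 these are A1 Q1^{-1} and A2 Q2^{-1}; the signs s and t are those produced
  by conjugation with Q1 and Q2.\<close>

definition fa :: "real \<Rightarrow> real \<Rightarrow> (nat \<Rightarrow> qalg) \<Rightarrow> qalg" where
  "fa s t r = 1 + r 1 + t *\<^sub>R r 2 + s *\<^sub>R r 3 + (s * t) *\<^sub>R r 4"

definition fb :: "real \<Rightarrow> real \<Rightarrow> (nat \<Rightarrow> qalg) \<Rightarrow> qalg" where
  "fb s t r = 1 + r 5 + t *\<^sub>R r 6 + s *\<^sub>R r 7 + (s * t) *\<^sub>R r 8"

lemma has_type_q:
  "has_type i j x \<Longrightarrow> q1 * x = (if i = 0 then x * q1 else - (x * q1))"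
  "has_type i j x \<Longrightarrow> q2 * x = (if j = 0 then x * q2 else - (x * q2))"
  by (simp_all add: has_type_def)

text \<open>By its type each r_k passes q1 and q2 up to a sign; s and t collect exactly these
  signs.\<close>

lemma fa_fb_twist:
  assumes "typed r"
  shows "q1 * fa s t r = fa (- s) t r * q1" "q2 * fa s t r = fa s (- t) r * q2"
    "q1 * fb s t r = fb (- s) t r * q1" "q2 * fb s t r = fb s (- t) r * q2"
  unfolding fa_def fb_def distrib_left distrib_right mult_scaleR_right
    typed_numeral[OF assms, THEN has_type_q(1)] typed_numeral[OF assms, THEN has_type_q(2)]
  by simp_all

lemma fa_fb_twist_both:
  assumes "typed r"
  shows "q1 * q2 * fa s t r = fa (- s) (- t) r * (q1 * q2)"
    "q1 * q2 * fb s t r = fb (- s) (- t) r * (q1 * q2)"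
  by (simp_all add: mult.assoc fa_fb_twist[OF assms])
    (simp_all add: fa_fb_twist[OF assms] flip: mult.assoc)

lemma filt_fa_fb:
  assumes "inftes r"
  shows "filt 1 (fa s t r - 1)" "filt 1 (fb s t r - 1)"
  using assms unfolding inftes_def ball_1_8
  by (auto simp: fa_def fb_def intro!: filt_add filt_scaleR)

lemma fq_rep_fa_fb: "fq_rep (fa s t)" "fq_rep (fb s t)"
  unfolding fa_def[abs_def] fb_def[abs_def]
  by (intro fq_rep_add fq_rep_one fq_rep_scaleR fq_rep_var; simp)+

lemma fa_fb_sv: "fa 1 1 (sv R1 R2) * q1 = q1 + R1" "fb 1 1 (sv R1 R2) * q2 = q2 + R2"
  using sv_sum[of R1 R2] by (simp_all add: fa_def fb_def distrib_right add.assoc)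

lemma filt_unit_mult: "filt 1 (x - 1) \<Longrightarrow> filt 1 (y - 1) \<Longrightarrow> filt 1 (x * y - 1)"
  using filt_add[OF filt_mult_right[of 1 "x - 1" y], of "y - 1"] by (simp add: algebra_simps)

lemma qinv_intertwine:
  assumes "filt 1 (u - 1)" "filt 1 (v - 1)" "x * u = v * x"
  shows "x * qinv u = qinv v * x"
proof -
  have "qinv v * (x * u) * qinv u = qinv v * (v * x) * qinv u" using assms(3) by simp
  then show ?thesis
    by (simp add: mult.assoc qinv_right[OF assms(1)]) (simp add: qinv_left[OF assms(2)] flip: mult.assoc)
qed

lemma right_cancel: "x * u = y * u \<Longrightarrow> u * v = 1 \<Longrightarrow> x = (y :: qalg)"
  by (metis mult.assoc mult_1_right)

lemma left_cancel: "u * x = u * y \<Longrightarrow> v * u = 1 \<Longrightarrow> x = (y :: qalg)"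
  by (metis mult.assoc mult_1_left)

text \<open>With A1 = \<open>fa 1 1 r * q1\<close> and A2 = \<open>fb 1 1 r * q2\<close>, moving the
  Q's to the right gives A1 A2^{-1} = \<open>- wl 1 1 r * (q1 * q2)\<close> and A2^{-1} A1 =
  \<open>wr 1 (-1) r * (q1 * q2)\<close>. In the first case Q1 Q2 passes the inverse and flips both
  of its signs; in the second Q2 passes both factors and flips t.\<close>

definition wl :: "real \<Rightarrow> real \<Rightarrow> (nat \<Rightarrow> qalg) \<Rightarrow> qalg" where
  "wl s t r = fa s t r * qinv (fb (- s) (- t) r)"

definition wr :: "real \<Rightarrow> real \<Rightarrow> (nat \<Rightarrow> qalg) \<Rightarrow> qalg" where
  "wr s t r = qinv (fb s t r) * fa s t r"

text \<open>\<open>gl\<close> is W^2 + 1 and \<open>gr\<close> is V^2 + 1 with the Q's eliminated: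
  the inner Q1 Q2 flips both signs of the second factor, and (Q1 Q2)^2 = -1.\<close>

definition gl :: "(nat \<Rightarrow> qalg) \<Rightarrow> qalg" where "gl r = 1 - wl 1 1 r * wl (-1) (-1) r"
definition gr :: "(nat \<Rightarrow> qalg) \<Rightarrow> qalg" where "gr r = 1 - wr 1 (-1) r * wr (-1) 1 r"

lemma filt_wl_wr:
  assumes "inftes r"
  shows "filt 1 (wl s t r - 1)" "filt 1 (wr s t r - 1)"
  unfolding wl_def wr_def by (intro filt_unit_mult qinv_first filt_fa_fb assms)+

lemma filt_gl_gr:
  assumes "inftes r"
  shows "filt 1 (gl r)" "filt 1 (gr r)"
  unfolding gl_def gr_def by (intro filt_sym[OF filt_unit_mult] filt_wl_wr assms)+

lemma fq_rep_wl_wr: "fq_rep (wl s t)" "fq_rep (wr s t)"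
  unfolding wl_def[abs_def] wr_def[abs_def]
  by (intro fq_rep_mult fq_rep_qinv fq_rep_fa_fb filt_fa_fb; assumption)+

lemma fq_rep_gl_gr: "fq_rep gl" "fq_rep gr"
  unfolding gl_def[abs_def] gr_def[abs_def]
  by (intro fq_rep_diff fq_rep_one fq_rep_mult fq_rep_wl_wr)+

lemma wl_wr_twist:
  assumes "typed r" "inftes r"
  shows "q1 * q2 * wl s t r = wl (- s) (- t) r * (q1 * q2)"
    "q1 * q2 * wr s t r = wr (- s) (- t) r * (q1 * q2)"
proof -
  have i: "q1 * q2 * qinv (fb s t r) = qinv (fb (- s) (- t) r) * (q1 * q2)" for s t
    by (rule qinv_intertwine) (intro filt_fa_fb assms fa_fb_twist_both)+
  show "q1 * q2 * wl s t r = wl (- s) (- t) r * (q1 * q2)"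
    unfolding wl_def mult.assoc[symmetric] fa_fb_twist_both(1)[OF assms(1), unfolded mult.assoc[symmetric]]
    by (simp add: mult.assoc i[unfolded mult.assoc])
  show "q1 * q2 * wr s t r = wr (- s) (- t) r * (q1 * q2)"
    unfolding wr_def mult.assoc[symmetric] i[unfolded mult.assoc[symmetric]]
    by (simp add: mult.assoc fa_fb_twist_both(1)[OF assms(1), unfolded mult.assoc])
qed

lemma gl_gr_square:
  assumes "typed r" "inftes r"
  shows "gl r = 1 + (wl 1 1 r * (q1 * q2)) * (wl 1 1 r * (q1 * q2))"
    "gr r = 1 + (wr 1 (-1) r * (q1 * q2)) * (wr 1 (-1) r * (q1 * q2))"
proof -
  have pp: "q1 * q2 * (q1 * q2) = -1" by (simp add: mult.assoc)
  have sq: "(x * (q1 * q2)) * (x * (q1 * q2)) = - (x * y)" if "q1 * q2 * x = y * (q1 * q2)" for x y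
  proof -
    have "(x * (q1 * q2)) * (x * (q1 * q2)) = x * (q1 * q2 * x) * (q1 * q2)"
      by (simp only: mult.assoc)
    also have "\<dots> = x * y * (q1 * q2 * (q1 * q2))"
      unfolding that by (simp only: mult.assoc)
    finally show ?thesis unfolding pp by simp
  qed
  show "gl r = 1 + (wl 1 1 r * (q1 * q2)) * (wl 1 1 r * (q1 * q2))"
    using sq[OF wl_wr_twist(1)[OF assms, of 1 1]] by (simp add: gl_def)
  show "gr r = 1 + (wr 1 (-1) r * (q1 * q2)) * (wr 1 (-1) r * (q1 * q2))"
    using sq[OF wl_wr_twist(2)[OF assms, of 1 "-1"]] by (simp add: gr_def)
qed

text \<open>Together with their Q factors the four series are -A1 A2^{-1}, A2^{-1} A1, -A1^{-1} and
  -A2^{-1}. With cleared denominators the equations hold for the generic and for the moved pair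
  alike and can be compared by cancellation; the signs do no harm, because the variance laws are
  linear.\<close>

lemma wl_wr_quotient:
  fixes A1 A2 :: qalg
  assumes "filt 1 (A1 - q1)" "filt 1 (A2 - q2)"
  defines "r \<equiv> sv (A1 - q1) (A2 - q2)"
  shows "wl 1 1 r * (q1 * q2) * A2 = - A1" "A2 * (wr 1 (-1) r * (q1 * q2)) = A1"
    "qinv (fa (-1) 1 r) * q1 * A1 = -1" "qinv (fb 1 (-1) r) * q2 * A2 = -1"
proof -
  have r: "typed r" "inftes r"
    unfolding r_def by (intro typed_sv inftes_sv assms)+
  note [simp] = qinv_left[OF filt_fa_fb(1)[OF r(2)]] qinv_right[OF filt_fa_fb(1)[OF r(2)]]
    qinv_left[OF filt_fa_fb(2)[OF r(2)]] qinv_right[OF filt_fa_fb(2)[OF r(2)]]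
  have A: "fa 1 1 r * q1 = A1" "fb 1 1 r * q2 = A2"
    using fa_fb_sv[of "A1 - q1" "A2 - q2"] by (simp_all add: r_def)
  have "wl 1 1 r * (q1 * q2) * A2 = fa 1 1 r * qinv (fb (-1) (-1) r) * (q1 * q2 * fb 1 1 r) * q2"
    unfolding wl_def A(2)[symmetric] by (simp only: mult.assoc)
  also have "\<dots> = fa 1 1 r * (qinv (fb (-1) (-1) r) * fb (-1) (-1) r) * (q1 * q2 * q2)"
    unfolding fa_fb_twist_both[OF r(1)] by (simp only: mult.assoc)
  also have "\<dots> = - A1" by (simp add: mult.assoc A)
  finally show "wl 1 1 r * (q1 * q2) * A2 = - A1" .
  have 2: "q2 * qinv (fb 1 (-1) r) = qinv (fb 1 1 r) * q2"
    using fa_fb_twist(4)[OF r(1), of 1 "-1"] by (intro qinv_intertwine filt_fa_fb r) simp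
  have "A2 * (wr 1 (-1) r * (q1 * q2)) = fb 1 1 r * (q2 * qinv (fb 1 (-1) r)) * fa 1 (-1) r * (q1 * q2)"
    unfolding wr_def A(2)[symmetric] by (simp only: mult.assoc)
  also have "\<dots> = fb 1 1 r * qinv (fb 1 1 r) * (q2 * fa 1 (-1) r) * (q1 * q2)"
    unfolding 2 by (simp only: mult.assoc)
  also have "\<dots> = fa 1 1 r * (q2 * (q1 * q2))"
    using fa_fb_twist(2)[OF r(1), of 1 "-1"] by (simp add: mult.assoc)
  also have "\<dots> = A1" by (simp add: A)
  finally show "A2 * (wr 1 (-1) r * (q1 * q2)) = A1" .
  have "qinv (fa (-1) 1 r) * q1 * A1 = qinv (fa (-1) 1 r) * (q1 * fa 1 1 r) * q1"
    unfolding A(1)[symmetric] by (simp only: mult.assoc)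
  also have "\<dots> = qinv (fa (-1) 1 r) * fa (-1) 1 r * (q1 * q1)"
    unfolding fa_fb_twist[OF r(1)] by (simp only: mult.assoc)
  finally show "qinv (fa (-1) 1 r) * q1 * A1 = -1" by simp
  have "qinv (fb 1 (-1) r) * q2 * A2 = qinv (fb 1 (-1) r) * (q2 * fb 1 1 r) * q2"
    unfolding A(2)[symmetric] by (simp only: mult.assoc)
  also have "\<dots> = qinv (fb 1 (-1) r) * fb 1 (-1) r * (q2 * q2)"
    unfolding fa_fb_twist[OF r(1)] by (simp only: mult.assoc)
  finally show "qinv (fb 1 (-1) r) * q2 * A2 = -1" by simp
qed

text \<open>Each A_i has the form u q_i with u near 1, so -q_i u^{-1} inverts it.\<close>

lemma near_q_invertible:
  assumes "filt 1 (A1 - q1)" "filt 1 (A2 - q2)"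
  obtains v1 v2 where "A1 * v1 = 1" "v1 * A1 = 1" "A2 * v2 = 1" "v2 * A2 = 1"
proof -
  let ?r = "sv (A1 - q1) (A2 - q2)"
  have r: "inftes ?r" by (intro inftes_sv assms)
  have A: "fa 1 1 ?r * q1 = A1" "fb 1 1 ?r * q2 = A2"
    using fa_fb_sv[of "A1 - q1" "A2 - q2"] by simp_all
  have *: "u * q * (- q * qinv u) = 1" "(- q * qinv u) * (u * q) = 1"
    if "filt 1 (u - 1)" "q * q = -1" for u q
  proof -
    have "u * q * (- q * qinv u) = - (u * (q * q) * qinv u)" by (simp add: mult.assoc)
    then show "u * q * (- q * qinv u) = 1" using that by (simp add: qinv_right)
    have "(- q * qinv u) * (u * q) = - (q * (qinv u * u) * q)" by (simp add: mult.assoc)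
    then show "(- q * qinv u) * (u * q) = 1" using that by (simp add: qinv_left)
  qed
  show thesis
    using that[of "- q1 * qinv (fa 1 1 ?r)" "- q2 * qinv (fb 1 1 ?r)"]
      *[OF filt_fa_fb(1)[OF r, of 1 1] clifford(1)] *[OF filt_fa_fb(2)[OF r, of 1 1] clifford(2)]
    by (simp only: A)
qed

section \<open>The generic pair Q_i + X_i (\<open>rA\<close>) and its image under the multipliers u,
  v (\<open>rB\<close>)\<close>

definition rA :: "nat \<Rightarrow> qalg" where "rA = sv (qX 1) (qX 2)"

definition rB :: "qalg \<Rightarrow> qalg \<Rightarrow> nat \<Rightarrow> qalg" where
  "rB u v = sv (u * (q1 + qX 1) * v - q1) (u * (q2 + qX 2) * v - q2)"

text \<open>T is the variance law and S the Clifford factor behind the series: q1 or q2 for a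
  component of a vectorial operation, 1 for a scalar, q1 q2 for a pseudoscalar.\<close>

definition variant :: "(qalg \<Rightarrow> qalg \<Rightarrow> qalg \<Rightarrow> qalg) \<Rightarrow> qalg \<Rightarrow> series \<Rightarrow> bool" where
  "variant T S f \<longleftrightarrow> (\<forall>u v. filt 1 (u - 1) \<longrightarrow> filt 1 (v - 1) \<longrightarrow>
      ev f (rB u v) * S = T u v (ev f rA * S))"

lemma filt_B:
  assumes "filt 1 (u - 1)" "filt 1 (v - 1)" "filt 1 R"
  shows "filt 1 (u * (q + R) * v - q)"
proof -
  have "filt 1 ((u - 1) * (q + R) * v + (q + R) * (v - 1) + R)"
    by (intro filt_add assms filt_mult_left[OF assms(2)] filt_mult_right[OF filt_mult_right[OF assms(1)]])
  then show ?thesis by (simp add: algebra_simps)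
qed

lemma inftes_rA: "inftes rA" and typed_rA: "typed rA" and typed_rB: "typed (rB u v)"
  unfolding rA_def rB_def by (intro inftes_sv filt_qX typed_sv)+

lemma inftes_rB: "filt 1 (u - 1) \<Longrightarrow> filt 1 (v - 1) \<Longrightarrow> inftes (rB u v)"
  unfolding rB_def by (intro inftes_sv filt_B filt_qX)

lemma conj_square:
  fixes a b w :: qalg
  assumes "a * b = 1" "b * a = 1"
  shows "1 + (a * w * b) * (a * w * b) = a * (1 + w * w) * b"
proof -
  have "(a * w * b) * (a * w * b) = a * w * (b * a) * w * b"
    by (simp only: mult.assoc)
  then show ?thesis by (simp add: assms distrib_left distrib_right mult.assoc)
qed

text \<open>The factor v cancels in (u A1 v)(u A2 v)^{-1}; z cancels u A2 v on the right.\<close>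

lemma left_quotient_conj:
  fixes W :: qalg
  assumes "W * A2 = - A1" "W' * (u * A2 * v) = - (u * A1 * v)" "(u * A2 * v) * z = 1" "u' * u = 1"
  shows "W' = u * W * u'"
proof (rule right_cancel[OF _ assms(3)])
  have "u * W * u' * (u * A2 * v) = u * W * (u' * u) * A2 * v" by (simp only: mult.assoc)
  also have "\<dots> = u * (W * A2) * v" by (simp add: assms(4) mult.assoc)
  also have "\<dots> = - (u * A1 * v)" unfolding assms(1) by simp
  finally show "W' * (u * A2 * v) = u * W * u' * (u * A2 * v)" using assms(2) by simp
qed

lemma right_quotient_conj:
  fixes W :: qalg
  assumes "A2 * W = A1" "(u * A2 * v) * W' = u * A1 * v" "z * (u * A2 * v) = 1" "v * v' = 1"
  shows "W' = v' * W * v"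
proof (rule left_cancel[OF _ assms(3)])
  have "u * A2 * v * (v' * W * v) = u * A2 * (v * v') * W * v" by (simp only: mult.assoc)
  also have "\<dots> = u * (A2 * W) * v" by (simp add: assms(4) mult.assoc)
  finally show "u * A2 * v * W' = u * A2 * v * (v' * W * v)" using assms(1,2) by simp
qed

context
  fixes u v :: qalg
  assumes u: "filt 1 (u - 1)" and v: "filt 1 (v - 1)"
begin

lemma near_q_base: "filt 1 (q1 + qX 1 - q1)" "filt 1 (q2 + qX 2 - q2)"
  by (simp_all add: filt_qX del: One_nat_def)

lemma near_q_moved: "filt 1 (u * (q1 + qX 1) * v - q1)" "filt 1 (u * (q2 + qX 2) * v - q2)"
  by (intro filt_B u v filt_qX)+

lemma wl_variant: "wl 1 1 (rB u v) * (q1 * q2) = u * (wl 1 1 rA * (q1 * q2)) * qinv u"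
proof -
  obtain z1 z2 where z: "u * (q1 + qX 1) * v * z1 = 1" "z1 * (u * (q1 + qX 1) * v) = 1"
    "u * (q2 + qX 2) * v * z2 = 1" "z2 * (u * (q2 + qX 2) * v) = 1"
    by (rule near_q_invertible[OF near_q_moved])
  have rA: "rA = sv (q1 + qX 1 - q1) (q2 + qX 2 - q2)" by (simp add: rA_def)
  show ?thesis
    unfolding rB_def rA
    by (rule left_quotient_conj[OF wl_wr_quotient(1)[OF near_q_base] wl_wr_quotient(1)[OF near_q_moved]
          z(3) qinv_left[OF u]])
qed

lemma gl_variant: "gl (rB u v) = u * gl rA * qinv u"
  unfolding gl_gr_square(1)[OF typed_rB inftes_rB[OF u v]] gl_gr_square(1)[OF typed_rA inftes_rA] wl_variant
  by (rule conj_square[OF qinv_right[OF u] qinv_left[OF u]])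

lemma wr_variant: "wr 1 (-1) (rB u v) * (q1 * q2) = qinv v * (wr 1 (-1) rA * (q1 * q2)) * v"
proof -
  obtain z1 z2 where z: "u * (q1 + qX 1) * v * z1 = 1" "z1 * (u * (q1 + qX 1) * v) = 1"
    "u * (q2 + qX 2) * v * z2 = 1" "z2 * (u * (q2 + qX 2) * v) = 1"
    by (rule near_q_invertible[OF near_q_moved])
  have rA: "rA = sv (q1 + qX 1 - q1) (q2 + qX 2 - q2)" by (simp add: rA_def)
  show ?thesis
    unfolding rB_def rA
    by (rule right_quotient_conj[OF wl_wr_quotient(2)[OF near_q_base] wl_wr_quotient(2)[OF near_q_moved]
          z(4) qinv_right[OF v]])
qed

lemma gr_variant: "gr (rB u v) = qinv v * gr rA * v"
  unfolding gl_gr_square(2)[OF typed_rB inftes_rB[OF u v]] gl_gr_square(2)[OF typed_rA inftes_rA] wr_variant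
  by (rule conj_square[OF qinv_left[OF v] qinv_right[OF v]])

lemma fa_fb_variant:
  "fa 1 1 (rB u v) * q1 = u * (fa 1 1 rA * q1) * v" "fb 1 1 (rB u v) * q2 = u * (fb 1 1 rA * q2) * v"
  unfolding rA_def rB_def fa_fb_sv by simp_all

lemma qinv_fa_fb_variant:
  "qinv (fa (-1) 1 (rB u v)) * q1 = qinv v * (qinv (fa (-1) 1 rA) * q1) * qinv u"
  "qinv (fb 1 (-1) (rB u v)) * q2 = qinv v * (qinv (fb 1 (-1) rA) * q2) * qinv u"
proof -
  obtain z1 z2 where z: "u * (q1 + qX 1) * v * z1 = 1" "z1 * (u * (q1 + qX 1) * v) = 1"
    "u * (q2 + qX 2) * v * z2 = 1" "z2 * (u * (q2 + qX 2) * v) = 1"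
    by (rule near_q_invertible[OF near_q_moved])
  have rA: "rA = sv (q1 + qX 1 - q1) (q2 + qX 2 - q2)" by (simp add: rA_def)
  have *: "Z' = qinv v * Z * qinv u" if "Z * X = -1" "Z' * (u * X * v) = -1" "u * X * v * z = 1"
    for Z Z' X z
  proof (rule right_cancel[OF _ that(3)])
    have "qinv v * Z * qinv u * (u * X * v) = qinv v * Z * (qinv u * u) * X * v"
      by (simp only: mult.assoc)
    also have "\<dots> = qinv v * (Z * X) * v" by (simp add: qinv_left[OF u] mult.assoc)
    also have "\<dots> = -1" by (simp add: that(1) qinv_left[OF v])
    finally show "Z' * (u * X * v) = qinv v * Z * qinv u * (u * X * v)" using that(2) by simp
  qed
  show "qinv (fa (-1) 1 (rB u v)) * q1 = qinv v * (qinv (fa (-1) 1 rA) * q1) * qinv u"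
    unfolding rB_def rA
    by (rule *[OF wl_wr_quotient(3)[OF near_q_base] wl_wr_quotient(3)[OF near_q_moved] z(1)])
  show "qinv (fb 1 (-1) (rB u v)) * q2 = qinv v * (qinv (fb 1 (-1) rA) * q2) * qinv u"
    unfolding rB_def rA
    by (rule *[OF wl_wr_quotient(4)[OF near_q_base] wl_wr_quotient(4)[OF near_q_moved] z(3)])
qed

end

section \<open>Existence\<close>

definition Tbi :: "qalg \<Rightarrow> qalg \<Rightarrow> qalg \<Rightarrow> qalg" where "Tbi u v x = u * (x * v)"
definition Tanti :: "qalg \<Rightarrow> qalg \<Rightarrow> qalg \<Rightarrow> qalg" where "Tanti u v x = qinv v * (x * qinv u)"
definition Tleft :: "qalg \<Rightarrow> qalg \<Rightarrow> qalg \<Rightarrow> qalg" where "Tleft u v x = u * (x * qinv u)"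
definition Tright :: "qalg \<Rightarrow> qalg \<Rightarrow> qalg \<Rightarrow> qalg" where "Tright u v x = qinv v * (x * v)"

text \<open>The operation is \<open>psum c (G r) * Y r\<close>. Y provides one solution of the
  variance law, and G moves by a conjugation which that law absorbs, so every c is admissible. At
  \<rho>, a point on the axis of the circular variable j, the coefficients are adjusted through
  c.\<close>

lemma variant_exists:
  assumes G: "fq_rep G" "\<And>r. inftes r \<Longrightarrow> filt 1 (G r)"
    and Y: "fq_rep Y" "\<And>r. inftes r \<Longrightarrow> filt 1 (Y r - 1)"
    and T: "\<And>u v. filt 1 (u - 1) \<Longrightarrow> filt 1 (v - 1) \<Longrightarrow>
      \<exists>a b. a * b = 1 \<and> b * a = 1 \<and> G (rB u v) = a * G rA * b \<and>
        (\<forall>x. a * x * b * (Y (rB u v) * S) = T u v (x * (Y rA * S)))"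
    and \<rho>: "inftes \<rho>" "\<And>l. l \<in> {1..8} \<Longrightarrow> rt \<rho> l = (if l = j then qX 0 else 0)" "j \<in> {1..8}"
    and lead: "filt 2 (G \<rho> + 4 *\<^sub>R qX 0)"
  shows "\<exists>f. valid_series f \<and> variant T S f \<and> (\<forall>n. circ_coeff f (replicate n j) = d n)"
proof -
  obtain c where c: "\<And>n. coef (psum c (G \<rho>) * Y \<rho>) (xmono n) = d n"
    using psum_prescribe[OF G(2)[OF \<rho>(1)] lead Y(2)[OF \<rho>(1)], of d] by blast
  have "fq_rep (\<lambda>r. psum c (G r) * Y r)"
    by (intro fq_rep_mult fq_rep_psum G Y)
  then obtain f where f: "valid_series f" "\<And>r. inftes r \<Longrightarrow> ev f r = psum c (G r) * Y r"
    using fq_rep_valid by blast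
  have "variant T S f"
    unfolding variant_def
  proof (intro allI impI)
    fix u v :: qalg assume uv: "filt 1 (u - 1)" "filt 1 (v - 1)"
    obtain a b where ab: "a * b = 1" "b * a = 1" "G (rB u v) = a * G rA * b"
      "\<And>x. a * x * b * (Y (rB u v) * S) = T u v (x * (Y rA * S))"
      using T[OF uv] by blast
    have "ev f (rB u v) * S = a * psum c (G rA) * b * (Y (rB u v) * S)"
      unfolding f(2)[OF inftes_rB[OF uv]] ab(3) psum_conj[OF G(2)[OF inftes_rA] ab(2,1)]
      by (simp only: mult.assoc)
    also have "\<dots> = T u v (ev f rA * S)"
      unfolding ab(4) f(2)[OF inftes_rA] by (simp only: mult.assoc)
    finally show "ev f (rB u v) * S = T u v (ev f rA * S)" .
  qed
  moreover have "circ_coeff f (replicate n j) = d n" for n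
    using circ_coeff_replicate[OF f(1) \<rho>(3,1,2)] f(2)[OF \<rho>(1)] c by simp
  ultimately show ?thesis using f(1) by blast
qed

text \<open>The point whose only nonzero circular variable is X_0 in place 4 (s = 1) or 5 (s = -1),
  found by inverting the change of basis. X_0 has no commutation type, so the point is not
  \<open>typed\<close>; \<open>gl\<close> and \<open>gr\<close> can still be evaluated there,
  because \<open>fq_rep\<close> covers all infinitesimal arguments.\<close>

definition rho :: "real \<Rightarrow> nat \<Rightarrow> qalg" where
  "rho s k = (if k = 1 then (1/2) *\<^sub>R qX 0 else if k = 5 then (-1/2) *\<^sub>R qX 0
              else if k = 4 then (s/2) *\<^sub>R qX 0 else if k = 8 then (-s/2) *\<^sub>R qX 0 else 0)"

lemma inftes_rho: "inftes (rho s)"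
  by (auto simp: inftes_def rho_def intro!: filt_minus filt_scaleR filt_qX simp del: One_nat_def)

lemma half_sum: "(1/2) *\<^sub>R x + (1/2) *\<^sub>R x = (x::qalg)"
  by (simp flip: scaleR_add_left)

lemma rt_rho:
  "l \<in> {1..8} \<Longrightarrow> rt (rho 1) l = (if l = 4 then qX 0 else 0)"
  "l \<in> {1..8} \<Longrightarrow> rt (rho (-1)) l = (if l = 5 then qX 0 else 0)"
proof -
  have "\<forall>l\<in>{1..8}. rt (rho 1) l = (if l = 4 then qX 0 else 0)"
    unfolding ball_1_8 rt_simps by (simp add: rho_def algebra_simps flip: scaleR_add_left)
  then show "l \<in> {1..8} \<Longrightarrow> rt (rho 1) l = (if l = 4 then qX 0 else 0)" by blast
  have "\<forall>l\<in>{1..8}. rt (rho (-1)) l = (if l = 5 then qX 0 else 0)"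
    unfolding ball_1_8 rt_simps by (simp add: rho_def algebra_simps flip: scaleR_add_left)
  then show "l \<in> {1..8} \<Longrightarrow> rt (rho (-1)) l = (if l = 5 then qX 0 else 0)" by blast
qed

lemma fa_fb_rho:
  "s * t * p = 1 \<Longrightarrow> fa s t (rho p) = 1 + qX 0" "s * t * p = 1 \<Longrightarrow> fb s t (rho p) = 1 - qX 0"
  using half_sum[of "qX 0"] by (simp_all add: fa_def fb_def rho_def algebra_simps)

lemma filt_2_mult:
  assumes "filt 1 x" "filt 1 y" "filt 2 (a - (1 + x))" "filt 2 (b - (1 + y))"
  shows "filt 2 (a * b - (1 + x + y))"
proof -
  have "filt 2 ((a - (1 + x)) * b + (1 + x) * (b - (1 + y)) + x * y)"
    using filt_mult[OF assms(1,2)] assms(3,4)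
    by (intro filt_add filt_mult_left[OF assms(4)] filt_mult_right[OF assms(3)]) (simp add: numeral_2_eq_2)
  then show ?thesis by (simp add: algebra_simps)
qed

lemma filt_2_qinv:
  assumes "filt 1 x" "filt 2 (u - (1 + x))"
  shows "filt 2 (qinv u - (1 - x))"
proof -
  have "filt 1 ((u - (1 + x)) + x)"
    by (intro filt_add assms filt_mono[OF assms(2)]) simp
  then have u: "filt 1 (u - 1)" by simp
  have "filt 2 (u * (1 - x) - (1 + x + - x))"
    by (rule filt_2_mult) (use assms filt_minus in auto)
  then have "filt 2 (qinv u * (u * (1 - x) - 1))"
    by (intro filt_mult_left) simp
  moreover have "qinv u * (u * (1 - x) - 1) = (1 - x) - qinv u"
    by (simp add: right_diff_distrib[of "qinv u"] qinv_left[OF u] flip: mult.assoc)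
  ultimately show ?thesis using filt_sym by metis
qed

text \<open>Since s t agrees with the sign of the axis, every \<open>fa\<close> that occurs is 1 +
  X_0 and every \<open>fb\<close> is 1 - X_0. Each quotient is 1 + 2 X_0 and their product 1 + 4 X_0
  modulo degree 2, which is the origin of the constant 4.\<close>

lemma lead_gl_gr: "filt 2 (gl (rho 1) + 4 *\<^sub>R qX 0)" "filt 2 (gr (rho (-1)) + 4 *\<^sub>R qX 0)"
proof -
  let ?t = "qX 0"
  have t: "filt 1 ?t" "filt 1 (?t + ?t)" by (intro filt_add filt_qX)+
  have i: "filt 2 (qinv (1 - ?t) - (1 + ?t))"
    using filt_2_qinv[of "- ?t" "1 - ?t"] t by (simp add: filt_minus)
  have l: "filt 2 ((1 + ?t) * qinv (1 - ?t) - (1 + (?t + ?t)))"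
    using filt_2_mult[OF t(1) t(1) _ i, of "1 + ?t"] by (simp add: add.assoc)
  have r: "filt 2 (qinv (1 - ?t) * (1 + ?t) - (1 + (?t + ?t)))"
    using filt_2_mult[OF t(1) t(1) i, of "1 + ?t"] by (simp add: add.assoc)
  have four: "4 *\<^sub>R ?t = ?t + ?t + (?t + ?t)"
    using scaleR_add_left[of 2 2 ?t] by (simp add: scaleR_2)
  show "filt 2 (gl (rho 1) + 4 *\<^sub>R qX 0)"
    using filt_sym[OF filt_2_mult[OF t(2) t(2) l l]]
    by (simp add: gl_def wl_def fa_fb_rho four algebra_simps)
  show "filt 2 (gr (rho (-1)) + 4 *\<^sub>R qX 0)"
    using filt_sym[OF filt_2_mult[OF t(2) t(2) r r]]
    by (simp add: gr_def wr_def fa_fb_rho four algebra_simps)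
qed

lemma variant_exists_left:
  assumes "fq_rep Y" "\<And>r. inftes r \<Longrightarrow> filt 1 (Y r - 1)"
    and "\<And>u v. filt 1 (u - 1) \<Longrightarrow> filt 1 (v - 1) \<Longrightarrow> Y (rB u v) * S = T u v (Y rA * S)"
    and "\<And>u v x y. filt 1 (u - 1) \<Longrightarrow> u * x * qinv u * T u v y = T u v (x * y)"
  shows "\<exists>f. valid_series f \<and> variant T S f \<and> (\<forall>n. circ_coeff f (replicate n 4) = d n)"
proof (rule variant_exists[OF fq_rep_gl_gr(1) filt_gl_gr(1) assms(1,2) _ inftes_rho rt_rho(1) _ lead_gl_gr(1)])
  fix u v :: qalg assume uv: "filt 1 (u - 1)" "filt 1 (v - 1)"
  show "\<exists>a b. a * b = 1 \<and> b * a = 1 \<and> gl (rB u v) = a * gl rA * b \<and>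
      (\<forall>x. a * x * b * (Y (rB u v) * S) = T u v (x * (Y rA * S)))"
    unfolding assms(3)[OF uv]
    using assms(4)[OF uv(1)] qinv_left[OF uv(1)] qinv_right[OF uv(1)] gl_variant[OF uv] by blast
qed auto

lemma variant_exists_right:
  assumes "fq_rep Y" "\<And>r. inftes r \<Longrightarrow> filt 1 (Y r - 1)"
    and "\<And>u v. filt 1 (u - 1) \<Longrightarrow> filt 1 (v - 1) \<Longrightarrow> Y (rB u v) * S = T u v (Y rA * S)"
    and "\<And>u v x y. filt 1 (v - 1) \<Longrightarrow> qinv v * x * v * T u v y = T u v (x * y)"
  shows "\<exists>f. valid_series f \<and> variant T S f \<and> (\<forall>n. circ_coeff f (replicate n 5) = d n)"
proof (rule variant_exists[OF fq_rep_gl_gr(2) filt_gl_gr(2) assms(1,2) _ inftes_rho rt_rho(2) _ lead_gl_gr(2)])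
  fix u v :: qalg assume uv: "filt 1 (u - 1)" "filt 1 (v - 1)"
  show "\<exists>a b. a * b = 1 \<and> b * a = 1 \<and> gr (rB u v) = a * gr rA * b \<and>
      (\<forall>x. a * x * b * (Y (rB u v) * S) = T u v (x * (Y rA * S)))"
    unfolding assms(3)[OF uv]
    using assms(4)[OF uv(2)] qinv_left[OF uv(2)] qinv_right[OF uv(2)] gr_variant[OF uv] by blast
qed auto

lemma conj_absorb:
  fixes u :: qalg
  assumes "u' * u = 1"
  shows "u * x * u' * (u * y) = u * (x * y)"
proof -
  have "u * x * u' * (u * y) = u * x * (u' * u) * y" by (simp only: mult.assoc)
  then show ?thesis by (simp add: assms mult.assoc)
qed

lemma T_absorb:
  "filt 1 (u - 1) \<Longrightarrow> u * x * qinv u * Tbi u v y = Tbi u v (x * y)"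
  "filt 1 (u - 1) \<Longrightarrow> u * x * qinv u * Tleft u v y = Tleft u v (x * y)"
  "filt 1 (v - 1) \<Longrightarrow> qinv v * x * v * Tanti u v y = Tanti u v (x * y)"
  "filt 1 (v - 1) \<Longrightarrow> qinv v * x * v * Tright u v y = Tright u v (x * y)"
  unfolding Tbi_def Tleft_def Tanti_def Tright_def
  by (simp_all only: conj_absorb[OF qinv_left] conj_absorb[OF qinv_right] mult.assoc[of x y])

lemma bivariant_exists:
  "\<exists>f. valid_series f \<and> variant Tbi q1 f \<and> (\<forall>n. circ_coeff f (replicate n 4) = d n)"
  "\<exists>f. valid_series f \<and> variant Tbi q2 f \<and> (\<forall>n. circ_coeff f (replicate n 4) = d n)"
  by (rule variant_exists_left[OF fq_rep_fa_fb(1)[of 1 1] filt_fa_fb(1) _ T_absorb(1)];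
      simp only: fa_fb_variant Tbi_def mult.assoc)
    (rule variant_exists_left[OF fq_rep_fa_fb(2)[of 1 1] filt_fa_fb(2) _ T_absorb(1)];
      simp only: fa_fb_variant Tbi_def mult.assoc)

text \<open>Y is the series of -A_i^{-1}; with this sign its constant term is 1, as the prescription
  of coefficients requires.\<close>

lemma antivariant_exists:
  "\<exists>f. valid_series f \<and> variant Tanti q1 f \<and> (\<forall>n. circ_coeff f (replicate n 5) = d n)"
  "\<exists>f. valid_series f \<and> variant Tanti q2 f \<and> (\<forall>n. circ_coeff f (replicate n 5) = d n)"
  by (rule variant_exists_right[OF fq_rep_qinv[OF fq_rep_fa_fb(1)[of "-1" 1] filt_fa_fb(1)]
        qinv_first[OF filt_fa_fb(1)] _ T_absorb(3)];
      simp only: qinv_fa_fb_variant Tanti_def mult.assoc)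
    (rule variant_exists_right[OF fq_rep_qinv[OF fq_rep_fa_fb(2)[of 1 "-1"] filt_fa_fb(2)]
        qinv_first[OF filt_fa_fb(2)] _ T_absorb(3)];
      simp only: qinv_fa_fb_variant Tanti_def mult.assoc)

lemma left_variant_exists:
  "\<exists>f. valid_series f \<and> variant Tleft 1 f \<and> (\<forall>n. circ_coeff f (replicate n 4) = d n)"
  "\<exists>f. valid_series f \<and> variant Tleft (q1 * q2) f \<and> (\<forall>n. circ_coeff f (replicate n 4) = d n)"
  by (rule variant_exists_left[OF fq_rep_one _ _ T_absorb(2)]; simp add: Tleft_def qinv_right)
    (rule variant_exists_left[OF fq_rep_wl_wr(1)[of 1 1] filt_wl_wr(1) _ T_absorb(2)];
      simp only: wl_variant Tleft_def mult.assoc)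

lemma right_variant_exists:
  "\<exists>f. valid_series f \<and> variant Tright 1 f \<and> (\<forall>n. circ_coeff f (replicate n 5) = d n)"
  "\<exists>f. valid_series f \<and> variant Tright (q1 * q2) f \<and> (\<forall>n. circ_coeff f (replicate n 5) = d n)"
  by (rule variant_exists_right[OF fq_rep_one _ _ T_absorb(4)]; simp add: Tright_def qinv_left)
    (rule variant_exists_right[OF fq_rep_wl_wr(2)[of 1 "-1"] filt_wl_wr(2) _ T_absorb(4)];
      simp only: wr_variant Tright_def mult.assoc)

section \<open>Independence of the split variables\<close>

text \<open>Strips a leading X_j from monomials with Clifford head 1 and kills all others: a
  one-sided inverse of left multiplication by X_j.\<close>

definition qL :: "nat \<Rightarrow> qalg \<Rightarrow> qalg" where
  "qL j z = qalg_of (\<lambda>m. coef z ((False, False), (j, fst m) # snd m))"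

lemma coef_qL: "coef (qL j z) m = coef z ((False, False), (j, fst m) # snd m)"
  by (simp add: qL_def qalg_of_inverse)

lemma qL_add: "qL j (x + y) = qL j x + qL j y"
  and qL_diff: "qL j (x - y) = qL j x - qL j y"
  and qL_minus: "qL j (- x) = - qL j x"
  and qL_scaleR: "qL j (c *\<^sub>R x) = c *\<^sub>R qL j x"
  by (rule coef_inject_ext, simp add: coef_qL)+

lemma filt_qL: "filt (Suc N) z \<Longrightarrow> filt N (qL j z)"
  by (rule filtI) (simp add: coef_qL filtD)

lemma coef_letter_mult:
  assumes "coef x = abasis (h, [(l, (False, False))])"
  shows "coef (x * z) (h', (j, b) # ys) = (if h = h' \<and> l = j then coef z (b, ys) else 0)"
proof -
  have mm: "mm (h, [(l, (False, False))]) p = (h, (l, fst p) # snd p)" for p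
    using mm_snoc[of h "[]" l "(False, False)" "fst p" "snd p"] by (simp add: qprod_def)
  have ms: "ms (h, [(l, (False, False))]) p = 1" for p
    using ms_snoc[of h "[]" l "(False, False)" "fst p" "snd p"] by (simp add: qsign_def)
  show ?thesis
  proof (cases "h = h' \<and> l = j")
    case True
    then have "mm (h, [(l, (False, False))]) p = (h', (j, b) # ys) \<longleftrightarrow> p = (b, ys)" for p
      unfolding mm by (cases p) simp
    from amul_abasis_left[OF this] show ?thesis
      unfolding times_qalg.rep_eq assms ms using True by simp
  next
    case False
    then show ?thesis
      unfolding times_qalg.rep_eq assms by (subst amul_abasis_left_zero) (auto simp: mm)
  qed
qed

lemma coef_q_qX:
  "coef (q1 * qX l) = abasis ((True, False), [(l, (False, False))])"
  "coef (q2 * qX l) = abasis ((False, True), [(l, (False, False))])"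
  "coef (q1 * (q2 * qX l)) = abasis ((True, True), [(l, (False, False))])"
  by (simp_all add: times_qalg.rep_eq coef_q coef_qX aQ1_def aQ2_def agen_def amul_abasis mm_Nil ms_Nil
      qprod_def qsign_def ascale_def)

lemma qL_qX:
  "qL j (qX l * z) = (if l = j then z else 0)"
  "qL j (q1 * (qX l * z)) = 0" "qL j (q2 * (qX l * z)) = 0" "qL j (q1 * (q2 * (qX l * z))) = 0"
proof -
  show "qL j (qX l * z) = (if l = j then z else 0)"
    by (rule coef_inject_ext) (simp add: coef_qL coef_letter_mult[OF coef_qX[unfolded agen_def]])
  have "qL j (q1 * qX l * z) = 0" "qL j (q2 * qX l * z) = 0" "qL j (q1 * (q2 * qX l) * z) = 0"
    by (rule coef_inject_ext, simp add: coef_qL coef_q_qX[THEN coef_letter_mult])+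
  then show "qL j (q1 * (qX l * z)) = 0" "qL j (q2 * (qX l * z)) = 0" "qL j (q1 * (q2 * (qX l * z))) = 0"
    by (simp_all only: mult.assoc)
qed

text \<open>Of the four terms of the projection, only the one without a Clifford factor in front
  survives \<open>qL\<close>. The value is therefore the same for all types (a, b), and a single use
  of \<open>qL\<close> detects just the sum over a block of four.\<close>

lemma qL_comp:
  "qL j (qcomp a b (- (qX l * q)) * z) = (if l = j then - (1/4) *\<^sub>R (q * z) else 0)"
  by (simp add: qcomp_def Let_def algebra_simps qL_add qL_diff qL_minus qL_scaleR qL_qX)

definition comb :: "(nat \<Rightarrow> qalg) \<Rightarrow> qalg" where
  "comb z = (\<Sum>k\<in>{1..8}. rA k * z k)"

lemma rA_numeral:
  "rA 1 = qcomp 0 0 (- (qX 1 * q1))" "rA 2 = qcomp 0 1 (- (qX 1 * q1))"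
  "rA 3 = qcomp 1 0 (- (qX 1 * q1))" "rA 4 = qcomp 1 1 (- (qX 1 * q1))"
  "rA 5 = qcomp 0 0 (- (qX 2 * q2))" "rA 6 = qcomp 0 1 (- (qX 2 * q2))"
  "rA 7 = qcomp 1 0 (- (qX 2 * q2))" "rA 8 = qcomp 1 1 (- (qX 2 * q2))"
  unfolding rA_def by (rule sv_numeral)+

lemma filt_q_cancel: "filt N (q1 * x) \<Longrightarrow> filt N x" "filt N (q2 * x) \<Longrightarrow> filt N x"
  using filt_mult_left[of N "q1 * x" "- q1"] filt_mult_left[of N "q2 * x" "- q2"] by simp_all

lemma filt_comb_sum:
  assumes "filt (Suc N) (comb z)"
  shows "filt N (z 1 + z 2 + z 3 + z 4)" "filt N (z 5 + z 6 + z 7 + z 8)"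
proof -
  have q: "-4 *\<^sub>R (- (1/4) *\<^sub>R x) = x" for x :: qalg by simp
  have 1: "qL 1 (comb z) = - (1/4) *\<^sub>R (q1 * (z 1 + z 2 + z 3 + z 4))"
    unfolding comb_def sum_1_8 rA_numeral qL_add qL_comp distrib_left scaleR_add_right by simp
  have 2: "qL 2 (comb z) = - (1/4) *\<^sub>R (q2 * (z 5 + z 6 + z 7 + z 8))"
    unfolding comb_def sum_1_8 rA_numeral qL_add qL_comp distrib_left scaleR_add_right by simp
  have "filt N (-4 *\<^sub>R qL 1 (comb z))" "filt N (-4 *\<^sub>R qL 2 (comb z))"
    by (intro filt_scaleR filt_qL assms)+
  then show "filt N (z 1 + z 2 + z 3 + z 4)" "filt N (z 5 + z 6 + z 7 + z 8)"
    unfolding 1 2 q using filt_q_cancel by blast+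
qed

definition sg1 :: "nat \<Rightarrow> real" where "sg1 k = (if k \<in> {1, 2, 5, 6} then 1 else -1)"
definition sg2 :: "nat \<Rightarrow> real" where "sg2 k = (if k \<in> {1, 3, 5, 7} then 1 else -1)"

text \<open>Premultiplication by q1 or q2 changes the signs inside the block sums that
  \<open>qL\<close> detects, because each generic variable passes them up to the sign given by its
  type.\<close>

lemma comb_twist:
  "q1 * comb z = comb (\<lambda>k. sg1 k *\<^sub>R (q1 * z k))" "q2 * comb z = comb (\<lambda>k. sg2 k *\<^sub>R (q2 * z k))"
proof -
  note ty = typed_numeral[OF typed_rA]
  have "\<forall>k\<in>{1..8}. q1 * rA k = sg1 k *\<^sub>R (rA k * q1)"
    unfolding ball_1_8 ty[THEN has_type_q(1)] by (simp add: sg1_def)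
  then have "q1 * (rA k * z k) = rA k * (sg1 k *\<^sub>R (q1 * z k))" if "k \<in> {1..8}" for k
    using that by (simp flip: mult.assoc)
  then show "q1 * comb z = comb (\<lambda>k. sg1 k *\<^sub>R (q1 * z k))"
    unfolding comb_def sum_distrib_left by (intro sum.cong) auto
  have "\<forall>k\<in>{1..8}. q2 * rA k = sg2 k *\<^sub>R (rA k * q2)"
    unfolding ball_1_8 ty[THEN has_type_q(2)] by (simp add: sg2_def)
  then have "q2 * (rA k * z k) = rA k * (sg2 k *\<^sub>R (q2 * z k))" if "k \<in> {1..8}" for k
    using that by (simp flip: mult.assoc)
  then show "q2 * comb z = comb (\<lambda>k. sg2 k *\<^sub>R (q2 * z k))"
    unfolding comb_def sum_distrib_left by (intro sum.cong) auto
qed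

lemma filt_four:
  fixes a b c d :: qalg
  assumes "filt N (a + b + c + d)" "filt N (a + b - c - d)" "filt N (a - b + c - d)" "filt N (a - b - c + d)"
  shows "filt N a" "filt N b" "filt N c" "filt N d"
proof -
  let ?s = "a + b + c + d" and ?t = "a + b - c - d" and ?u = "a - b + c - d" and ?v = "a - b - c + d"
  have q: "x = (1/4) *\<^sub>R (x + x + x + x)" for x :: qalg
    using scaleR_add_left[of "1/4" "1/4" x] scaleR_add_left[of "1/2" "1/4" x] scaleR_add_left[of "3/4" "1/4" x]
    by (simp add: scaleR_add_right)
  have a: "a = (1/4) *\<^sub>R (?s + ?t + ?u + ?v)" by (subst q) (simp add: algebra_simps)
  have "filt N ((1/4) *\<^sub>R (?s + ?t + ?u + ?v))"
    by (intro filt_scaleR filt_add filt_diff assms)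
  then show "filt N a" by (simp only: a[symmetric])
  have b: "b = (1/4) *\<^sub>R (?s + ?t - ?u - ?v)" by (subst q) (simp add: algebra_simps)
  have "filt N ((1/4) *\<^sub>R (?s + ?t - ?u - ?v))"
    by (intro filt_scaleR filt_add filt_diff assms)
  then show "filt N b" by (simp only: b[symmetric])
  have c: "c = (1/4) *\<^sub>R (?s - ?t + ?u - ?v)" by (subst q) (simp add: algebra_simps)
  have "filt N ((1/4) *\<^sub>R (?s - ?t + ?u - ?v))"
    by (intro filt_scaleR filt_add filt_diff assms)
  then show "filt N c" by (simp only: c[symmetric])
  have d: "d = (1/4) *\<^sub>R (?s - ?t - ?u + ?v)" by (subst q) (simp add: algebra_simps)
  have "filt N ((1/4) *\<^sub>R (?s - ?t - ?u + ?v))"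
    by (intro filt_scaleR filt_add filt_diff assms)
  then show "filt N d" by (simp only: d[symmetric])
qed

text \<open>Premultiplying by 1, q1, q2 and q1 q2 produces the sums of each block against all four
  characters of (Z/2)^2, and inverting these (\<open>filt_four\<close>) isolates each z k. Thus the
  generic split variables are independent over right coefficients, at the cost of one
  degree.\<close>

lemma filt_comb:
  assumes z: "filt (Suc N) (comb z)" and k: "k \<in> {1..8}"
  shows "filt N (z k)"
proof -
  have z1: "filt (Suc N) (comb (\<lambda>k. sg1 k *\<^sub>R (q1 * z k)))"
    using filt_mult_left[OF z, of q1] by (simp add: comb_twist)
  have z2: "filt (Suc N) (comb (\<lambda>k. sg2 k *\<^sub>R (q2 * z k)))"
    using filt_mult_left[OF z, of q2] by (simp add: comb_twist)
  have z3: "filt (Suc N) (comb (\<lambda>k. sg1 k *\<^sub>R (q1 * (sg2 k *\<^sub>R (q2 * z k)))))"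
    using filt_mult_left[OF z2, of q1] by (simp add: comb_twist)
  have 1: "filt N (q1 * (z 1 + z 2 - z 3 - z 4))" "filt N (q1 * (z 5 + z 6 - z 7 - z 8))"
    using filt_comb_sum[OF z1] by (simp_all add: sg1_def algebra_simps)
  have 2: "filt N (q2 * (z 1 - z 2 + z 3 - z 4))" "filt N (q2 * (z 5 - z 6 + z 7 - z 8))"
    using filt_comb_sum[OF z2] by (simp_all add: sg2_def algebra_simps)
  have 3: "filt N (q1 * (q2 * (z 1 - z 2 - z 3 + z 4)))" "filt N (q1 * (q2 * (z 5 - z 6 - z 7 + z 8)))"
    using filt_comb_sum[OF z3] by (simp_all add: sg1_def sg2_def algebra_simps)
  have "\<forall>k\<in>{1..8}. filt N (z k)"
    unfolding ball_1_8
    using filt_four[OF filt_comb_sum(1)[OF z] filt_q_cancel(1)[OF 1(1)] filt_q_cancel(2)[OF 2(1)]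
        filt_q_cancel(2)[OF filt_q_cancel(1)[OF 3(1)]]]
      filt_four[OF filt_comb_sum(2)[OF z] filt_q_cancel(1)[OF 1(2)] filt_q_cancel(2)[OF 2(2)]
        filt_q_cancel(2)[OF filt_q_cancel(1)[OF 3(2)]]]
    by blast
  then show ?thesis using k by blast
qed

text \<open>Peeling off first letters reduces the absence of relations between the generic split
  variables to their independence over right coefficients, one degree per letter.\<close>

lemma ev_rA_independent:
  assumes "filt N (ev f rA)" "length w < N" "set w \<subseteq> {1..8}"
  shows "f w = 0"
  using assms
proof (induction w arbitrary: N f)
  case Nil
  have rest: "filt 1 (\<Sum>k\<in>{1..8}. rA k * ev (\<lambda>w. f (k # w)) rA)"
    using inftes_rA unfolding inftes_def by (intro filt_sum filt_mult_right) blast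
  have "filt 1 (ev f rA)"
    by (rule filt_mono[OF Nil(1)]) (use Nil in simp)
  from filt_diff[OF this rest] have "filt 1 (f [] *\<^sub>R (1::qalg))"
    by (simp add: ev_rec[OF inftes_rA, of f] del: One_nat_def)
  from filtD[OF this, of mone] show ?case by (simp add: coef_one)
next
  case (Cons k w)
  obtain M where N: "N = Suc M" using Cons.prems(2) by (cases N) auto
  have rest: "filt 1 (\<Sum>k\<in>{1..8}. rA k * ev (\<lambda>w. f (k # w)) rA)"
    using inftes_rA unfolding inftes_def by (intro filt_sum filt_mult_right) blast
  have "filt 1 (ev f rA)"
    by (rule filt_mono[OF Cons.prems(1)]) (use N in simp)
  from filt_diff[OF this rest] have "filt 1 (f [] *\<^sub>R (1::qalg))"
    by (simp add: ev_rec[OF inftes_rA, of f] del: One_nat_def)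
  from filtD[OF this, of mone] have "f [] = 0" by (simp add: coef_one)
  then have "filt (Suc M) (comb (\<lambda>k. ev (\<lambda>w. f (k # w)) rA))"
    using Cons.prems(1) unfolding N comb_def by (simp add: ev_rec[OF inftes_rA, of f])
  from filt_comb[OF this, of k] have "filt M (ev (\<lambda>w. f (k # w)) rA)"
    using Cons.prems(3) by simp
  from Cons.IH[OF this] show ?case using Cons.prems N by simp
qed

lemma lin_subst_zero:
  assumes "\<And>u. set u \<subseteq> {1..8} \<Longrightarrow> length u = length w \<Longrightarrow> g u = 0"
  shows "lin_subst L g w = 0"
  unfolding lin_subst_def using assms by (intro sum.neutral) auto

lemma ev_rt_independent:
  assumes "filt N (ev g (rt rA))" "length w < N" "set w \<subseteq> {1..8}"
  shows "g w = 0"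
proof -
  \<comment> \<open>Evaluation ignores words outside the alphabet; cutting g down to a valid series
    makes it a series of circular coefficients.\<close>
  define g' where "g' = (\<lambda>w. if set w \<subseteq> {1..8} then g w else 0)"
  define f where "f = lin_subst hat_form (lin_subst tilde_form g')"
  have g': "valid_series g'" by (simp add: g'_def valid_series_def)
  have f: "valid_series f" unfolding f_def by (rule valid_forms)
  have circ: "circ_coeff f = g'"
    unfolding circ_coeff_eq[OF f] by (simp add: f_def lin_subst_inverse valid_forms g')
  have "ev f rA = ev g (rt rA)"
    unfolding ev_rt[OF inftes_rA f] circ by (rule ev_cong_series) (simp add: g'_def)
  then have f0: "f u = 0" if "length u = length w" "set u \<subseteq> {1..8}" for u
    using ev_rA_independent[of N f u] assms that by simp
  have "lin_subst untilde (lin_subst unhat f) w = 0"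
    by (rule lin_subst_zero, rule lin_subst_zero) (use f0 in auto)
  then have "g' w = 0"
    unfolding circ_coeff_eq[OF f, symmetric] circ .
  then show ?thesis using assms(3) by (simp add: g'_def)
qed

section \<open>Moving the generic pair along its orbit\<close>

text \<open>A series starting in degree n depends, modulo degree n + 1, only on the linear parts of
  its arguments.\<close>

lemma ev_filt_diff:
  assumes "inftes r" "inftes r'" "\<And>k. k \<in> {1..8} \<Longrightarrow> filt 2 (r k - r' k)"
    and "\<And>w. set w \<subseteq> {1..8} \<Longrightarrow> length w < n \<Longrightarrow> g w = 0"
  shows "filt (Suc n) (ev g r - ev g r')"
  using assms(4)
proof (induction n arbitrary: g)
  case 0
  have "filt 1 (r k * ev (\<lambda>w. g (k # w)) r - r' k * ev (\<lambda>w. g (k # w)) r')" if "k \<in> {1..8}" for k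
    using assms(1,2) that unfolding inftes_def by (intro filt_diff filt_mult_right) blast+
  then have "filt 1 (\<Sum>k\<in>{1..8}. r k * ev (\<lambda>w. g (k # w)) r - r' k * ev (\<lambda>w. g (k # w)) r')"
    by (rule filt_sum)
  then show ?case
    unfolding ev_rec[OF assms(1), of g] ev_rec[OF assms(2), of g] by (simp add: sum_subtractf)
next
  case (Suc n)
  let ?g = "\<lambda>k w. g (k # w)"
  have k: "filt (Suc (Suc n)) ((r k - r' k) * ev (?g k) r + r' k * (ev (?g k) r - ev (?g k) r'))"
    if "k \<in> {1..8}" for k
  proof (rule filt_add)
    have g: "?g k w = 0" if "set w \<subseteq> {1..8}" "length w < n" for w
      using Suc.prems[of "k # w"] that \<open>k \<in> {1..8}\<close> by simp
    have "filt (2 + n) ((r k - r' k) * ev (?g k) r)"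
      by (intro filt_mult assms(3) that filt_ev assms(1) g)
    then show "filt (Suc (Suc n)) ((r k - r' k) * ev (?g k) r)" by simp
    have "filt 1 (r' k)" using assms(2) that by (simp add: inftes_def)
    then have "filt (1 + Suc n) (r' k * (ev (?g k) r - ev (?g k) r'))"
      by (intro filt_mult Suc.IH g)
    then show "filt (Suc (Suc n)) (r' k * (ev (?g k) r - ev (?g k) r'))" by simp
  qed
  have "ev g r - ev g r' = (\<Sum>k\<in>{1..8}. (r k - r' k) * ev (?g k) r + r' k * (ev (?g k) r - ev (?g k) r'))"
    unfolding ev_rec[OF assms(1), of g] ev_rec[OF assms(2), of g]
    by (simp add: left_diff_distrib right_diff_distrib flip: sum_subtractf)
  then show ?case using filt_sum[OF k] by (simp only:)
qed

lemma ev_kill_letters: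
  "ev g (\<lambda>l. if l \<in> K then r l else 0) = ev (\<lambda>w. if set w \<subseteq> K then g w else 0) r"
proof (rule coef_inject_ext)
  fix m
  have "wprod (\<lambda>l. if l \<in> K then r l else 0) w = (if set w \<subseteq> K then wprod r w else 0)" for w
    by (induction w) auto
  then show "coef (ev g (\<lambda>l. if l \<in> K then r l else 0)) m
      = coef (ev (\<lambda>w. if set w \<subseteq> K then g w else 0) r) m"
    unfolding coef_ev by (intro sum.cong) auto
qed

lemma filt_rt: "(\<And>k. k \<in> {1..8} \<Longrightarrow> filt N (r k - r' k)) \<Longrightarrow> filt N (rt r l - rt r' l)"
proof -
  assume *: "\<And>k. k \<in> {1..8} \<Longrightarrow> filt N (r k - r' k)"
  have "rt r l - rt r' l = (\<Sum>i\<in>{1..8}. tilde_form l i *\<^sub>R (\<Sum>k\<in>{1..8}. hat_form i k *\<^sub>R (r k - r' k)))"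
    unfolding rt_def by (simp only: scaleR_diff_right sum_subtractf)
  also have "filt N \<dots>" by (intro filt_sum filt_scaleR *)
  finally show ?thesis .
qed

lemma filt_sv:
  assumes "filt N (R1 - R1')" "filt N (R2 - R2')"
  shows "filt N (sv R1 R2 k - sv R1' R2' k)"
proof -
  have "sv R1 R2 k - sv R1' R2' k = sv (R1 - R1') (R2 - R2') k"
    unfolding sv_def qcomp_diff[symmetric] by (simp add: algebra_simps)
  also have "filt N \<dots>"
    unfolding sv_def using assms by (auto intro!: filt_comp filt_minus filt_mult_right)
  finally show ?thesis .
qed

lemma sv_of_typed:
  assumes "typed y" "k \<in> {1..8}"
  shows "sv ((y 1 + y 2 + y 3 + y 4) * q1) ((y 5 + y 6 + y 7 + y 8) * q2) k = y k"
proof -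
  have "- (x * q1 * q1) = x" "- (x * q2 * q2) = x" for x by (simp_all add: mult.assoc)
  then have "\<forall>k\<in>{1..8}. sv ((y 1 + y 2 + y 3 + y 4) * q1) ((y 5 + y 6 + y 7 + y 8) * q2) k = y k"
    unfolding ball_1_8 sv_numeral
    by (simp only: qcomp_add) (simp add: typed_numeral[OF assms(1), simplified, THEN qcomp_type])
  then show ?thesis using assms(2) by blast
qed

lemma has_type_diff: "has_type i j x \<Longrightarrow> has_type i j y \<Longrightarrow> has_type i j (x - y)"
  and has_type_add: "has_type i j x \<Longrightarrow> has_type i j y \<Longrightarrow> has_type i j (x + y)"
  and has_type_scaleR: "has_type i j x \<Longrightarrow> has_type i j (c *\<^sub>R x)"
  and has_type_zero: "has_type i j 0"
  by (auto simp: has_type_def algebra_simps)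

lemma rA_sum:
  "qX 1 = (rA 1 + rA 2 + rA 3 + rA 4) * q1" "qX 2 = (rA 5 + rA 6 + rA 7 + rA 8) * q2"
  unfolding rA_def sv_sum by simp_all

text \<open>The orbit of the generic pair meets, to first order, the slice on which only
  the circular variables 4 and 5 survive.\<close>

lemma orbit_first_order_slice:
  obtains u v where "filt 1 (u - 1)" "filt 1 (v - 1)"
    "\<And>l. l \<in> {1..8} \<Longrightarrow> filt 2 (rt (rB u v) l - (if l \<in> {4, 5} then rt rA l else 0))"
proof -
  let ?a = "rA 1 + rA 2 + rA 3 + rA 4" and ?b = "rA 5 + rA 6 + rA 7 + rA 8"
  \<comment> \<open>The pair (e, d) solves the linearized equations componentwise. The left factor e
    cancels the sum r_k + r_{k+4} in every type. The right factor d enters the two blocks with signs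
    from passing q1 and q2; these are opposite in types (0,1) and (1,0), where d cancels the
    difference too. They agree in types (0,0) and (1,1), whose differences remain as y.\<close>
  define e where "e = (-1/2) *\<^sub>R (?a + ?b)"
  define d where "d = (1/2) *\<^sub>R (rA 6 - rA 2 + rA 3 - rA 7)"
  define y where "y k = (if k = 1 then (1/2) *\<^sub>R (rA 1 - rA 5) else if k = 5 then (1/2) *\<^sub>R (rA 5 - rA 1)
    else if k = 4 then (1/2) *\<^sub>R (rA 4 - rA 8) else if k = 8 then (1/2) *\<^sub>R (rA 8 - rA 4) else 0)" for k :: nat
  note ty = typed_numeral[OF typed_rA]
  note qs = ty[THEN has_type_q(1)] ty[THEN has_type_q(2)]
  have in1: "\<forall>k\<in>{1..8}. filt 1 (rA k)" using inftes_rA by (simp add: inftes_def)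
  have e: "filt 1 e" and d: "filt 1 d"
    using in1 unfolding ball_1_8 e_def d_def by (auto intro!: filt_minus filt_scaleR filt_add filt_diff)
  have "typed y"
    unfolding typed_def ball_1_8 y_def
    by (simp add: has_type_scaleR has_type_diff has_type_zero ty[simplified])
  note sv_y = sv_of_typed[OF this]
  have half: "x = (1/2) *\<^sub>R x + (1/2) *\<^sub>R x" for x :: qalg
    by (simp flip: scaleR_add_left)
  have l1: "e * q1 + q1 * d + qX 1 = (y 1 + y 2 + y 3 + y 4) * q1"
  proof -
    have D: "q1 * d = ((1/2) *\<^sub>R (rA 6 - rA 2 - rA 3 + rA 7)) * q1"
      unfolding d_def mult_scaleR_right mult_scaleR_left right_diff_distrib distrib_left left_diff_distrib
        distrib_right qs by simp
    have E: "e + (1/2) *\<^sub>R (rA 6 - rA 2 - rA 3 + rA 7) + ((1/2) *\<^sub>R ?a + (1/2) *\<^sub>R ?a) = y 1 + y 2 + y 3 + y 4"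
      by (simp add: e_def y_def scaleR_add_right scaleR_diff_right)
    show ?thesis
      unfolding rA_sum(1) D E[unfolded half[of ?a, symmetric], symmetric] by (simp only: distrib_right)
  qed
  have l2: "e * q2 + q2 * d + qX 2 = (y 5 + y 6 + y 7 + y 8) * q2"
  proof -
    have D: "q2 * d = ((1/2) *\<^sub>R (rA 2 - rA 6 + rA 3 - rA 7)) * q2"
      unfolding d_def mult_scaleR_right mult_scaleR_left right_diff_distrib distrib_left left_diff_distrib
        distrib_right qs by simp
    have E: "e + (1/2) *\<^sub>R (rA 2 - rA 6 + rA 3 - rA 7) + ((1/2) *\<^sub>R ?b + (1/2) *\<^sub>R ?b) = y 5 + y 6 + y 7 + y 8"
      by (simp add: e_def y_def scaleR_add_right scaleR_diff_right)
    show ?thesis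
      unfolding rA_sum(2) D E[unfolded half[of ?b, symmetric], symmetric] by (simp only: distrib_right)
  qed
  \<comment> \<open>The part linear in e, d and X is e q + q d + X; all other terms contain two
    infinitesimals.\<close>
  have first_order: "filt 2 (((1 + e) * (q + X) * (1 + d) - q) - (e * q + q * d + X))"
    if "filt 1 X" for q X
  proof -
    have "filt (1 + 1) (e * (X * (1 + d)))" "filt (1 + 1) (e * (q * d))" "filt (1 + 1) (X * d)"
      by (intro filt_mult filt_mult_right filt_mult_left e d that)+
    then have "filt 2 (e * (X * (1 + d)) + e * (q * d) + X * d)"
      by (simp add: filt_add numeral_2_eq_2)
    moreover have "((1 + e) * (q + X) * (1 + d) - q) - (e * q + q * d + X) = e * (X * (1 + d)) + e * (q * d) + X * d"
      by (simp add: algebra_simps)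
    ultimately show ?thesis by simp
  qed
  have "filt 2 (rB (1 + e) (1 + d) k - y k)" if "k \<in> {1..8}" for k
    using filt_sv[OF first_order[OF filt_qX, of q1 1] first_order[OF filt_qX, of q2 2], of k]
    unfolding l1 l2 sv_y[OF that] rB_def .
  then have 1: "filt 2 (rt (rB (1 + e) (1 + d)) l - rt y l)" for l
    by (rule filt_rt)
  have "\<forall>l\<in>{1..8}. rt y l = (if l \<in> {4, 5} then rt rA l else 0)"
  proof -
    have z: "y 1 + y 5 = 0" "y 4 + y 8 = 0" "y 2 = 0" "y 3 = 0" "y 6 = 0" "y 7 = 0"
      by (simp_all add: y_def scaleR_diff_right)
    have d: "y 1 - y 5 = rA 1 - rA 5" "y 4 - y 8 = rA 4 - rA 8"
      using half[of "rA 1"] half[of "rA 5"] half[of "rA 4"] half[of "rA 8"]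
      by (simp_all add: y_def scaleR_diff_right algebra_simps)
    have "y 1 - y 5 + y 4 - y 8 = (y 1 - y 5) + (y 4 - y 8)"
      "y 1 - y 5 - y 4 + y 8 = (y 1 - y 5) - (y 4 - y 8)" by simp_all
    then have "y 1 - y 5 + y 4 - y 8 = rA 1 - rA 5 + rA 4 - rA 8"
      "y 1 - y 5 - y 4 + y 8 = rA 1 - rA 5 - rA 4 + rA 8"
      unfolding d by simp_all
    then show ?thesis
      unfolding ball_1_8 rt_simps by (simp only: z) simp
  qed
  with 1 have "filt 2 (rt (rB (1 + e) (1 + d)) l - (if l \<in> {4, 5} then rt rA l else 0))"
    if "l \<in> {1..8}" for l using that by metis
  then show thesis using that[of "1 + e" "1 + d"] e d by simp
qed

text \<open>Being half of r_4 + r_8 it has type (1,1), so it anticommutes with q1 and q2 and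
  commutes with q1 q2. Being itself a circular variable, its products with the others can be
  compared letter by letter.\<close>

definition e6 :: qalg where "e6 = rt rA 6"

lemma has_type_e6: "has_type 1 1 e6"
  unfolding e6_def rt_simps by (intro has_type_scaleR has_type_add typed_numeral typed_rA)

lemma filt_e6: "filt 1 e6"
  using inftes_rt[OF inftes_rA] by (simp add: inftes_def e6_def)

lemma e6_q: "q1 * e6 = - (e6 * q1)" "q2 * e6 = - (e6 * q2)" "q1 * q2 * e6 = e6 * (q1 * q2)"
proof -
  show 1: "q1 * e6 = - (e6 * q1)" and 2: "q2 * e6 = - (e6 * q2)"
    using has_type_e6 by (simp_all add: has_type_def)
  have "q1 * q2 * e6 = q1 * (q2 * e6)" by (rule mult.assoc)
  also have "\<dots> = - (q1 * e6 * q2)" by (simp add: 2 mult.assoc)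
  also have "\<dots> = e6 * (q1 * q2)" by (simp add: 1 mult.assoc)
  finally show "q1 * q2 * e6 = e6 * (q1 * q2)" .
qed

definition rC :: "nat \<Rightarrow> qalg" where "rC = rB (1 + e6) (1 + e6)"

lemma inftes_rC: "inftes rC"
  unfolding rC_def by (rule inftes_rB) (use filt_e6 in simp_all)

text \<open>Passing q turns the right multiplier 1 + e6 into 1 - e6, so A_i Q_i^{-1} becomes (1 +
  e6) A_i Q_i^{-1} (1 - e6) for both i.\<close>

lemma rC_numeral:
  fixes a b
  defines "a \<equiv> (1 + e6) * (1 + (rA 1 + rA 2 + rA 3 + rA 4)) * (1 - e6) - 1"
    and "b \<equiv> (1 + e6) * (1 + (rA 5 + rA 6 + rA 7 + rA 8)) * (1 - e6) - 1"
  shows "rC = sv (a * q1) (b * q2)"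
proof -
  have "(1 + e6) * (q + x * q) * (1 + e6) - q = ((1 + e6) * (1 + x) * (1 - e6) - 1) * q"
    if "q * e6 = - (e6 * q)" for x q
  proof -
    have "q + x * q = (1 + x) * q" by (simp add: distrib_right)
    moreover have "q * (1 + e6) = (1 - e6) * q" using that by (simp add: algebra_simps)
    ultimately have "(1 + e6) * (q + x * q) * (1 + e6) = (1 + e6) * (1 + x) * (1 - e6) * q"
      by (simp add: mult.assoc)
    then show ?thesis by (simp add: left_diff_distrib)
  qed
  from this[OF e6_q(1)] this[OF e6_q(2)] show ?thesis
    unfolding rC_def rB_def rA_sum a_def b_def by simp
qed

lemma rC_first_order: "k \<in> {1..8} \<Longrightarrow> filt 2 (rC k - rA k)"
proof -
  assume k: "k \<in> {1..8}"
  have *: "filt 2 (((1 + e6) * (1 + x) * (1 - e6) - 1) * q - x * q)" if x: "filt 1 x" for x q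
  proof -
    have "filt (1 + 1) (e6 * (x * (1 - e6)))" "filt (1 + 1) (e6 * e6)" "filt (1 + 1) (x * e6)"
      by (intro filt_mult filt_mult_right filt_e6 x)+
    then have "filt 2 ((e6 * (x * (1 - e6)) - e6 * e6 - x * e6) * q)"
      by (intro filt_mult_right[of _ _ q] filt_diff) (simp_all add: numeral_2_eq_2)
    then show ?thesis by (simp add: algebra_simps)
  qed
  have in1: "\<forall>k\<in>{1..8}. filt 1 (rA k)" using inftes_rA by (simp add: inftes_def)
  have "filt 2 (rC k - sv ((rA 1 + rA 2 + rA 3 + rA 4) * q1) ((rA 5 + rA 6 + rA 7 + rA 8) * q2) k)"
    unfolding rC_numeral
    by (intro filt_sv *) (use in1 in \<open>auto simp: ball_1_8 intro!: filt_add\<close>)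
  then show ?thesis unfolding sv_of_typed[OF typed_rA k] .
qed

lemma qcomp_diag_sum: "qcomp 0 0 x + qcomp 1 1 x = (1/2) *\<^sub>R (x - q1 * q2 * x * (q1 * q2))"
proof -
  have "qcomp 0 0 x + qcomp 1 1 x = (1/4) *\<^sub>R ((x - q1 * q2 * x * (q1 * q2)) + (x - q1 * q2 * x * (q1 * q2)))"
    by (simp add: qcomp_def Let_def algebra_simps)
  then show ?thesis
    by (simp add: scaleR_add_right flip: scaleR_add_left)
qed

text \<open>The circular variable 4 is half of the part of A1 Q1^{-1} - A2 Q2^{-1} that commutes
  with Q1 Q2, namely its types (0,0) and (1,1). Multipliers commuting with Q1 Q2 pass through this
  projection, which makes the transformation under 1 + e6 exact.\<close>

lemma rt4_sv:
  "rt (sv (a * q1) (b * q2)) 4 = (1/4) *\<^sub>R ((a - b) - q1 * q2 * (a - b) * (q1 * q2))"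
proof -
  have "rt (sv (a * q1) (b * q2)) 4 = (1/2) *\<^sub>R ((qcomp 0 0 a + qcomp 1 1 a) - (qcomp 0 0 b + qcomp 1 1 b))"
    unfolding rt_simps sv_numeral by (simp add: mult.assoc)
  then show ?thesis
    unfolding qcomp_diag_sum by (simp add: scaleR_diff_right right_diff_distrib left_diff_distrib)
qed

text \<open>Conjugation by q1 changes the sign of the type (1,1) part and so exchanges the circular
  variables 4 and 5. As it also turns e6 into -e6, the two variables are moved in opposite
  senses.\<close>

lemma rt5_typed: "typed r \<Longrightarrow> rt r 5 = - (q1 * rt r 4 * q1)"
proof -
  assume r: "typed r"
  have "q1 * rt r 4 = (1/2) *\<^sub>R (r 1 - r 5 - r 4 + r 8) * q1"
    unfolding rt_simps mult_scaleR_right right_diff_distrib distrib_left left_diff_distrib distrib_right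
      typed_numeral[OF r, THEN has_type_q(1)] mult_scaleR_left by simp
  then have "q1 * rt r 4 * q1 = - ((1/2) *\<^sub>R (r 1 - r 5 - r 4 + r 8))"
    by (simp only: mult.assoc clifford mult_minus_right mult_1_right)
  then show ?thesis by (simp add: rt_simps(5))
qed

lemma rt_rC:
  "rt rC 4 = (1 + e6) * rt rA 4 * (1 - e6)" "rt rC 5 = (1 - e6) * rt rA 5 * (1 + e6)"
proof -
  let ?P = "q1 * q2" and ?a = "rA 1 + rA 2 + rA 3 + rA 4" and ?b = "rA 5 + rA 6 + rA 7 + rA 8"
  have "rA = sv (?a * q1) (?b * q2)"
    unfolding rA_sum[symmetric] by (simp add: rA_def)
  then have A: "rt rA 4 = (1/4) *\<^sub>R ((?a - ?b) - ?P * (?a - ?b) * ?P)"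
    using rt4_sv[of ?a ?b] by simp
  have P1: "?P * (1 + e6) = (1 + e6) * ?P" and P2: "(1 - e6) * ?P = ?P * (1 - e6)"
    using e6_q(3) by (simp_all add: distrib_left distrib_right left_diff_distrib right_diff_distrib)
  have "?P * ((1 + e6) * x * (1 - e6)) * ?P = (?P * (1 + e6)) * x * ((1 - e6) * ?P)" for x
    by (simp only: mult.assoc)
  also have "(?P * (1 + e6)) * x * ((1 - e6) * ?P) = (1 + e6) * (?P * x * ?P) * (1 - e6)" for x
    unfolding P1 P2 by (simp only: mult.assoc)
  finally have tw: "?P * ((1 + e6) * x * (1 - e6)) * ?P = (1 + e6) * (?P * x * ?P) * (1 - e6)" for x .
  have diff: "((1 + e6) * (1 + x) * (1 - e6) - 1) - ((1 + e6) * (1 + y) * (1 - e6) - 1)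
      = (1 + e6) * (x - y) * (1 - e6)" for x y
    by (simp add: algebra_simps)
  show C: "rt rC 4 = (1 + e6) * rt rA 4 * (1 - e6)"
    unfolding rC_numeral rt4_sv diff tw A
    by (simp add: left_diff_distrib[of _ _ "1 - e6"] right_diff_distrib[of "1 + e6"])
  have Q1: "q1 * (1 + e6) = (1 - e6) * q1"
    using e6_q(1) by (simp add: algebra_simps)
  have "typed rC" unfolding rC_def by (rule typed_rB)
  then have "rt rC 5 = - (q1 * (1 + e6) * rt rA 4 * ((1 - e6) * q1))"
    unfolding C[symmetric] by (simp add: rt5_typed C mult.assoc)
  also have "\<dots> = - (((1 - e6) * q1) * rt rA 4 * (q1 * (1 + e6)))"
    by (simp only: Q1)
  also have "\<dots> = (1 - e6) * (- (q1 * rt rA 4 * q1)) * (1 + e6)"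
    by (simp only: mult.assoc mult_minus_left mult_minus_right)
  finally show "rt rC 5 = (1 - e6) * rt rA 5 * (1 + e6)"
    unfolding rt5_typed[OF typed_rA] .
qed

section \<open>Uniqueness\<close>

definition lsg :: "nat \<Rightarrow> real" where "lsg x = (if x = 4 then 1 else if x = 5 then -1 else 0)"

text \<open>The value 0 at the empty word says that no letter stands there to form a commutator with
  6.\<close>

primrec hd_sg :: "nat list \<Rightarrow> real" where
  "hd_sg [] = 0" | "hd_sg (x # u) = lsg x"

text \<open>The coefficients of the variable y times g.\<close>

definition lcons :: "nat \<Rightarrow> series \<Rightarrow> series" where
  "lcons y g u = (case u of [] \<Rightarrow> 0 | x # v \<Rightarrow> if x = y then g v else 0)"

text \<open>The coefficients of the image of g under the derivation that sends the variable 4 to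
  its commutator [6, 4], the variable 5 to -[6, 5] and the other variables to 0.\<close>

primrec dser :: "nat list \<Rightarrow> series \<Rightarrow> real" where
  "dser [] g = 0"
| "dser (k # u) g = (if k = 6 then hd_sg u * g u else 0) - lsg k * lcons 6 (\<lambda>v. g (k # v)) u
                    + dser u (\<lambda>w. g (k # w))"

lemma ev_lcons:
  assumes "inftes r" "y \<in> {1..8}"
  shows "ev (lcons y g) r = r y * ev g r"
proof -
  have "ev (\<lambda>w. lcons y g (k # w)) r = (if k = y then ev g r else 0)" for k
    by (simp add: lcons_def ev_zero)
  then have "ev (lcons y g) r = (\<Sum>k\<in>{1..8}. if k = y then r y * ev g r else 0)"
    by (subst ev_rec[OF assms(1)]) (simp add: lcons_def if_distrib[of "\<lambda>z. _ * z"] cong: if_cong)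
  then show ?thesis using assms(2) by simp
qed

text \<open>Leibniz rule for the first letter k. The product with 6 in front of k comes from the
  first term of \<open>dser\<close>, the one with 6 just behind k from the second.\<close>

lemma ev_dser:
  assumes "inftes r"
  shows "ev (\<lambda>u. dser u g) r = (\<Sum>k\<in>{1..8}.
    lsg k *\<^sub>R (r 6 * r k - r k * r 6) * ev (\<lambda>w. g (k # w)) r + r k * ev (\<lambda>u. dser u (\<lambda>w. g (k # w))) r)"
proof -
  let ?g = "\<lambda>k w. g (k # w)"
  have hd: "ev (\<lambda>u. hd_sg u * g u) r = (\<Sum>x\<in>{1..8}. lsg x *\<^sub>R (r x * ev (?g x) r))"
    by (subst ev_rec[OF assms]) (simp add: ev_scaleR)
  have k: "ev (\<lambda>u. dser (k # u) g) r
      = (if k = 6 then ev (\<lambda>u. hd_sg u * g u) r else 0) - lsg k *\<^sub>R (r 6 * ev (?g k) r) + ev (\<lambda>u. dser u (?g k)) r" for k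
    using ev_lcons[OF assms, of 6 "?g k"]
    by (cases "k = 6") (simp_all add: ev_add ev_diff ev_scaleR ev_zero)
  have "ev (\<lambda>u. dser u g) r = (\<Sum>k\<in>{1..8}. r k * ev (\<lambda>u. dser (k # u) g) r)"
    by (subst ev_rec[OF assms]) simp
  also have "\<dots> = (\<Sum>k\<in>{1..8}. (if k = 6 then r 6 * ev (\<lambda>u. hd_sg u * g u) r else 0)
      + (r k * ev (\<lambda>u. dser u (?g k)) r - lsg k *\<^sub>R (r k * r 6 * ev (?g k) r)))"
    unfolding k by (intro sum.cong) (auto simp: algebra_simps)
  also have "\<dots> = r 6 * ev (\<lambda>u. hd_sg u * g u) r
      + (\<Sum>k\<in>{1..8}. r k * ev (\<lambda>u. dser u (?g k)) r - lsg k *\<^sub>R (r k * r 6 * ev (?g k) r))"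
    unfolding sum.distrib by simp
  also have "\<dots> = (\<Sum>k\<in>{1..8}. lsg k *\<^sub>R (r 6 * r k * ev (?g k) r)
      + (r k * ev (\<lambda>u. dser u (?g k)) r - lsg k *\<^sub>R (r k * r 6 * ev (?g k) r)))"
    unfolding hd sum_distrib_left sum.distrib by (simp add: mult.assoc)
  also have "\<dots> = (\<Sum>k\<in>{1..8}.
      lsg k *\<^sub>R (r 6 * r k - r k * r 6) * ev (?g k) r + r k * ev (\<lambda>u. dser u (?g k)) r)"
    by (intro sum.cong) (simp_all add: algebra_simps)
  finally show ?thesis .
qed

text \<open>In degree n + 1 the value changes only through the degree n part of g with a single
  letter replaced by its second-order displacement. Replacing two letters, or one in a longer word,
  costs at least degree n + 2.\<close>

lemma ev_second_order:
  assumes r: "inftes r" and r': "inftes r'" and d: "\<And>k. k \<in> {1..8} \<Longrightarrow> filt 2 (r' k - r k)"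
    and d45: "\<And>k. k \<in> {4, 5} \<Longrightarrow> filt 3 (r' k - r k - lsg k *\<^sub>R (r 6 * r k - r k * r 6))"
    and g: "\<And>w. set w \<subseteq> {1..8} \<Longrightarrow> length w < n \<Longrightarrow> g w = 0"
    and g45: "\<And>w. set w \<subseteq> {1..8} \<Longrightarrow> length w = n \<Longrightarrow> \<not> set w \<subseteq> {4, 5} \<Longrightarrow> g w = 0"
  shows "filt (n + 2) (ev g r' - ev g r - ev (\<lambda>u. dser u g) r)"
  using g g45
proof (induction n arbitrary: g)
  let ?E = "\<lambda>g. ev g r' - ev g r - ev (\<lambda>u. dser u g) r"
  let ?c = "\<lambda>k. lsg k *\<^sub>R (r 6 * r k - r k * r 6)"
  have rk: "filt 1 (r k)" "filt 1 (r' k)" if "k \<in> {1..8}" for k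
    using r r' that by (simp_all add: inftes_def)
  have c2: "filt 2 (?c k)" if "k \<in> {1..8}" for k
    using filt_mult[OF rk(1) rk(1), of 6 k] filt_mult[OF rk(1) rk(1), of k 6] that
    by (intro filt_scaleR filt_diff) (simp_all add: numeral_2_eq_2)
  have E: "?E g = (\<Sum>k\<in>{1..8}. ((r' k - r k) * ev (\<lambda>w. g (k # w)) r' - ?c k * ev (\<lambda>w. g (k # w)) r)
      + r k * ?E (\<lambda>w. g (k # w)))" for g
    unfolding ev_dser[OF r, of g] ev_rec[OF r, of g] ev_rec[OF r', of g]
    by (simp add: left_diff_distrib[of "r' _"] right_diff_distrib[of "r _"] sum.distrib sum_subtractf sum_negf)
  {
    case 0
    have E1: "filt 1 (?E h)" for h
    proof (rule filt_diff)
      show "filt 1 (ev h r' - ev h r)"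
        using ev_filt_diff[OF r' r d, of 0 h] by simp
      show "filt 1 (ev (\<lambda>u. dser u h) r)" by (rule filt_ev[OF r]) simp
    qed
    have "filt 2 (((r' k - r k) * ev (\<lambda>w. g (k # w)) r' - ?c k * ev (\<lambda>w. g (k # w)) r) + r k * ?E (\<lambda>w. g (k # w)))"
      if k: "k \<in> {1..8}" for k
    proof -
      have "filt (1 + 1) (r k * ?E (\<lambda>w. g (k # w)))" by (intro filt_mult rk k E1)
      then have "filt 2 (r k * ?E (\<lambda>w. g (k # w)))" by (simp only: one_add_one)
      then show ?thesis
        by (intro filt_add filt_diff[OF filt_mult_right[OF d[OF k]] filt_mult_right[OF c2[OF k]]])
    qed
    then show ?case unfolding E[of g] add_0 by (rule filt_sum)
  next
    case (Suc n)
    have "filt (Suc n + 2) (((r' k - r k) * ev (\<lambda>w. g (k # w)) r' - ?c k * ev (\<lambda>w. g (k # w)) r)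
        + r k * ?E (\<lambda>w. g (k # w)))"
      if k: "k \<in> {1..8}" for k
    proof (rule filt_add)
      let ?h = "\<lambda>w. g (k # w)"
      have h: "?h w = 0" if "set w \<subseteq> {1..8}" "length w < n" for w
        using Suc.prems(1)[of "k # w"] that k by simp
      have h45: "?h w = 0" if "set w \<subseteq> {1..8}" "length w = n" "\<not> set w \<subseteq> {4, 5}" for w
        using Suc.prems(2)[of "k # w"] that k by auto
      have "filt (1 + (n + 2)) (r k * ?E ?h)"
        by (intro filt_mult rk k Suc.IH h h45)
      then show "filt (Suc n + 2) (r k * ?E ?h)" by simp
      show "filt (Suc n + 2) ((r' k - r k) * ev ?h r' - ?c k * ev ?h r)"
      proof (cases "k \<in> {4, 5}")
        case True
        have "filt (3 + n) ((r' k - r k - ?c k) * ev ?h r')"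
          by (intro filt_mult d45 True filt_ev r' h)
        moreover have "filt (2 + Suc n) (?c k * (ev ?h r' - ev ?h r))"
          by (intro filt_mult c2 k ev_filt_diff r r' d h)
        ultimately have "filt (Suc n + 2) ((r' k - r k - ?c k) * ev ?h r' + ?c k * (ev ?h r' - ev ?h r))"
          by (intro filt_add) (simp_all add: numeral_2_eq_2 numeral_3_eq_3)
        moreover have "(x - c) * y + c * (y - z) = x * y - c * z" for x c y z :: qalg
          by (simp add: left_diff_distrib right_diff_distrib)
        ultimately show ?thesis by (simp only:)
      next
        case False
        \<comment> \<open>For k outside {4, 5} the displacement is only known to have degree 2, but
          no lowest-degree word contains k, so the tail of g starts one degree later.\<close>
        have h': "?h w = 0" if "set w \<subseteq> {1..8}" "length w < Suc n" for w
          using Suc.prems(1)[of "k # w"] Suc.prems(2)[of "k # w"] that k False by (cases "length w = n") auto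
        have "filt (2 + Suc n) ((r' k - r k) * ev ?h r')"
          by (intro filt_mult d k filt_ev r' h')
        moreover have "lsg k = 0" using False by (simp add: lsg_def)
        ultimately show ?thesis by simp
      qed
    qed
    then show ?case unfolding E[of g] by (rule filt_sum)
  }
qed

lemma dser_zero:
  assumes "\<And>w. Suc (length w) = length u \<Longrightarrow> g w = 0"
  shows "dser u g = 0"
  using assms
proof (induction u arbitrary: g)
  case (Cons k u)
  have "dser u (\<lambda>w. g (k # w)) = 0"
    by (rule Cons.IH) (simp add: Cons.prems)
  moreover have "lcons 6 (\<lambda>v. g (k # v)) u = 0"
    by (auto simp: lcons_def Cons.prems split: list.split)
  ultimately show ?case by (simp add: Cons.prems)
qed simp

text \<open>As g vanishes on words of this length containing 6, the displayed 6 must be the inserted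
  one. It belongs to the commutator of the first letter of q or of the last letter of p, with
  opposite signs; \<open>hd_sg (rev p)\<close> is the sign of that last letter.\<close>

lemma dser_insert:
  assumes "6 \<notin> set p" "\<And>w. length w = length p + length q \<Longrightarrow> 6 \<in> set w \<Longrightarrow> g w = 0"
  shows "dser (p @ 6 # q) g = (hd_sg q - hd_sg (rev p)) * g (p @ q)"
  using assms
proof (induction p arbitrary: g)
  case Nil
  have "dser q (\<lambda>w. g (6 # w)) = 0"
    by (rule dser_zero) (simp add: Nil.prems)
  then show ?case by (simp add: lsg_def)
next
  case (Cons k p)
  have IH: "dser (p @ 6 # q) (\<lambda>w. g (k # w)) = (hd_sg q - hd_sg (rev p)) * g (k # p @ q)"
    using Cons.prems by (intro Cons.IH) auto
  show ?case
  proof (cases p)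
    case Nil
    then show ?thesis using IH Cons.prems(1) by (simp add: lcons_def algebra_simps)
  next
    case (Cons x p')
    then have "hd_sg (rev (k # p)) = hd_sg (rev p)"
      by (cases "rev p") auto
    then show ?thesis
      using IH Cons \<open>6 \<notin> set (k # p)\<close> by (simp add: lcons_def)
  qed
qed

text \<open>Comparing the second-order parts along the curve (1+e) A (1+e), with e the circular
  variable 6, gives g(w) (s(next letter) - s(previous letter)) = 0 at every place inside w,
  where s is +1 on the letter 4 and -1 on the letter 5.\<close>

lemma variant_determined:
  fixes \<sigma> :: real
  assumes f: "valid_series f"
    and V: "\<And>u v. filt 1 (u - 1) \<Longrightarrow> filt 1 (v - 1) \<Longrightarrow>
      \<exists>a b. filt 1 (a - 1) \<and> filt 1 (b - 1) \<and> ev f (rB u v) = a * ev f rA * b"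
    and V2: "\<exists>a b. filt 2 (a - (1 + \<sigma> *\<^sub>R e6)) \<and> filt 2 (b - (1 - \<sigma> *\<^sub>R e6)) \<and> ev f rC = a * ev f rA * b"
    and j: "j \<in> {4, 5}" "lsg j = \<sigma>"
    and zero: "\<And>n. circ_coeff f (replicate n j) = 0"
  shows "f = (\<lambda>w. 0)"
proof -
  define g where "g = circ_coeff f"
  let ?r = "rt rA" and ?r' = "rt rC"
  have r: "inftes ?r" and r': "inftes ?r'" by (intro inftes_rt inftes_rA inftes_rC)+
  have evA: "ev f rA = ev g ?r" unfolding g_def by (rule ev_rt[OF inftes_rA f])
  have evC: "ev f rC = ev g ?r'" unfolding g_def by (rule ev_rt[OF inftes_rC f])
  have s: "\<sigma> = 1 \<or> \<sigma> = -1" using j by (auto simp: lsg_def)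
  have "g w = 0" if "set w \<subseteq> {1..8}" for w
    using that
  proof (induction "length w" arbitrary: w rule: less_induct)
    case less
    define n where "n = length w"
    have low: "g w = 0" if "set w \<subseteq> {1..8}" "length w < n" for w
      using less.hyps that by (simp add: n_def)
    have F: "filt n (ev g ?r)" by (rule filt_ev[OF r low])
    \<comment> \<open>Modulo degree n + 1 the factors a and b act as 1, so g has the same value at
      the generic point and on the slice; independence then compares coefficients.\<close>
    have g45: "g w = 0" if w: "set w \<subseteq> {1..8}" "length w = n" "\<not> set w \<subseteq> {4, 5}" for w
    proof -
      obtain u v where uv: "filt 1 (u - 1)" "filt 1 (v - 1)"
        and slice: "\<And>l. l \<in> {1..8} \<Longrightarrow> filt 2 (rt (rB u v) l - (if l \<in> {4, 5} then ?r l else 0))"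
        by (rule orbit_first_order_slice) blast
      let ?p = "\<lambda>l. if l \<in> {4, 5} then ?r l else 0"
      let ?g = "\<lambda>w. if set w \<subseteq> {4, 5} then g w else 0"
      obtain a b where ab: "filt 1 (a - 1)" "filt 1 (b - 1)" "ev f (rB u v) = a * ev f rA * b"
        using V[OF uv] by blast
      have "filt (1 + n) ((a - 1) * (ev g ?r * b))" "filt (n + 1) (ev g ?r * (b - 1))"
        by (intro filt_mult filt_mult_right ab F)+
      then have "filt (Suc n) ((a - 1) * (ev g ?r * b) + ev g ?r * (b - 1))"
        by (intro filt_add) simp_all
      then have 1: "filt (Suc n) (a * ev g ?r * b - ev g ?r)"
        by (simp add: algebra_simps)
      have p: "inftes ?p" using r by (simp add: inftes_def)
      have "filt (Suc n) (ev g (rt (rB u v)) - ev g ?p)"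
        by (intro ev_filt_diff inftes_rt inftes_rB uv p slice low)
      moreover have "ev g (rt (rB u v)) = a * ev g ?r * b"
        using ab(3) ev_rt[OF inftes_rB[OF uv] f] by (simp add: evA g_def)
      ultimately have 2: "filt (Suc n) (a * ev g ?r * b - ev ?g ?r)"
        by (simp only: ev_kill_letters)
      have "filt (Suc n) (ev (\<lambda>w. g w - ?g w) ?r)"
        unfolding ev_diff by (rule filt_trans[OF filt_sym[OF 1] 2])
      from ev_rt_independent[OF this, of w] show ?thesis using w by simp
    qed
    \<comment> \<open>Since F, the value of g, starts in degree n, a F b - F is \<sigma> [e6, F]
      modulo degree n + 2. The \<open>lcons\<close> and \<open>smul\<close> terms are the
      coefficients of the letter 6 before and after g.\<close>
    have second: "dser u g = \<sigma> * (lcons 6 g u - smul g (\<lambda>v. of_bool (v = [6])) u)"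
      if u: "set u \<subseteq> {1..8}" "length u = Suc n" for u
    proof -
      obtain a b where ab: "filt 2 (a - (1 + \<sigma> *\<^sub>R e6))" "filt 2 (b - (1 - \<sigma> *\<^sub>R e6))" "ev f rC = a * ev f rA * b"
        using V2 by blast
      let ?x = "\<sigma> *\<^sub>R e6" and ?F = "ev g ?r"
      have x: "filt 1 ?x" by (intro filt_scaleR filt_e6)
      have "filt (2 + n) ((a - (1 + ?x)) * (?F * b))" "filt (n + 2) ((1 + ?x) * (?F * (b - (1 - ?x))))"
        "filt (1 + (n + 1)) (?x * (?F * ?x))"
        by (rule filt_mult[OF ab(1) filt_mult_right[OF F]], rule filt_mult_left[OF filt_mult[OF F ab(2)]],
            rule filt_mult[OF x filt_mult[OF F x]])
      then have "filt (n + 2) ((a - (1 + ?x)) * (?F * b) + (1 + ?x) * (?F * (b - (1 - ?x))) - ?x * (?F * ?x))"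
        by (intro filt_add filt_diff) (simp_all add: add.commute)
      moreover have "(a - (1 + y)) * (F * b) + (1 + y) * (F * (b - (1 - y))) - y * (F * y)
          = a * F * b - F - (y * F - F * y)" for y F :: qalg
        by (simp add: algebra_simps)
      ultimately have 1: "filt (n + 2) (ev g ?r' - ?F - (?x * ?F - ?F * ?x))"
        using ab(3) unfolding evA evC by (simp only:)
      have 2: "filt (n + 2) (ev g ?r' - ?F - ev (\<lambda>u. dser u g) ?r)"
      proof (rule ev_second_order[OF r r' _ _ low g45])
        show "filt 2 (?r' k - ?r k)" if "k \<in> {1..8}" for k
          by (rule filt_rt) (rule rC_first_order)
        \<comment> \<open>Beyond the commutator, the exact conjugation formulas leave only the term
          - e6 r e6.\<close>
        have e3: "filt 3 (e6 * (?r k * e6))" if "k \<in> {4, 5}" for k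
        proof -
          have "filt 1 (?r k)" using r that by (auto simp: inftes_def)
          from filt_mult[OF filt_e6 filt_mult[OF this filt_e6]] show ?thesis
            by (simp add: numeral_3_eq_3)
        qed
        show "filt 3 (?r' k - ?r k - lsg k *\<^sub>R (?r 6 * ?r k - ?r k * ?r 6))" if k: "k \<in> {4, 5}" for k
        proof (cases "k = 4")
          case True
          have "?r' 4 - ?r 4 - lsg 4 *\<^sub>R (?r 6 * ?r 4 - ?r 4 * ?r 6) = - (e6 * (?r 4 * e6))"
            unfolding rt_rC e6_def[symmetric] by (simp add: lsg_def algebra_simps)
          then show ?thesis using filt_minus[OF e3[OF k]] True by simp
        next
          case False
          then have 5: "k = 5" using k by simp
          have "?r' 5 - ?r 5 - lsg 5 *\<^sub>R (?r 6 * ?r 5 - ?r 5 * ?r 6) = - (e6 * (?r 5 * e6))"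
            unfolding rt_rC e6_def[symmetric] by (simp add: lsg_def algebra_simps)
          then show ?thesis using filt_minus[OF e3[OF k]] 5 by simp
        qed
      qed
      let ?h = "\<lambda>u. dser u g - \<sigma> * (lcons 6 g u - smul g (\<lambda>v. of_bool (v = [6])) u)"
      have "ev ?h ?r = ev (\<lambda>u. dser u g) ?r - (?x * ?F - ?F * ?x)"
        using ev_lcons[OF r, of 6 g] ev_smul[OF r, of g] ev_single[OF r, of "[6]"]
        by (simp add: ev_diff ev_scaleR e6_def scaleR_diff_right)
      moreover have "ev (\<lambda>u. dser u g) ?r - (?x * ?F - ?F * ?x)
          = (ev g ?r' - ?F - (?x * ?F - ?F * ?x)) - (ev g ?r' - ?F - ev (\<lambda>u. dser u g) ?r)"
        by simp
      ultimately have "filt (n + 2) (ev ?h ?r)"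
        using filt_diff[OF 1 2] by (simp only:)
      from ev_rt_independent[OF this, of u] show ?thesis using u by simp
    qed
    show "g w = 0"
    proof (cases "set w \<subseteq> {4, 5}")
      case False
      then show ?thesis using g45 less.prems by (simp add: n_def)
    next
      case w45: True
      \<comment> \<open>The letter 6 is inserted just before the first letter of w different from j,
        where the signs on its two sides cannot cancel.\<close>
      define p q where "p = takeWhile (\<lambda>x. x = j) w" and "q = dropWhile (\<lambda>x. x = j) w"
      have w: "w = p @ q" by (simp add: p_def q_def)
      have "\<forall>x\<in>set p. x = j" unfolding p_def by (auto dest: set_takeWhileD)
      then obtain m where p: "p = replicate m j"
        using replicate_length_same[of p j, symmetric] by blast
      show ?thesis
      proof (cases q)
        case Nil
        then show ?thesis using w p zero[of m] by (simp add: g_def)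
      next
        case (Cons x q')
        have "x \<noteq> j" using Cons hd_dropWhile[of "\<lambda>x. x = j" w] by (simp add: q_def)
        moreover have "x \<in> {4, 5}" using w45 w Cons by auto
        ultimately have hq: "hd_sg q = - \<sigma>" using j Cons by (auto simp: lsg_def)
        have six: "6 \<notin> set p" "6 \<notin> set q" using w45 w by auto
        have hp: "hd_sg (rev p) = (if p = [] then 0 else \<sigma>)"
        proof -
          have "rev p = p" by (simp add: p)
          then show ?thesis using j(2) by (cases m) (simp_all add: p)
        qed
        have "set w \<subseteq> {1..8}" by (rule less.prems)
        then have "dser (p @ 6 # q) g
            = \<sigma> * (lcons 6 g (p @ 6 # q) - smul g (\<lambda>v. of_bool (v = [6])) (p @ 6 # q))"
          unfolding w by (intro second) (simp_all add: n_def w)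
        moreover have "dser (p @ 6 # q) g = (hd_sg q - hd_sg (rev p)) * g (p @ q)"
        proof (rule dser_insert[OF six(1)])
          fix v assume v: "length v = length p + length q" "(6::nat) \<in> set v"
          show "g v = 0"
          proof (cases "set v \<subseteq> {1..8}")
            case True
            then show ?thesis using v by (intro g45) (auto simp: n_def w)
          next
            case False
            then show ?thesis
              using circ_coeff_inverse(1)[OF f] by (simp add: g_def valid_series_def)
          qed
        qed
        \<comment> \<open>This term requires a word ending in 6, but q is nonempty and ends in 4 or
          5.\<close>
        moreover have "smul g (\<lambda>v. of_bool (v = [6])) (p @ 6 # q) = 0"
        proof -
          have "drop i (p @ 6 # q) \<noteq> [6]" for i
          proof
            assume *: "drop i (p @ 6 # q) = [6]"
            have "i < length (p @ 6 # q)" by (rule ccontr) (use * in simp)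
            from last_drop[OF this] have "last (p @ 6 # q) = 6" unfolding * by simp
            moreover have "last (p @ 6 # q) = last q" using Cons by simp
            moreover have "last q \<in> set q" using Cons by simp
            ultimately show False using six(2) by simp
          qed
          then show ?thesis by (simp add: smul_def)
        qed
        moreover have "lcons 6 g (p @ 6 # q) = (if p = [] then g (p @ q) else 0)"
          using six(1) by (cases p) (auto simp: lcons_def)
        ultimately have "(hd_sg q - hd_sg (rev p)) * g (p @ q) = \<sigma> * ((if p = [] then g (p @ q) else 0) - 0)"
          by (simp only:)
        then have "(- \<sigma> - (if p = [] then 0 else \<sigma>)) * g w = \<sigma> * (if p = [] then g w else 0)"
          unfolding hq hp w[symmetric] by simp
        \<comment> \<open>For empty p the equation reads -\<sigma> g(w) = \<sigma> g(w), otherwise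
          -2 \<sigma> g(w) = 0.\<close>
        then have "\<sigma> * g w = 0" by (simp split: if_splits)
        then show ?thesis using s by auto
      qed
    qed
  qed
  then have "g w = 0" for w
    using circ_coeff_inverse(1)[OF f] unfolding g_def valid_series_def by blast
  then have "g = (\<lambda>w. 0)" by blast
  then have "f = lin_subst hat_form (lin_subst tilde_form (\<lambda>w. 0))"
    using circ_coeff_inverse(2)[OF f] by (simp add: g_def)
  then show ?thesis by (simp add: lin_subst_def)
qed

section \<open>Transfer to the function representation\<close>

text \<open>The right factor acting on the series itself is S \<gamma> S^{-1}, and \<kappa> is the
  sign with which S passes e6. The condition on \<kappa>, \<tau>, \<sigma> makes the first-order
  terms of the two factors opposite. The triples (\<sigma>, \<tau>, \<kappa>) are (1, 1, -1) for
  bivariant, (-1, -1, -1) for antivariant, (1, -1, 1) for left-variant and (-1, 1, 1) for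
  right-variant operations; \<sigma> fixes the letter j.\<close>

lemma variant_unique:
  fixes \<sigma> \<tau> \<kappa> :: real
  assumes T: "\<And>u v x. T u v x = \<alpha> u v * (x * \<gamma> u v)"
    and \<alpha>: "\<And>u v. filt 1 (u - 1) \<Longrightarrow> filt 1 (v - 1) \<Longrightarrow> filt 1 (\<alpha> u v - 1)"
    and \<gamma>: "\<And>u v. filt 1 (u - 1) \<Longrightarrow> filt 1 (v - 1) \<Longrightarrow> filt 1 (\<gamma> u v - 1)"
    and \<alpha>2: "filt 2 (\<alpha> (1 + e6) (1 + e6) - (1 + \<sigma> *\<^sub>R e6))"
    and \<gamma>2: "filt 2 (\<gamma> (1 + e6) (1 + e6) - (1 + \<tau> *\<^sub>R e6))"
    and S: "S * S' = 1" "S * e6 * S' = \<kappa> *\<^sub>R e6" "\<kappa> * \<tau> = - \<sigma>"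
    and j: "j \<in> {4, 5}" "lsg j = \<sigma>"
    and f: "valid_series f" "variant T S f" and f': "valid_series f'" "variant T S f'"
    and eq: "\<And>n. circ_coeff f (replicate n j) = circ_coeff f' (replicate n j)"
  shows "f = f'"
proof -
  \<comment> \<open>The laws are linear in the series, so the difference is again variant, with
    vanishing coefficients at the words j...j.\<close>
  let ?d = "\<lambda>w. f w - f' w"
  have move: "ev ?d (rB u v) = \<alpha> u v * ev ?d rA * (S * \<gamma> u v * S')"
    if uv: "filt 1 (u - 1)" "filt 1 (v - 1)" for u v
  proof -
    have eq: "ev h (rB u v) * S = \<alpha> u v * (ev h rA * S * \<gamma> u v)" if "variant T S h" for h
      using that uv unfolding variant_def T by blast
    have "ev ?d (rB u v) * S = ev f (rB u v) * S - ev f' (rB u v) * S"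
      by (simp only: ev_diff left_diff_distrib)
    also have "\<dots> = \<alpha> u v * (ev ?d rA * S * \<gamma> u v)"
      unfolding eq[OF f(2)] eq[OF f'(2)] ev_diff left_diff_distrib right_diff_distrib ..
    finally have "ev ?d (rB u v) * S * S' = \<alpha> u v * (ev ?d rA * S * \<gamma> u v) * S'" by simp
    then show ?thesis by (simp add: mult.assoc S(1))
  qed
  have near: "filt N (S * x * S' - (1 + y))" if "filt N (x - (1 + z))" "S * z * S' = y" for N x y z
  proof -
    have "filt N (S * (x - (1 + z)) * S')" using that(1) by (rule filt_mult_both)
    moreover have "S * (x - (1 + z)) * S' = S * x * S' - (1 + y)"
      by (simp add: right_diff_distrib left_diff_distrib distrib_left distrib_right S(1) that(2))
    ultimately show ?thesis by simp
  qed
  have "?d = (\<lambda>w. 0)"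
  proof (rule variant_determined[OF valid_series_diff[OF f(1) f'(1)] _ _ j])
    fix u v :: qalg assume uv: "filt 1 (u - 1)" "filt 1 (v - 1)"
    have "filt 1 (S * \<gamma> u v * S' - 1)"
      using near[of 1 "\<gamma> u v" 0 0] \<gamma>[OF uv] by simp
    then show "\<exists>a b. filt 1 (a - 1) \<and> filt 1 (b - 1) \<and> ev ?d (rB u v) = a * ev ?d rA * b"
      using \<alpha>[OF uv] move[OF uv] by blast
  next
    have e: "filt 1 (1 + e6 - 1)" using filt_e6 by simp
    have "S * (\<tau> *\<^sub>R e6) * S' = \<tau> *\<^sub>R (S * e6 * S')" by simp
    also have "\<dots> = (- \<sigma>) *\<^sub>R e6" using S(3) by (simp add: S(2) mult.commute)
    finally have "filt 2 (S * \<gamma> (1 + e6) (1 + e6) * S' - (1 - \<sigma> *\<^sub>R e6))"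
      using near[OF \<gamma>2] by simp
    then show "\<exists>a b. filt 2 (a - (1 + \<sigma> *\<^sub>R e6)) \<and> filt 2 (b - (1 - \<sigma> *\<^sub>R e6)) \<and> ev ?d rC = a * ev ?d rA * b"
      unfolding rC_def using \<alpha>2 move[OF e e] by blast
  next
    show "circ_coeff ?d (replicate n j) = 0" for n
      by (simp add: circ_coeff_diff f(1) f'(1) eq)
  qed
  then show ?thesis by (simp add: fun_eq_iff)
qed

lemma e6_conj:
  "q1 * - q1 = 1" "q1 * e6 * - q1 = (-1) *\<^sub>R e6"
  "q2 * - q2 = 1" "q2 * e6 * - q2 = (-1) *\<^sub>R e6"
  "q1 * q2 * - (q1 * q2) = 1" "q1 * q2 * e6 * - (q1 * q2) = 1 *\<^sub>R e6"
  "1 * (1::qalg) = 1" "1 * e6 * 1 = 1 *\<^sub>R e6"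
proof -
  have "q1 * q2 * e6 * (q1 * q2) = e6 * (q1 * q2 * (q1 * q2))"
    unfolding e6_q by (simp only: mult.assoc)
  then show "q1 * q2 * e6 * - (q1 * q2) = 1 *\<^sub>R e6" by (simp add: mult.assoc)
qed (simp_all add: e6_q mult.assoc)

lemma filt_2_e6: "filt 2 (1 + e6 - (1 + 1 *\<^sub>R e6))" "filt 2 (qinv (1 + e6) - (1 + (-1) *\<^sub>R e6))"
  using filt_2_qinv[OF filt_e6, of "1 + e6"] by simp_all

lemma variant_bijection:
  assumes "\<exists>f. valid_series f \<and> variant T S f \<and> (\<forall>n. circ_coeff f (replicate n j) = d n)"
    and "\<And>f f'. valid_series f \<Longrightarrow> variant T S f \<Longrightarrow> valid_series f' \<Longrightarrow> variant T S f' \<Longrightarrow>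
      (\<And>n. circ_coeff f (replicate n j) = circ_coeff f' (replicate n j)) \<Longrightarrow> f = f'"
  shows "\<exists>!f. valid_series f \<and> variant T S f \<and> (\<forall>n. circ_coeff f (replicate n j) = d n)"
  using assms(1)
proof (rule ex_ex1I)
  fix f f'
  assume "valid_series f \<and> variant T S f \<and> (\<forall>n. circ_coeff f (replicate n j) = d n)"
    "valid_series f' \<and> variant T S f' \<and> (\<forall>n. circ_coeff f' (replicate n j) = d n)"
  then show "f = f'" by (intro assms(2)) simp_all
qed

lemma bivariant_bijection:
  assumes "S \<in> {q1, q2}"
  shows "\<exists>!f. valid_series f \<and> variant Tbi S f \<and> (\<forall>n. circ_coeff f (replicate n 4) = d n)"
proof (rule variant_bijection)
  show "\<exists>f. valid_series f \<and> variant Tbi S f \<and> (\<forall>n. circ_coeff f (replicate n 4) = d n)"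
    using assms bivariant_exists by auto
  have "S * - S = 1" "S * e6 * - S = (-1) *\<^sub>R e6" using assms e6_conj(1-4) by blast+
  note * = variant_unique[of Tbi "\<lambda>u v. u" "\<lambda>u v. v", OF Tbi_def _ _ filt_2_e6(1) filt_2_e6(1) this]
  show "f = f'" if "valid_series f" "variant Tbi S f" "valid_series f'" "variant Tbi S f'"
    "\<And>n. circ_coeff f (replicate n 4) = circ_coeff f' (replicate n 4)" for f f'
    by (rule *[OF _ _ _ _ _ that]) (simp_all add: lsg_def)
qed

lemma antivariant_bijection:
  assumes "S \<in> {q1, q2}"
  shows "\<exists>!f. valid_series f \<and> variant Tanti S f \<and> (\<forall>n. circ_coeff f (replicate n 5) = d n)"
proof (rule variant_bijection)
  show "\<exists>f. valid_series f \<and> variant Tanti S f \<and> (\<forall>n. circ_coeff f (replicate n 5) = d n)"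
    using assms antivariant_exists by auto
  have "S * - S = 1" "S * e6 * - S = (-1) *\<^sub>R e6" using assms e6_conj(1-4) by blast+
  note * = variant_unique[of Tanti "\<lambda>u v. qinv v" "\<lambda>u v. qinv u",
      OF Tanti_def _ _ filt_2_e6(2) filt_2_e6(2) this]
  show "f = f'" if "valid_series f" "variant Tanti S f" "valid_series f'" "variant Tanti S f'"
    "\<And>n. circ_coeff f (replicate n 5) = circ_coeff f' (replicate n 5)" for f f'
    by (rule *[OF _ _ _ _ _ that]) (simp_all add: lsg_def qinv_first del: One_nat_def)
qed

lemma left_variant_bijection:
  assumes "S \<in> {1, q1 * q2}"
  shows "\<exists>!f. valid_series f \<and> variant Tleft S f \<and> (\<forall>n. circ_coeff f (replicate n 4) = d n)"
proof (rule variant_bijection)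
  show "\<exists>f. valid_series f \<and> variant Tleft S f \<and> (\<forall>n. circ_coeff f (replicate n 4) = d n)"
    using assms left_variant_exists by auto
  obtain S' where "S * S' = 1" "S * e6 * S' = 1 *\<^sub>R e6" using assms e6_conj(5-8) by blast
  note * = variant_unique[of Tleft "\<lambda>u v. u" "\<lambda>u v. qinv u",
      OF Tleft_def _ _ filt_2_e6(1) filt_2_e6(2) this]
  show "f = f'" if "valid_series f" "variant Tleft S f" "valid_series f'" "variant Tleft S f'"
    "\<And>n. circ_coeff f (replicate n 4) = circ_coeff f' (replicate n 4)" for f f'
    by (rule *[OF _ _ _ _ _ that]) (simp_all add: lsg_def qinv_first del: One_nat_def)
qed

lemma right_variant_bijection:
  assumes "S \<in> {1, q1 * q2}"
  shows "\<exists>!f. valid_series f \<and> variant Tright S f \<and> (\<forall>n. circ_coeff f (replicate n 5) = d n)"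
proof (rule variant_bijection)
  show "\<exists>f. valid_series f \<and> variant Tright S f \<and> (\<forall>n. circ_coeff f (replicate n 5) = d n)"
    using assms right_variant_exists by auto
  obtain S' where "S * S' = 1" "S * e6 * S' = 1 *\<^sub>R e6" using assms e6_conj(5-8) by blast
  note * = variant_unique[of Tright "\<lambda>u v. qinv v" "\<lambda>u v. v",
      OF Tright_def _ _ filt_2_e6(2) filt_2_e6(1) this]
  show "f = f'" if "valid_series f" "variant Tright S f" "valid_series f'" "variant Tright S f'"
    "\<And>n. circ_coeff f (replicate n 5) = circ_coeff f' (replicate n 5)" for f f'
    by (rule *[OF _ _ _ _ _ that]) (simp_all add: lsg_def qinv_first del: One_nat_def)
qed

lemma infinitesimal_coef: "infinitesimal (coef x) \<longleftrightarrow> filt 1 x"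
  unfolding infinitesimal_def by transfer auto

text \<open>Elements 1 + e with e infinitesimal are exactly the \<open>coef u\<close> with u near 1.
  The predicate P stays abstract to fit both variance definitions.\<close>

lemma all_infinitesimal:
  "(\<forall>e1 e2. infinitesimal e1 \<and> infinitesimal e2 \<longrightarrow> P (aadd aone e1) (aadd aone e2)) \<longleftrightarrow>
   (\<forall>u v. filt 1 (u - 1) \<longrightarrow> filt 1 (v - 1) \<longrightarrow> P (coef u) (coef v))"
proof safe
  fix u v assume *: "\<forall>e1 e2. infinitesimal e1 \<and> infinitesimal e2 \<longrightarrow> P (aadd aone e1) (aadd aone e2)"
    and uv: "filt 1 (u - 1)" "filt 1 (v - 1)"
  have "aadd aone (coef (x - 1)) = coef x" for x
    by (simp flip: one_qalg.rep_eq plus_qalg.rep_eq)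
  then show "P (coef u) (coef v)"
    using *[rule_format, of "coef (u - 1)" "coef (v - 1)"] uv by (simp only: infinitesimal_coef)
next
  fix e1 e2 assume *: "\<forall>u v. filt 1 (u - 1) \<longrightarrow> filt 1 (v - 1) \<longrightarrow> P (coef u) (coef v)"
    and e: "infinitesimal e1" "infinitesimal e2"
  have "coef (1 + qalg_of x) = aadd aone x" for x
    by (simp add: plus_qalg.rep_eq one_qalg.rep_eq qalg_of_inverse)
  moreover have "filt 1 (1 + qalg_of e1 - 1)" "filt 1 (1 + qalg_of e2 - 1)"
    using e infinitesimal_coef[of "qalg_of e1"] infinitesimal_coef[of "qalg_of e2"]
    by (simp_all add: qalg_of_inverse)
  ultimately show "P (aadd aone e1) (aadd aone e2)"
    using *[rule_format, of "1 + qalg_of e1" "1 + qalg_of e2"] by (simp only:)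
qed

lemma fq_eval_base: "fq_eval f (baseA 1) (baseA 2) = coef (ev f rA)"
proof -
  have "baseA 1 = coef (q1 + qX 1)" "baseA 2 = coef (q2 + qX 2)"
    by (simp_all add: baseA_def Qc_def plus_qalg.rep_eq coef_q coef_qX)
  then show ?thesis by (simp add: fq_eval_coef rA_def)
qed

lemma fq_eval_moved:
  "fq_eval f (amul (coef u) (amul (baseA 1) (coef v))) (amul (coef u) (amul (baseA 2) (coef v)))
    = coef (ev f (rB u v))"
proof -
  have "baseA 1 = coef (q1 + qX 1)" "baseA 2 = coef (q2 + qX 2)"
    by (simp_all add: baseA_def Qc_def plus_qalg.rep_eq coef_q coef_qX)
  then show ?thesis
    by (simp add: fq_eval_coef rB_def mult.assoc flip: times_qalg.rep_eq)
qed

lemma vec_variant_iff: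
  assumes "\<And>u v x. filt 1 (u - 1) \<Longrightarrow> filt 1 (v - 1) \<Longrightarrow> R (coef u) (coef v) (coef x) = coef (T u v x)"
  shows "vec_variant R f1 f2 \<longleftrightarrow> variant T q1 f1 \<and> variant T q2 f2"
  unfolding vec_variant_def Let_def
    all_infinitesimal[of "\<lambda>t1 t2. amul (fq_eval f1 (amul t1 (amul (baseA 1) t2)) (amul t1 (amul (baseA 2) t2))) aQ1
        = R t1 t2 (amul (fq_eval f1 (baseA 1) (baseA 2)) aQ1) \<and>
       amul (fq_eval f2 (amul t1 (amul (baseA 1) t2)) (amul t1 (amul (baseA 2) t2))) aQ2
        = R t1 t2 (amul (fq_eval f2 (baseA 1) (baseA 2)) aQ2)"]
  unfolding fq_eval_moved fq_eval_base variant_def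
  by (auto simp: assms coef_inject simp del: One_nat_def simp flip: coef_q times_qalg.rep_eq)

lemma single_variant_iff:
  assumes "\<And>u v x. filt 1 (u - 1) \<Longrightarrow> filt 1 (v - 1) \<Longrightarrow> R (coef u) (coef v) (coef x) = coef (T u v x)"
    and V: "\<And>x. V (coef x) = coef (x * S)"
  shows "single_variant R V f \<longleftrightarrow> variant T S f"
  unfolding single_variant_def Let_def
    all_infinitesimal[of "\<lambda>t1 t2. V (fq_eval f (amul t1 (amul (baseA 1) t2)) (amul t1 (amul (baseA 2) t2)))
        = R t1 t2 (V (fq_eval f (baseA 1) (baseA 2)))"]
  unfolding fq_eval_moved fq_eval_base variant_def V
  by (auto simp: assms coef_inject simp del: One_nat_def)

lemma ainv_near_one: "filt 1 (u - 1) \<Longrightarrow> ainv (coef u) = coef (qinv u)"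
  by (intro ainv_coef qinv_left qinv_right)

lemma raw_T:
  assumes "filt 1 (u - 1)" "filt 1 (v - 1)"
  shows "bivar (coef u) (coef v) (coef x) = coef (Tbi u v x)"
    "antivar (coef u) (coef v) (coef x) = coef (Tanti u v x)"
    "leftvar (coef u) (coef v) (coef x) = coef (Tleft u v x)"
    "rightvar (coef u) (coef v) (coef x) = coef (Tright u v x)"
  unfolding bivar_def antivar_def leftvar_def rightvar_def Tbi_def Tanti_def Tleft_def Tright_def
    ainv_near_one[OF assms(1)] ainv_near_one[OF assms(2)] times_qalg.rep_eq by (rule refl)+

lemma raw_val: "scalar_val (coef x) = coef (x * 1)" "pseudo_val (coef x) = coef (x * (q1 * q2))"
  by (simp_all add: scalar_val_def pseudo_val_def times_qalg.rep_eq coef_q)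

text \<open>The two components of a vectorial operation are constrained independently of each
  other.\<close>

lemma ex1_pair:
  assumes P: "\<exists>!x. P x" and Q: "\<exists>!y. Q y"
  shows "\<exists>!F. P (fst F) \<and> Q (snd F)"
proof (rule ex_ex1I)
  from ex1_implies_ex[OF P] ex1_implies_ex[OF Q] obtain x y where "P x" "Q y" by blast
  then show "\<exists>F. P (fst F) \<and> Q (snd F)" by (intro exI[of _ "(x, y)"]) simp
  fix F F' assume "P (fst F) \<and> Q (snd F)" "P (fst F') \<and> Q (snd F')"
  then show "F = F'"
    using alt_ex1E[OF P] alt_ex1E[OF Q] by (intro prod_eqI) blast+
qed

theorem mainTheorem4:
  shows
  "(\<forall>c1 c2 :: nat \<Rightarrow> real. \<exists>!F :: series \<times> series.
       valid_series (fst F) \<and> valid_series (snd F) \<and> vec_variant bivar (fst F) (snd F) \<and>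
       (\<forall>n. circ_coeff (fst F) (replicate n 4) = c1 n) \<and>
       (\<forall>n. circ_coeff (snd F) (replicate n 4) = c2 n))
 \<and> (\<forall>c1 c2 :: nat \<Rightarrow> real. \<exists>!F :: series \<times> series.
       valid_series (fst F) \<and> valid_series (snd F) \<and> vec_variant antivar (fst F) (snd F) \<and>
       (\<forall>n. circ_coeff (fst F) (replicate n 5) = c1 n) \<and>
       (\<forall>n. circ_coeff (snd F) (replicate n 5) = c2 n))
 \<and> (\<forall>c :: nat \<Rightarrow> real. \<exists>!f. valid_series f \<and> single_variant leftvar scalar_val f \<and>
       (\<forall>n. circ_coeff f (replicate n 4) = c n))
 \<and> (\<forall>c :: nat \<Rightarrow> real. \<exists>!f. valid_series f \<and> single_variant leftvar pseudo_val f \<and>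
       (\<forall>n. circ_coeff f (replicate n 4) = c n))
 \<and> (\<forall>c :: nat \<Rightarrow> real. \<exists>!f. valid_series f \<and> single_variant rightvar scalar_val f \<and>
       (\<forall>n. circ_coeff f (replicate n 5) = c n))
 \<and> (\<forall>c :: nat \<Rightarrow> real. \<exists>!f. valid_series f \<and> single_variant rightvar pseudo_val f \<and>
       (\<forall>n. circ_coeff f (replicate n 5) = c n))"
proof (intro conjI allI)
  fix c1 c2 c :: "nat \<Rightarrow> real"
  have bi: "vec_variant bivar f1 f2 \<longleftrightarrow> variant Tbi q1 f1 \<and> variant Tbi q2 f2" for f1 f2
    by (rule vec_variant_iff) (rule raw_T)
  have anti: "vec_variant antivar f1 f2 \<longleftrightarrow> variant Tanti q1 f1 \<and> variant Tanti q2 f2" for f1 f2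
    by (rule vec_variant_iff) (rule raw_T)
  have single:
    "single_variant leftvar scalar_val f \<longleftrightarrow> variant Tleft 1 f"
    "single_variant leftvar pseudo_val f \<longleftrightarrow> variant Tleft (q1 * q2) f"
    "single_variant rightvar scalar_val f \<longleftrightarrow> variant Tright 1 f"
    "single_variant rightvar pseudo_val f \<longleftrightarrow> variant Tright (q1 * q2) f" for f
    by (rule single_variant_iff, erule (1) raw_T, rule raw_val)+
  show "\<exists>!F :: series \<times> series.
       valid_series (fst F) \<and> valid_series (snd F) \<and> vec_variant bivar (fst F) (snd F) \<and>
       (\<forall>n. circ_coeff (fst F) (replicate n 4) = c1 n) \<and>
       (\<forall>n. circ_coeff (snd F) (replicate n 4) = c2 n)"
    using ex1_pair[OF bivariant_bijection[of q1 c1] bivariant_bijection[of q2 c2]]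
    unfolding bi by (simp add: conj_ac)
  show "\<exists>!F :: series \<times> series.
       valid_series (fst F) \<and> valid_series (snd F) \<and> vec_variant antivar (fst F) (snd F) \<and>
       (\<forall>n. circ_coeff (fst F) (replicate n 5) = c1 n) \<and>
       (\<forall>n. circ_coeff (snd F) (replicate n 5) = c2 n)"
    using ex1_pair[OF antivariant_bijection[of q1 c1] antivariant_bijection[of q2 c2]]
    unfolding anti by (simp add: conj_ac)
  show "\<exists>!f. valid_series f \<and> single_variant leftvar scalar_val f \<and>
       (\<forall>n. circ_coeff f (replicate n 4) = c n)"
    unfolding single by (rule left_variant_bijection) simp
  show "\<exists>!f. valid_series f \<and> single_variant leftvar pseudo_val f \<and>
       (\<forall>n. circ_coeff f (replicate n 4) = c n)"
    unfolding single by (rule left_variant_bijection) simp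
  show "\<exists>!f. valid_series f \<and> single_variant rightvar scalar_val f \<and>
       (\<forall>n. circ_coeff f (replicate n 5) = c n)"
    unfolding single by (rule right_variant_bijection) simp
  show "\<exists>!f. valid_series f \<and> single_variant rightvar pseudo_val f \<and>
       (\<forall>n. circ_coeff f (replicate n 5) = c n)"
    unfolding single by (rule right_variant_bijection) simp
qed

end
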